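(* Let $G$ be a non-elementary hyperbolic group. Then there exist a set $X$ and a transitive right action of $G$ on $X$ such that the growth of this action is maximal and, for every element $g\in G$, every orbit of the cyclic group $\langle g\rangle$ on $X$ is finite.
   Context: A group is elementary if it contains a cyclic subgroup of finite index. Let $G$ be generated by a finite set $S$; $|g|$ is the word length of $g\in G$ with respect to $S$, and $f(n)=\#\{g\in G : |g|\le n\}$ is the growth function of $G$. For a transitive right action of $G$ on a set $X$ and a base point $o\in X$, the growth function of the action is $f_{o,S}(n)=\#\{og : g\in G,\ |g|\le n\}$. For functions $f_1,f_2:\mathbb N_0\to\mathbb N_0$ write $f_1\prec f_2$ if there is a non-negative integer $C$ with $f_1(n)\le f_2(n+C)$ for all $n\in\mathbb N_0$; $f_1,f_2$ are equivalent if $f_1\prec f_2$ and $f_2\prec f_1$. (Growth functions for different base points are equivalent.) The growth of the action is called maximal if $f_{o,S}$ is equivalent to $f$. *)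

theory Defs
  imports "HOL-Algebra.Generated_Groups" "HOL-Algebra.Group_Action" Complex_Main
begin

section \<open>Word length and growth\<close>

text \<open>
  Generating sets are not assumed to be symmetric: words are taken over the generators and their
  inverses. When \<open>S\<close> does not generate \<open>g\<close>, the value of \<open>word_length G S g\<close> is meaningless.
\<close>

definition word_length :: "('g, 'm) monoid_scheme \<Rightarrow> 'g set \<Rightarrow> 'g \<Rightarrow> nat" where
  "word_length G S g =
     (LEAST n. \<exists>w. length w = n \<and> set w \<subseteq> S \<union> m_inv G ` S \<and> foldr (\<otimes>\<^bsub>G\<^esub>) w \<one>\<^bsub>G\<^esub> = g)"

definition word_dist :: "('g, 'm) monoid_scheme \<Rightarrow> 'g set \<Rightarrow> 'g \<Rightarrow> 'g \<Rightarrow> real" where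
  "word_dist G S x y = real (word_length G S (inv\<^bsub>G\<^esub> x \<otimes>\<^bsub>G\<^esub> y))"

definition word_ball :: "('g, 'm) monoid_scheme \<Rightarrow> 'g set \<Rightarrow> nat \<Rightarrow> 'g set" where
  "word_ball G S n = {g \<in> carrier G. word_length G S g \<le> n}"

definition group_growth :: "('g, 'm) monoid_scheme \<Rightarrow> 'g set \<Rightarrow> nat \<Rightarrow> nat" where
  "group_growth G S n = card (word_ball G S n)"

definition growth_le :: "(nat \<Rightarrow> nat) \<Rightarrow> (nat \<Rightarrow> nat) \<Rightarrow> bool" where
  "growth_le f1 f2 \<longleftrightarrow> (\<exists>C. \<forall>n. f1 n \<le> f2 (n + C))"

definition growth_equiv :: "(nat \<Rightarrow> nat) \<Rightarrow> (nat \<Rightarrow> nat) \<Rightarrow> bool" where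
  "growth_equiv f1 f2 \<longleftrightarrow> growth_le f1 f2 \<and> growth_le f2 f1"


section \<open>Hyperbolic and elementary groups\<close>

definition gromov_product :: "('p \<Rightarrow> 'p \<Rightarrow> real) \<Rightarrow> 'p \<Rightarrow> 'p \<Rightarrow> 'p \<Rightarrow> real" where
  "gromov_product d w x y = (d x w + d y w - d x y) / 2"

definition gromov_hyperbolic :: "'p set \<Rightarrow> ('p \<Rightarrow> 'p \<Rightarrow> real) \<Rightarrow> bool" where
  "gromov_hyperbolic M d \<longleftrightarrow>
     (\<exists>\<delta>\<ge>0. \<forall>w\<in>M. \<forall>x\<in>M. \<forall>y\<in>M. \<forall>z\<in>M.
        gromov_product d w x z
          \<ge> min (gromov_product d w x y) (gromov_product d w y z) - \<delta>)"

definition finite_generating_set :: "('g, 'm) monoid_scheme \<Rightarrow> 'g set \<Rightarrow> bool" where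
  "finite_generating_set G S \<longleftrightarrow> finite S \<and> S \<subseteq> carrier G \<and> generate G S = carrier G"

definition hyperbolic_group :: "('g, 'm) monoid_scheme \<Rightarrow> bool" where
  "hyperbolic_group G \<longleftrightarrow>
     group G \<and>
     (\<exists>S. finite_generating_set G S \<and> gromov_hyperbolic (carrier G) (word_dist G S))"

definition elementary_group :: "('g, 'm) monoid_scheme \<Rightarrow> bool" where
  "elementary_group G \<longleftrightarrow>
     group G \<and> (\<exists>g\<in>carrier G. finite (rcosets\<^bsub>G\<^esub> (generate G {g})))"


section \<open>Right actions\<close>

text \<open>
  The library's \<^locale>\<open>group_action\<close> is a left action, hence a separate locale.
\<close>

locale right_action = group G
  for G :: "('g, 'm) monoid_scheme" (structure) +
  fixes X :: "'x set" and act :: "'x \<Rightarrow> 'g \<Rightarrow> 'x"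
  assumes act_closed: "\<lbrakk>x \<in> X; g \<in> carrier G\<rbrakk> \<Longrightarrow> act x g \<in> X"
    and act_one: "x \<in> X \<Longrightarrow> act x \<one> = x"
    and act_mult: "\<lbrakk>x \<in> X; g \<in> carrier G; h \<in> carrier G\<rbrakk> \<Longrightarrow> act x (g \<otimes> h) = act (act x g) h"

locale transitive_right_action = right_action +
  assumes nonempty: "X \<noteq> {}"
    and transitive: "\<lbrakk>x \<in> X; y \<in> X\<rbrakk> \<Longrightarrow> \<exists>g\<in>carrier G. act x g = y"

definition action_growth ::
    "('g, 'm) monoid_scheme \<Rightarrow> 'g set \<Rightarrow> ('x \<Rightarrow> 'g \<Rightarrow> 'x) \<Rightarrow> 'x \<Rightarrow> nat \<Rightarrow> nat" where
  "action_growth G S act p n = card (act p ` word_ball G S n)"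

text \<open>
  For a transitive action, different base points give equivalent growth functions, so
  quantifying over all base points is the same as fixing one.
\<close>

definition maximal_growth ::
    "('g, 'm) monoid_scheme \<Rightarrow> 'g set \<Rightarrow> 'x set \<Rightarrow> ('x \<Rightarrow> 'g \<Rightarrow> 'x) \<Rightarrow> bool" where
  "maximal_growth G S X act \<longleftrightarrow>
     (\<forall>p\<in>X. growth_equiv (action_growth G S act p) (group_growth G S))"

definition cyclic_orbit ::
    "('g, 'm) monoid_scheme \<Rightarrow> ('x \<Rightarrow> 'g \<Rightarrow> 'x) \<Rightarrow> 'g \<Rightarrow> 'x \<Rightarrow> 'x set" where
  "cyclic_orbit G act g x = act x ` generate G {g}"

text \<open>
  HOL cannot quantify existentially over types. Points of a \<open>G\<close>-set are taken of type
  \<open>'g set\<close> in what follows: every transitive right \<open>G\<close>-set is isomorphic to a set of right cosets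
  \<open>H #> g\<close> with \<open>G\<close> acting by right multiplication, so this loses no generality.
\<close>

end

theory Submission
  imports Defs "HOL-Library.Countable_Set"
begin

text \<open>
  A transitive action is given by a subgroup \<open>H\<close>. Its cyclic orbits are finite as soon as \<open>H\<close> contains
  a positive power of every element, and its growth counts cosets of \<open>H\<close> meeting a ball. Such an \<open>H\<close>
  is the union of an increasing chain of torsion-free quasiconvex subgroups: given \<open>H\<^sub>j\<close> and an
  element \<open>g\<close> no positive power of which lies in \<open>H\<^sub>j\<close>, adjoin \<open>g\<^sup>n\<close> for a huge \<open>n\<close>. Reduced products in
  \<open>H\<^sub>j\<close> and \<open>g\<^sup>n\<close> are quasigeodesic, so the new subgroup is a free product, again torsion-free and
  quasiconvex.

  If two cosets \<open>H\<^sub>j s\<close> and \<open>H\<^sub>j t\<close> are merged by this step, then a long power \<open>g\<^sup>l\<close> or \<open>g\<^sup>-\<^sup>l\<close> is an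
  initial piece of an element of one of them, and deleting it shortens the representative. Thus at
  most \<open>2 f(N - M)\<close> cosets are lost in the ball of radius \<open>N\<close>, with \<open>M\<close> as large as desired. Since \<open>f\<close>
  doubles after a bounded shift of its argument (ping-pong with two independent loxodromic elements),
  the losses over all steps sum to at most half of \<open>f(N)\<close>, which the same doubling absorbs.

  The growth is measured with respect to an arbitrary generating set, while hyperbolicity is only
  given for one of them; hence the comparison of geodesics for two word lengths.
\<close>

section \<open>Gromov products for a length function\<close>

text \<open>The chain consists of torsion-free groups because a non-trivial torsion element of
  \<open>H\<close> may commute with \<open>g\<close>, and then \<open>H\<close> and a power of
  \<open>g\<close> generate no free product. An element \<open>x\<close> of infinite order cannot do
  so: its powers and those of \<open>g\<close> would have to follow each other, while quasiconvexity
  bounds by some \<open>K\<close> how far elements of \<open>H\<close> follow the axis of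
  \<open>g\<close>. All estimates are inequalities between Gromov products at a point. Each use of
  the four-point inequality loses \<open>\<delta>\<close>, so an induction over products of
  arbitrary length must recover its own bound at every step; this is why the adjoined power is taken
  long in comparison with \<open>K\<close> and \<open>\<delta>\<close>. Equivalence of growth
  functions allows a shift of the argument but no factor, so a loss is harmless only as a definite
  fraction of \<open>f(N)\<close>. Since a finite ball involves only finitely many quotients of its
  elements, the union of the chain acts on it like one of its members, and the bounds pass to the
  limit.\<close>

locale length_group = group G for G :: "('g, 'm) monoid_scheme" (structure) +
  fixes L :: "'g \<Rightarrow> nat"
  assumes L_one: "L \<one> = 0"
    and L_eq_0: "\<lbrakk>x \<in> carrier G; L x = 0\<rbrakk> \<Longrightarrow> x = \<one>"
    and L_inv: "x \<in> carrier G \<Longrightarrow> L (inv x) = L x"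
    and L_mult: "\<lbrakk>x \<in> carrier G; y \<in> carrier G\<rbrakk> \<Longrightarrow> L (x \<otimes> y) \<le> L x + L y"
    and finite_ball: "finite {x \<in> carrier G. L x \<le> r}"
    and geodesic_split: "\<lbrakk>x \<in> carrier G; k \<le> L x\<rbrakk> \<Longrightarrow>
      \<exists>y\<in>carrier G. L y = k \<and> L (inv y \<otimes> x) = L x - k"
begin

definition d :: "'g \<Rightarrow> 'g \<Rightarrow> real" where
  "d x y = real (L (inv x \<otimes> y))"

text \<open>The base point comes first. \<open>gp p x y \<le> D\<close> says that the detour from
  \<open>x\<close> to \<open>y\<close> through \<open>p\<close> costs at most \<open>2 * D\<close>,
  so that \<open>p\<close> lies near a geodesic; a large \<open>gp \<one> x y\<close> says that
  \<open>x\<close> and \<open>y\<close> have a long initial piece in common.\<close>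

definition gp :: "'g \<Rightarrow> 'g \<Rightarrow> 'g \<Rightarrow> real" where
  "gp w x y = (d w x + d w y - d x y) / 2"

lemma inv_mult_cancel [simp]:
  assumes "x \<in> carrier G" "y \<in> carrier G"
  shows "inv x \<otimes> (x \<otimes> y) = y" "x \<otimes> (inv x \<otimes> y) = y"
  using assms by (simp_all flip: m_assoc)

lemma d_one [simp]: "x \<in> carrier G \<Longrightarrow> d \<one> x = L x"
  by (simp add: d_def)

lemma d_self [simp]: "x \<in> carrier G \<Longrightarrow> d x x = 0"
  by (simp add: d_def L_one)

lemma d_nonneg [simp]: "d x y \<ge> 0"
  by (simp add: d_def)

lemma d_commute:
  assumes "x \<in> carrier G" "y \<in> carrier G"
  shows "d x y = d y x"
proof -
  have "inv (inv x \<otimes> y) = inv y \<otimes> x"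
    using assms by (simp add: inv_mult_group)
  then show ?thesis
    unfolding d_def using L_inv[of "inv x \<otimes> y"] assms by simp
qed

lemma d_one_right [simp]: "x \<in> carrier G \<Longrightarrow> d x \<one> = L x"
  using d_commute[of x \<one>] by simp

lemma d_left [simp]:
  assumes "a \<in> carrier G" "x \<in> carrier G" "y \<in> carrier G"
  shows "d (a \<otimes> x) (a \<otimes> y) = d x y"
proof -
  have "inv (a \<otimes> x) \<otimes> (a \<otimes> y) = inv x \<otimes> y"
    using assms by (simp add: inv_mult_group m_assoc)
  then show ?thesis by (simp add: d_def)
qed

lemma d_left_one [simp]:
  assumes "a \<in> carrier G" "y \<in> carrier G"
  shows "d a (a \<otimes> y) = L y" "d (a \<otimes> y) a = L y"
  using d_left[of a \<one> y] d_left[of a y \<one>] assms by simp_all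

lemma d_triangle:
  assumes "x \<in> carrier G" "y \<in> carrier G" "z \<in> carrier G"
  shows "d x z \<le> d x y + d y z"
proof -
  have "inv x \<otimes> z = (inv x \<otimes> y) \<otimes> (inv y \<otimes> z)"
    using assms by (simp add: m_assoc)
  then show ?thesis
    unfolding d_def using L_mult[of "inv x \<otimes> y" "inv y \<otimes> z"] assms
    by (simp flip: of_nat_add)
qed

lemma gp_left [simp]:
  assumes "a \<in> carrier G" "w \<in> carrier G" "x \<in> carrier G" "y \<in> carrier G"
  shows "gp (a \<otimes> w) (a \<otimes> x) (a \<otimes> y) = gp w x y"
  using assms by (simp add: gp_def)

lemma gp_translate:
  assumes "w \<in> carrier G" "x \<in> carrier G" "y \<in> carrier G"
  shows "gp w x y = gp \<one> (inv w \<otimes> x) (inv w \<otimes> y)"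
  using gp_left[of "inv w" w x y] assms by simp

lemma gp_commute: "\<lbrakk>x \<in> carrier G; y \<in> carrier G\<rbrakk> \<Longrightarrow> gp w x y = gp w y x"
  using d_commute[of x y] by (simp add: gp_def)

lemma gp_nonneg:
  assumes "w \<in> carrier G" "x \<in> carrier G" "y \<in> carrier G"
  shows "gp w x y \<ge> 0"
  using d_triangle[of x w y] d_commute[of w x] assms by (simp add: gp_def)

lemma gp_le:
  assumes "w \<in> carrier G" "x \<in> carrier G" "y \<in> carrier G"
  shows "gp w x y \<le> d w x" "gp w x y \<le> d w y"
  using d_triangle[of w x y] d_triangle[of w y x] d_commute[of x y] assms
  by (simp_all add: gp_def)

text \<open>The products at the two ends of one side of a triangle share its length. This converts
  closeness to a geodesic into a long common initial piece, and back.\<close>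

lemma gp_flip:
  assumes "w \<in> carrier G" "x \<in> carrier G" "y \<in> carrier G"
  shows "gp w x y + gp x w y = d w x"
  using d_commute[of w x] assms by (simp add: gp_def field_simps)

lemma gp_ge:
  assumes "w \<in> carrier G" "x \<in> carrier G" "y \<in> carrier G"
  shows "gp w x y \<ge> d w x - d x y"
  using gp_flip[of w x y] gp_le(2)[of x w y] assms by simp

lemma gp_base:
  assumes "w \<in> carrier G" "w' \<in> carrier G" "x \<in> carrier G" "y \<in> carrier G"
  shows "gp w x y \<le> gp w' x y + d w w'"
  using d_triangle[of w w' x] d_triangle[of w w' y] assms
  by (simp add: gp_def field_simps)

lemma gp_right:
  assumes "w \<in> carrier G" "x \<in> carrier G" "x' \<in> carrier G" "y \<in> carrier G"
  shows "gp w x y \<le> gp w x' y + d x x'"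
  using d_triangle[of w x' x] d_triangle[of x' x y] d_commute[of x x'] assms
  by (simp add: gp_def field_simps)

lemma L_int_pow:
  assumes "g \<in> carrier G"
  shows "L (g [^] (k::int)) \<le> nat \<bar>k\<bar> * L g"
proof -
  have nat: "L (x [^] (n::nat)) \<le> n * L x" if "x \<in> carrier G" for x n
  proof (induction n)
    case (Suc n)
    then show ?case using L_mult[of "x [^] n" x] that by simp
  qed (simp add: L_one)
  show ?thesis
  proof (cases k rule: int_cases2)
    case (nonneg n)
    then show ?thesis using nat[OF assms, of n] by (simp add: int_pow_int)
  next
    case (nonpos n)
    then have "L (g [^] k) = L (g [^] n)"
      using assms by (simp add: int_pow_neg L_inv int_pow_int)
    then show ?thesis using nat[OF assms, of n] nonpos by simp
  qed
qed

lemma L_nat_pow: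
  assumes "g \<in> carrier G" "k \<le> N"
  shows "real (L (g [^] (k::nat))) \<le> real N * real (L g)"
proof -
  have "L (g [^] k) \<le> k * L g"
    using L_int_pow[OF assms(1), of "int k"] unfolding int_pow_int by simp
  also have "\<dots> \<le> N * L g"
    using assms(2) by (rule mult_le_mono1)
  finally show ?thesis by (simp flip: of_nat_mult)
qed

text \<open>Distinct powers leave every finite ball. The condition on \<bar>k\<bar> serves both
  directions of the axis and all non-zero multiples of \<open>n\<close>.\<close>

lemma exists_large_power:
  assumes "inj (\<lambda>k::int. g [^] k)" "g \<in> carrier G"
  shows "\<exists>n>0. \<forall>k::int. \<bar>k\<bar> \<ge> n \<longrightarrow> L (g [^] k) \<ge> B"
proof -
  let ?A = "(\<lambda>k::int. g [^] k) -` {x \<in> carrier G. L x \<le> B}"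
  define n where "n = Max (insert 0 (abs ` ?A)) + 1"
  have fin: "finite (insert 0 (abs ` ?A))"
    by (intro finite.insertI finite_imageI finite_vimageI finite_ball assms(1))
  have n: "\<bar>k\<bar> < n" if "L (g [^] k) \<le> B" for k
  proof -
    have "\<bar>k\<bar> \<in> insert 0 (abs ` ?A)" using that assms(2) by auto
    then have "\<bar>k\<bar> \<le> Max (insert 0 (abs ` ?A))" by (rule Max_ge[OF fin])
    then show ?thesis unfolding n_def by linarith
  qed
  have "n > 0"
  proof -
    have "0 \<le> Max (insert 0 (abs ` ?A))" by (rule Max_ge[OF fin]) simp
    then show ?thesis unfolding n_def by linarith
  qed
  moreover have "B \<le> L (g [^] k)" if "n \<le> \<bar>k\<bar>" for k
    using n[of k] that by linarith
  ultimately show ?thesis by blast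
qed

text \<open>\<open>N\<close> depends on \<open>R\<close> alone, so it can be fixed before the
  sequence and used to decide how long other elements must be.\<close>

lemma pigeonhole_ball:
  "\<exists>N. \<forall>f. (\<forall>k\<le>N::nat. f k \<in> carrier G \<and> L (f k) \<le> R) \<longrightarrow> (\<exists>i j. i < j \<and> j \<le> N \<and> f i = f j)"
proof -
  let ?N = "card {x \<in> carrier G. L x \<le> R}"
  have "\<exists>i j. i < j \<and> j \<le> ?N \<and> f i = f j"
    if "\<forall>k\<le>?N. f k \<in> carrier G \<and> L (f k) \<le> R" for f :: "nat \<Rightarrow> 'g"
  proof -
  have "f ` {..?N} \<subseteq> {x \<in> carrier G. L x \<le> R}" using that by auto
  then have "\<not> inj_on f {..?N}"
    using card_inj_on_le[of f "{..?N}" "{x \<in> carrier G. L x \<le> R}"] finite_ball[of R] by auto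
  then show "\<exists>i j. i < j \<and> j \<le> ?N \<and> f i = f j"
    by (auto simp: inj_on_def) (metis linorder_neqE_nat)
  qed
  then show ?thesis by blast
qed

end

lemma (in group) int_pow_inj_iff:
  assumes "g \<in> carrier G"
  shows "inj (\<lambda>k::int. g [^] k) \<longleftrightarrow> (\<forall>n>0. g [^] (n::nat) \<noteq> \<one>)"
proof
  assume inj: "inj (\<lambda>k::int. g [^] k)"
  show "\<forall>n>0. g [^] (n::nat) \<noteq> \<one>"
  proof (intro allI impI notI)
    fix n :: nat assume "n > 0" "g [^] n = \<one>"
    then have "g [^] (int n) = g [^] (0::int)" by (simp add: int_pow_int)
    with inj \<open>n > 0\<close> show False using injD[OF inj, of "int n" 0] by simp
  qed
next
  assume *: "\<forall>n>0. g [^] (n::nat) \<noteq> \<one>"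
  have "i = j" if "i \<le> j" "g [^] i = g [^] j" for i j :: int
  proof (rule ccontr)
    assume "i \<noteq> j"
    have "g [^] (j - i) = \<one>"
      using that assms int_pow_diff[of g j i] by simp
    then have "g [^] int (nat (j - i)) = \<one>"
      using that by simp
    then show False
      using *[rule_format, of "nat (j - i)"] that \<open>i \<noteq> j\<close> by (simp add: int_pow_int del: int_nat_eq)
  qed
  then show "inj (\<lambda>k::int. g [^] k)"
    by (intro injI) (metis (no_types) linear)
qed

locale hyperbolic_length = length_group G L
  for G :: "('g, 'm) monoid_scheme" (structure) and L +
  fixes \<delta> :: real
  assumes delta_nonneg: "\<delta> \<ge> 0"
    and hyperbolic: "\<lbrakk>w \<in> carrier G; x \<in> carrier G; y \<in> carrier G; z \<in> carrier G\<rbrakk> \<Longrightarrow>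
      gp w x z \<ge> min (gp w x y) (gp w y z) - \<delta>"
begin

lemma hyp_cases:
  assumes "w \<in> carrier G" "x \<in> carrier G" "y \<in> carrier G" "z \<in> carrier G"
  shows "gp w x y \<le> gp w x z + \<delta> \<or> gp w y z \<le> gp w x z + \<delta>"
  using hyperbolic[OF assms] by linarith

text \<open>The usual form of the four-point inequality below: if \<open>x\<close> and
  \<open>y\<close> stay together beyond \<open>c + \<delta>\<close> as seen from \<open>w\<close>,
  then a point that leaves \<open>x\<close> early leaves \<open>y\<close> early. The price is one
  \<open>\<delta>\<close>.\<close>

lemma hyp_le:
  assumes "gp w x z \<le> c" "gp w x y > c + \<delta>"
    and "w \<in> carrier G" "x \<in> carrier G" "y \<in> carrier G" "z \<in> carrier G"
  shows "gp w y z \<le> c + \<delta>"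
  using hyp_cases[OF assms(3-6)] assms(1,2) by linarith

lemma hyp_ge:
  assumes "gp w x y \<ge> c" "gp w y z \<ge> c"
    and "w \<in> carrier G" "x \<in> carrier G" "y \<in> carrier G" "z \<in> carrier G"
  shows "gp w x z \<ge> c - \<delta>"
  using hyp_cases[OF assms(3-6)] assms(1,2) by linarith

end


section \<open>Elements of infinite order\<close>

context hyperbolic_length
begin

text \<open>By translation, each power of \<open>g\<close> lies near all geodesics between an
  earlier and a later power: the powers form an axis.\<close>

definition loxodromic :: "'g \<Rightarrow> bool" where
  "loxodromic g \<longleftrightarrow> (\<exists>K. \<forall>(i::nat) (j::nat). gp \<one> (inv (g [^] i)) (g [^] j) \<le> K)"

text \<open>With \<open>K = gp \<one> (inv u) u\<close> the hypothesis reads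
  \<open>L u \<ge> 2 * K + 4 * \<delta> + 1\<close>: less than half of a factor cancels between
  neighbours. Hence \<open>inv (u [^] Suc n)\<close> still begins like \<open>inv u\<close>, and the
  same bound \<open>K + \<delta>\<close> comes back at every step.\<close>

lemma long_square_powers:
  assumes "u \<in> carrier G" "real (L (u \<otimes> u)) \<ge> real (L u) + 4 * \<delta> + 1"
  shows "gp \<one> (inv (u [^] (n::nat))) u \<le> gp \<one> (inv u) u + \<delta>"
proof (induction n)
  case 0
  then show ?case
    using assms delta_nonneg gp_nonneg[of \<one> "inv u" u] by (simp add: gp_def)
next
  case (Suc n)
  have "d (inv u) u = L (u \<otimes> u)"
    using assms by (simp add: d_def)
  then have Lu: "real (L u) \<ge> 2 * gp \<one> (inv u) u + 4 * \<delta> + 1"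
    using assms by (simp add: gp_def L_inv field_simps)
  have "inv (u [^] Suc n) = inv u \<otimes> inv (u [^] n)"
    using assms by (simp add: inv_mult_group)
  then have "gp \<one> (inv u) (inv (u [^] Suc n)) = gp u \<one> (inv (u [^] n))"
    using assms gp_left[of "inv u" u \<one> "inv (u [^] n)"] by simp
  also have "\<dots> = L u - gp \<one> (inv (u [^] n)) u"
    using gp_flip[of \<one> u "inv (u [^] n)"] gp_commute[of u "inv (u [^] n)" \<one>] assms by simp
  finally have "gp \<one> (inv u) (inv (u [^] Suc n)) > gp \<one> (inv u) u + \<delta>"
    using Suc Lu gp_nonneg[of \<one> "inv u" u] delta_nonneg assms by simp
  then show ?case
    using assms by (intro hyp_le[of \<one> "inv u"]) auto
qed

lemma long_square_loxodromic:
  assumes u: "u \<in> carrier G" and sq: "real (L (u \<otimes> u)) \<ge> real (L u) + 4 * \<delta> + 1"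
  shows "loxodromic u"
proof -
  let ?K = "gp \<one> (inv u) u"
  have "d (inv u) u = L (u \<otimes> u)"
    using u by (simp add: d_def)
  then have Lu: "real (L u) \<ge> 2 * ?K + 4 * \<delta> + 1"
    using sq u by (simp add: gp_def L_inv field_simps)
  have sq': "real (L (inv u \<otimes> inv u)) \<ge> real (L (inv u)) + 4 * \<delta> + 1"
    using sq u L_inv[of "u \<otimes> u"] by (simp add: inv_mult_group L_inv)
  have "gp \<one> (inv (u [^] i)) (u [^] j) \<le> ?K + \<delta> + \<delta>" for i j :: nat
  proof (cases j)
    case 0
    then show ?thesis
      using u delta_nonneg gp_nonneg[of \<one> "inv u" u] by (simp add: gp_def)
  next
    case (Suc k)
    have eq: "u [^] Suc k = u \<otimes> u [^] k"
      using u by (metis nat_pow_Suc2)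
    have "gp \<one> (inv u) (u [^] k) \<le> ?K + \<delta>"
      using long_square_powers[of "inv u" k] sq' u
      by (simp add: nat_pow_inv gp_commute)
    moreover have "gp \<one> u (u [^] Suc k) = gp (inv u) \<one> (u [^] k)"
      using u gp_left[of u "inv u" \<one> "u [^] k"] unfolding eq by simp
    moreover have "gp \<one> (inv u) (u [^] k) + gp (inv u) \<one> (u [^] k) = L u"
      using gp_flip[of \<one> "inv u" "u [^] k"] u by (simp add: L_inv)
    ultimately have *: "gp \<one> u (u [^] Suc k) > (?K + \<delta>) + \<delta>"
      using Lu gp_nonneg[of \<one> "inv u" u] delta_nonneg u by simp
    have "gp \<one> (u [^] Suc k) (inv (u [^] i)) \<le> (?K + \<delta>) + \<delta>"
      using long_square_powers[OF u sq, of i] u gp_commute[of u "inv (u [^] i)" \<one>]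
      by (intro hyp_le[OF _ *]) auto
    then show ?thesis
      using Suc u by (metis gp_commute inv_closed nat_pow_closed)
  qed
  then show ?thesis
    unfolding loxodromic_def by blast
qed

text \<open>By \<open>long_square_powers\<close>, a further factor \<open>u\<close> adds more to the
  length than it cancels, so the length of the powers increases strictly.\<close>

lemma long_square_infinite_order:
  assumes u: "u \<in> carrier G" and sq: "real (L (u \<otimes> u)) \<ge> real (L u) + 4 * \<delta> + 1"
  shows "inj (\<lambda>k::int. u [^] k)"
proof -
  let ?K = "gp \<one> (inv u) u"
  have "d (inv u) u = L (u \<otimes> u)"
    using u by (simp add: d_def)
  then have Lu: "real (L u) \<ge> 2 * ?K + 4 * \<delta> + 1"
    using sq u by (simp add: gp_def L_inv field_simps)
  have "L (u [^] n) \<ge> n" for n :: nat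
  proof (induction n)
    case (Suc n)
    have "d (inv (u [^] n)) u = L (u [^] Suc n)"
      using u by (simp add: d_def)
    then have "L (u [^] Suc n) = L (u [^] n) + L u - 2 * gp \<one> (inv (u [^] n)) u"
      using u by (simp add: gp_def L_inv field_simps)
    then have "real (L (u [^] Suc n)) \<ge> L (u [^] n) + 1"
      using long_square_powers[OF u sq, of n] Lu delta_nonneg by simp
    then show ?case using Suc by linarith
  qed simp
  then have "u [^] n \<noteq> \<one>" if "n > 0" for n :: nat
    using that L_one by (metis not_less)
  then show ?thesis using u by (simp add: int_pow_inj_iff)
qed

lemma loxodromic_root:
  assumes g: "g \<in> carrier G" and "k > 0" and lox: "loxodromic (g [^] (k::nat))"
  shows "loxodromic g"
proof -
  let ?u = "g [^] k"
  from lox obtain K where K: "\<And>(i::nat) (j::nat). gp \<one> (inv (?u [^] i)) (?u [^] j) \<le> K"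
    unfolding loxodromic_def by blast
  have short: "L (g [^] (r::nat)) \<le> k * L g" if "r < k" for r
  proof -
    have "L (g [^] r) \<le> r * L g"
      using L_int_pow[OF g, of "int r"] by (simp add: int_pow_int)
    then show ?thesis using that by (meson less_imp_le mult_le_mono1 order_trans)
  qed
  have split: "g [^] i = ?u [^] (i div k) \<otimes> g [^] (i mod k)" for i :: nat
    using g by (simp add: nat_pow_pow nat_pow_mult)
  \<comment> \<open>Here the remainder stands on the left: inversion moves it to the right, where
    left invariance turns it into a distance.\<close>
  have split': "g [^] i = g [^] (i mod k) \<otimes> ?u [^] (i div k)" for i :: nat
    using g by (simp add: nat_pow_pow nat_pow_mult)
  have "gp \<one> (inv (g [^] i)) (g [^] j) \<le> K + 2 * (k * L g)" for i j :: nat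
  proof -
    let ?x = "?u [^] (i div k)" and ?y = "?u [^] (j div k)"
    have "gp \<one> (inv (g [^] i)) (g [^] j) \<le> gp \<one> (inv ?x) (g [^] j) + d (inv (g [^] i)) (inv ?x)"
      using g by (intro gp_right) auto
    moreover have "d (inv (g [^] i)) (inv ?x) \<le> k * L g"
    proof -
      have "inv (g [^] i) = inv ?x \<otimes> inv (g [^] (i mod k))"
        using g split'[of i] by (simp add: inv_mult_group)
      then have "d (inv (g [^] i)) (inv ?x) = L (g [^] (i mod k))"
        using g by (simp add: L_inv)
      then show ?thesis using short[of "i mod k"] \<open>k > 0\<close> by (simp flip: of_nat_mult)
    qed
    moreover have "gp \<one> (g [^] j) (inv ?x) \<le> gp \<one> ?y (inv ?x) + d (g [^] j) ?y"
      using g by (intro gp_right) auto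
    moreover have "d (g [^] j) ?y \<le> k * L g"
    proof -
      have "d (g [^] j) ?y = L (g [^] (j mod k))"
        using g split[of j] by simp
      then show ?thesis using short[of "j mod k"] \<open>k > 0\<close> by (simp flip: of_nat_mult)
    qed
    ultimately show ?thesis
      using K[of "i div k" "j div k"] g gp_commute[of "g [^] j" "inv ?x" \<one>]
        gp_commute[of "?y" "inv ?x" \<one>] by simp
  qed
  then show ?thesis unfolding loxodromic_def by blast
qed

text \<open>
  If the square of \<open>u\<close> is short, then \<open>u\<close> nearly fixes the midpoint \<open>m\<close> of a geodesic from \<open>\<one>\<close> to
  \<open>u\<close>. An element \<open>v\<close> commuting with \<open>u\<close> that is short compared to \<open>u\<close> can only move \<open>m\<close> along that
  geodesic, while \<open>u\<close> exchanges its two halves; hence \<open>v\<close> nearly fixes \<open>m\<close> as well.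
\<close>

lemma commuting_displacement:
  assumes G: "u \<in> carrier G" "v \<in> carrier G" "m \<in> carrier G"
    and comm: "u \<otimes> v = v \<otimes> u"
    and sq: "real (L (u \<otimes> u)) < real (L u) + 4 * \<delta> + 1"
    and m: "L m = L u div 2" "L (inv m \<otimes> u) = L u - L u div 2"
    and long: "real (L u) > 2 * real (L v) + 8 * \<delta> + 4"
  shows "L (inv m \<otimes> (v \<otimes> m)) \<le> 10 * \<delta> + 4"
proof -
  define t where "t = real (L u div 2)"
  have t: "real (L u) - 1 \<le> 2 * t" "2 * t \<le> real (L u)"
    unfolding t_def by linarith+
  have Lm: "L m = t" and dmu: "d m u = L u - t"
    using m G by (auto simp: t_def d_def of_nat_diff)
  have umv: "u \<otimes> m \<in> carrier G" "v \<otimes> m \<in> carrier G" "u \<otimes> u \<in> carrier G" "v \<otimes> u \<in> carrier G"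
    using G by simp_all
  \<comment> \<open>Since the square of \<open>u\<close> is short, \<open>\<one>\<close> and
    \<open>u \<otimes> u\<close> have about half of their way from \<open>u\<close> in common;
    \<open>m\<close> and \<open>u \<otimes> m\<close> lie on these two geodesics near the place
    where they separate.\<close>
  have mum: "d m (u \<otimes> m) \<le> 8 * \<delta> + 2"
  proof -
    have uu: "d u m = L u - t" "d u (u \<otimes> u) = L u" "d u (u \<otimes> m) = t" "d u \<one> = L u"
      "d m \<one> = t" "d m (u \<otimes> u) = d (u \<otimes> u) m" "d (u \<otimes> m) (u \<otimes> u) = L u - t"
      "d \<one> (u \<otimes> u) = L (u \<otimes> u)"
      using G Lm dmu d_commute[of u m] d_commute[of m "u \<otimes> u"] by simp_all
    have "gp u m \<one> = L u - t"
      using uu unfolding gp_def by simp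
    moreover have "gp u \<one> (u \<otimes> u) \<ge> (real (L u) - 4 * \<delta> - 1) / 2"
      using uu sq unfolding gp_def by (simp add: field_simps)
    moreover have "gp u (u \<otimes> u) (u \<otimes> m) = t"
      using uu G d_commute[of "u \<otimes> m" "u \<otimes> u"] unfolding gp_def by simp
    ultimately have "gp u m (u \<otimes> m) \<ge> (real (L u) - 4 * \<delta> - 1) / 2 - \<delta> - \<delta>"
      using t delta_nonneg G umv
      by (intro hyp_ge[of _ u m "u \<otimes> u"] hyp_ge[of _ u m \<one>]) (auto simp: field_simps)
    then show ?thesis
      using uu unfolding gp_def by (simp add: field_simps)
  qed
  have ds: "d v (v \<otimes> m) = t" "d (v \<otimes> m) v = t" "d (v \<otimes> m) (v \<otimes> u) = L u - t" "d v (v \<otimes> u) = L u"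
    "d u (v \<otimes> u) = L v" "d (v \<otimes> u) u = L v" "d v \<one> = L v"
    using G Lm dmu d_left_one(1)[of u v] d_left_one(2)[of u v] comm by simp_all
  \<comment> \<open>\<open>v \<otimes> m\<close> lies on a geodesic from \<open>v\<close> to
    \<open>v \<otimes> u\<close>, whose ends are within \<open>L v\<close> of \<open>\<one>\<close>
    and \<open>u\<close>. As \<open>L v\<close> is small compared with \<open>L u\<close>, both ends
    can be exchanged, one \<open>\<delta>\<close> each.\<close>
  have "gp (v \<otimes> m) v (v \<otimes> u) = 0"
    using ds unfolding gp_def by simp
  moreover have "gp (v \<otimes> m) v \<one> \<ge> t - L v"
    using gp_ge[of "v \<otimes> m" v \<one>] ds G by simp
  moreover have "gp (v \<otimes> m) (v \<otimes> u) u \<ge> L u - t - L v"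
    using gp_ge[of "v \<otimes> m" "v \<otimes> u" u] ds G by simp
  ultimately have gps: "gp (v \<otimes> m) v (v \<otimes> u) \<le> 0" "gp (v \<otimes> m) v \<one> > 0 + \<delta>"
      "gp (v \<otimes> m) (v \<otimes> u) u > \<delta> + \<delta>"
    using t long delta_nonneg by linarith+
  have "gp (v \<otimes> m) (v \<otimes> u) \<one> \<le> \<delta>"
    using hyp_le[OF gps(1,2)] G umv gp_commute[of \<one> "v \<otimes> u"] by simp
  from hyp_le[OF this gps(3)] have "gp (v \<otimes> m) u \<one> \<le> \<delta> + \<delta>"
    using G umv by simp
  then have near: "d (v \<otimes> m) u + d (v \<otimes> m) \<one> \<le> L u + 4 * \<delta>"
    using G unfolding gp_def by (simp add: field_simps)
  \<comment> \<open>Here commutation enters: \<open>u\<close> moves \<open>v \<otimes> m\<close> as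
    little as it moves \<open>m\<close>, and it carries \<open>\<one>\<close> to \<open>u\<close>.
    So \<open>v \<otimes> m\<close> has nearly the same distance to \<open>\<one>\<close> and to
    \<open>u\<close>.\<close>
  have "d u (u \<otimes> (v \<otimes> m)) = d (v \<otimes> m) \<one>"
    using G by simp
  moreover have "d (u \<otimes> (v \<otimes> m)) (v \<otimes> m) = d m (u \<otimes> m)"
  proof -
    have "u \<otimes> (v \<otimes> m) = v \<otimes> (u \<otimes> m)"
      using G comm by (simp flip: m_assoc)
    then show ?thesis using G d_commute[of m "u \<otimes> m"] by simp
  qed
  moreover note d_triangle[of u "u \<otimes> (v \<otimes> m)" "v \<otimes> m"] d_triangle[of u "v \<otimes> m" "u \<otimes> (v \<otimes> m)"]
      d_commute[of u "v \<otimes> m"] d_commute[of "u \<otimes> (v \<otimes> m)" "v \<otimes> m"]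
  ultimately have "\<bar>d (v \<otimes> m) u - d (v \<otimes> m) \<one>\<bar> \<le> 8 * \<delta> + 2"
    using mum G umv by (simp only: m_closed abs_le_iff) linarith
  with near have half: "d (v \<otimes> m) u \<le> real (L u) / 2 + 6 * \<delta> + 1"
    "d (v \<otimes> m) \<one> \<le> real (L u) / 2 + 6 * \<delta> + 1"
    by (simp_all add: abs_le_iff)
  have "gp m \<one> u = 0"
    using Lm dmu G unfolding gp_def by simp
  then have "gp m \<one> (v \<otimes> m) \<le> \<delta> \<or> gp m (v \<otimes> m) u \<le> \<delta>"
    using hyp_cases[of m \<one> "v \<otimes> m" u] G by simp
  then have "d m (v \<otimes> m) \<le> 10 * \<delta> + 4"
    using half Lm dmu t delta_nonneg d_commute[of \<one> "v \<otimes> m"] G umv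
    unfolding gp_def by (auto simp: field_simps)
  then show ?thesis using G by (simp add: d_def)
qed

text \<open>Some power \<open>u\<close> of \<open>g\<close> is long compared with all
  \<open>g [^] i\<close>, \<open>i \<le> N\<close>. If its square were short, the conjugates of
  these \<open>g [^] i\<close> by the midpoint \<open>m\<close> would lie in a ball whose radius
  depends on \<open>\<delta>\<close> only, and two of them would coincide. So the square of
  \<open>u\<close> is long, and \<open>g\<close> inherits the property from its power
  \<open>u\<close>.\<close>

lemma infinite_order_loxodromic:
  assumes g: "g \<in> carrier G" and inj: "inj (\<lambda>k::int. g [^] k)"
  shows "loxodromic g"
proof -
  define R where "R = nat \<lfloor>10 * \<delta> + 4\<rfloor>"
  obtain N :: nat where N: "\<forall>f. (\<forall>k\<le>N. f k \<in> carrier G \<and> L (f k) \<le> R) \<longrightarrow> (\<exists>i j. i < j \<and> j \<le> N \<and> f i = f j)"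
    using pigeonhole_ball[of R] by (rule exE)
  obtain n :: int where "n > 0" and
    n: "\<And>k::int. \<bar>k\<bar> \<ge> n \<Longrightarrow> L (g [^] k) \<ge> nat \<lceil>2 * (N * L g) + 8 * \<delta> + 5\<rceil>"
    using exists_large_power[OF inj g] by blast
  define u where "u = g [^] nat n"
  have u: "u \<in> carrier G" using g by (simp add: u_def)
  have "u = g [^] n" using \<open>n > 0\<close> using int_pow_int[of G g "nat n"] by (simp add: u_def)
  then have Lu: "real (L u) > 2 * (N * L g) + 8 * \<delta> + 4"
    using n[OF abs_ge_self] by (simp only: nat_ceiling_le_eq)
  have "real (L (u \<otimes> u)) \<ge> real (L u) + 4 * \<delta> + 1"
  proof (rule ccontr)
    assume "\<not> ?thesis"
    then have sq: "real (L (u \<otimes> u)) < real (L u) + 4 * \<delta> + 1" by simp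
    obtain m where m: "m \<in> carrier G" "L m = L u div 2" "L (inv m \<otimes> u) = L u - L u div 2"
      using geodesic_split[OF u, of "L u div 2"] by auto
    have "L (inv m \<otimes> (g [^] i \<otimes> m)) \<le> R" if "i \<le> N" for i :: nat
    proof -
      have "L (g [^] i) \<le> i * L g"
        using L_int_pow[OF g, of "int i"] by (simp add: int_pow_int)
      then have "L (g [^] i) \<le> N * L g"
        using that by (meson mult_le_mono1 order_trans)
      then have "real (L (g [^] i)) \<le> N * L g"
        by (simp flip: of_nat_mult)
      then have "real (L u) > 2 * real (L (g [^] i)) + 8 * \<delta> + 4"
        using Lu by simp
      then have "real (L (inv m \<otimes> (g [^] i \<otimes> m))) \<le> 10 * \<delta> + 4"
        using commuting_displacement[OF u _ m(1) _ sq m(2,3), of "g [^] i"] g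
        by (simp add: u_def nat_pow_mult add.commute)
      then show ?thesis unfolding R_def by linarith
    qed
    then have "\<exists>i j. i < j \<and> j \<le> N \<and> inv m \<otimes> (g [^] i \<otimes> m) = inv m \<otimes> (g [^] j \<otimes> m)"
      using m(1) g by (intro N[THEN spec, THEN mp]) auto
    then obtain i j :: nat where ij: "i < j" "inv m \<otimes> (g [^] i \<otimes> m) = inv m \<otimes> (g [^] j \<otimes> m)"
      by blast
    then have "g [^] int i = g [^] int j"
      using m(1) g by (simp add: int_pow_int)
    then show False using injD[OF inj] ij(1) by fastforce
  qed
  then show ?thesis
    using long_square_loxodromic[OF u] loxodromic_root[OF g, of "nat n"] \<open>n > 0\<close>
    by (simp add: u_def)
qed

text \<open>If all squares are short, every long element begins like its inverse, for about half of
  its length. Let \<open>u\<close> and \<open>v\<close> point in opposite directions. Then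
  \<open>inv u\<close> begins like \<open>u\<close> and \<open>inv v\<close> like \<open>v\<close>,
  so \<open>u \<otimes> v\<close> is long, begins like \<open>u\<close>, and its inverse begins like
  \<open>inv v\<close>. These directions differ, a contradiction for
  \<open>u \<otimes> v\<close>.\<close>

lemma exists_infinite_order:
  assumes "infinite (carrier G)"
  shows "\<exists>g\<in>carrier G. inj (\<lambda>k::int. g [^] k)"
proof (rule ccontr)
  assume none: "\<not> ?thesis"
  have short: "real (L (u \<otimes> u)) < real (L u) + 4 * \<delta> + 1" if "u \<in> carrier G" for u
    using long_square_infinite_order[OF that] none that by fastforce
  have half: "gp \<one> u (inv u) > (real (L u) - 4 * \<delta> - 1) / 2" if "u \<in> carrier G" for u
    using short[OF that] that d_commute[of u "inv u"]
    by (simp add: gp_def L_inv d_def field_simps)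
  define r where "r = nat \<lceil>20 * \<delta> + 20\<rceil>"
  have r: "real r \<ge> 20 * \<delta> + 20" unfolding r_def by linarith
  have "\<not> carrier G \<subseteq> {x \<in> carrier G. L x \<le> 2 * r}"
    using assms finite_ball finite_subset by blast
  then obtain y' where y': "y' \<in> carrier G" "2 * r \<le> L y'" by fastforce
  obtain y where y: "y \<in> carrier G" "L y = 2 * r" using geodesic_split[OF y'] by auto
  obtain m where m: "m \<in> carrier G" "L m = r" "L (inv m \<otimes> y) = r"
    using geodesic_split[OF y(1), of r] y(2) by auto
  \<comment> \<open>The two ends of a geodesic of length \<open>2 * r\<close>, seen from its
    midpoint.\<close>
  define u v where "u = inv m" and "v = inv m \<otimes> y"
  have G: "u \<in> carrier G" "v \<in> carrier G" "inv u \<in> carrier G" "inv v \<in> carrier G"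
      "u \<otimes> v \<in> carrier G" "inv (u \<otimes> v) \<in> carrier G"
    using m y by (simp_all add: u_def v_def)
  have L: "L u = r" "L v = r" using m y by (simp_all add: u_def v_def L_inv)
  have "d u v = L y"
    using d_left[of "inv m" \<one> y] m y by (simp add: u_def v_def)
  then have uv: "gp \<one> u v = 0"
    using L y G by (simp add: gp_def)
  have iuv: "gp \<one> (inv u) v \<le> \<delta>"
    using hyp_le[of \<one> u v 0 "inv u"] uv half[OF G(1)] L r G delta_nonneg by simp
  have "gp \<one> v (inv v) > 0 + \<delta>"
    using half[OF G(2)] L r delta_nonneg by simp
  then have uiv: "gp \<one> (inv v) u \<le> \<delta>"
    using hyp_le[of \<one> v u 0 "inv v"] uv G gp_commute[of u v \<one>] by simp
  have duv: "d (inv u) v = L (u \<otimes> v)"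
    using G by (simp add: d_def)
  then have Luv: "real (L (u \<otimes> v)) \<ge> 2 * r - 2 * \<delta>"
    using iuv L G by (simp add: gp_def L_inv)
  have a: "gp \<one> u (u \<otimes> v) \<ge> r - \<delta>"
    using Luv L G delta_nonneg by (simp add: gp_def)
  have "d (inv v) (inv (u \<otimes> v)) = r"
    using G L by (simp add: inv_mult_group L_inv)
  then have b: "gp \<one> (inv v) (inv (u \<otimes> v)) \<ge> r - \<delta>"
    using Luv L G L_inv[of "u \<otimes> v"] L_inv[of v] delta_nonneg by (simp add: gp_def)
  have "gp \<one> (u \<otimes> v) (inv v) \<le> \<delta> + \<delta>"
    using hyp_le[OF _ _ one_closed, of u "inv v" \<delta> "u \<otimes> v"] uiv a r G delta_nonneg
      gp_commute[of u "inv v" \<one>] by simp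
  then have "gp \<one> (inv (u \<otimes> v)) (u \<otimes> v) \<le> \<delta> + \<delta> + \<delta>"
    using hyp_le[OF _ _ one_closed, of "inv v" "u \<otimes> v" "\<delta> + \<delta>" "inv (u \<otimes> v)"] b r G delta_nonneg
      gp_commute[of "u \<otimes> v" "inv v" \<one>] by simp
  then show False
    using half[OF G(5)] Luv r G gp_commute[of "u \<otimes> v" "inv (u \<otimes> v)" \<one>] delta_nonneg by simp
qed

end


section \<open>Powers and quasiconvex subgroups\<close>

lemma (in group) int_pow_intertwine:
  assumes "a \<in> carrier G" "b \<in> carrier G" "x \<in> carrier G" "a \<otimes> x = x \<otimes> b"
  shows "a [^] (m::int) \<otimes> x = x \<otimes> b [^] m"
proof -
  have nat: "a [^] n \<otimes> x = x \<otimes> b [^] n" for n :: nat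
  proof (induction n)
    case (Suc n)
    have "a [^] Suc n \<otimes> x = a [^] n \<otimes> (x \<otimes> b)"
      using assms by (simp add: m_assoc)
    also have "\<dots> = (a [^] n \<otimes> x) \<otimes> b"
      using assms by (simp add: m_assoc)
    also have "\<dots> = x \<otimes> b [^] Suc n"
      using Suc assms by (simp add: m_assoc)
    finally show ?case .
  qed (use assms in simp)
  show ?thesis
  proof (cases m rule: int_cases2)
    case (nonneg n)
    then show ?thesis using nat by (simp add: int_pow_int)
  next
    case (nonpos n)
    have "inv (a [^] n) \<otimes> x = inv (a [^] n) \<otimes> (x \<otimes> b [^] n) \<otimes> inv (b [^] n)"
      using assms by (simp add: m_assoc)
    also have "\<dots> = x \<otimes> inv (b [^] n)"
      using assms by (simp flip: nat) (simp flip: m_assoc)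
    finally show ?thesis using nonpos assms by (simp add: int_pow_neg int_pow_int)
  qed
qed

text \<open>Passing one factor \<open>x\<close> turns a multiple of \<open>p\<close> in the exponent
  into the same multiple of \<open>q\<close>; the factor \<open>p ^ k\<close> leaves enough
  divisibility for \<open>k\<close> passages.\<close>

lemma (in group) int_pow_intertwine_iterate:
  assumes "g \<in> carrier G" "x \<in> carrier G" "g [^] (p::int) \<otimes> x = x \<otimes> g [^] (q::int)"
  shows "g [^] (p ^ k * m) \<otimes> x [^] (k::nat) = x [^] k \<otimes> g [^] (q ^ k * m)"
proof (induction k arbitrary: m)
  case (Suc k)
  have "g [^] (p ^ Suc k * m) \<otimes> x [^] Suc k = (g [^] (p ^ k * (p * m)) \<otimes> x [^] k) \<otimes> x"
    using assms by (simp add: m_assoc mult.assoc mult.left_commute)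
  also have "\<dots> = x [^] k \<otimes> (g [^] (q ^ k * (p * m)) \<otimes> x)"
    using Suc assms by (simp add: m_assoc)
  also have "g [^] (q ^ k * (p * m)) \<otimes> x = (g [^] p) [^] (q ^ k * m) \<otimes> x"
    using assms by (simp add: int_pow_pow mult.left_commute)
  also have "\<dots> = x \<otimes> (g [^] q) [^] (q ^ k * m)"
    using assms by (intro int_pow_intertwine) auto
  also have "(g [^] q) [^] (q ^ k * m) = g [^] (q ^ Suc k * m)"
    using assms by (simp add: int_pow_pow mult.assoc)
  also have "x [^] k \<otimes> (x \<otimes> g [^] (q ^ Suc k * m)) = x [^] Suc k \<otimes> g [^] (q ^ Suc k * m)"
    using assms by (simp add: m_assoc)
  finally show ?case .
qed (use assms in simp)

section \<open>Axes of loxodromic elements and the subgroups that meet them\<close>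

context hyperbolic_length
begin

lemma loxodromic_gp:
  assumes g: "g \<in> carrier G" and lox: "loxodromic g"
  obtains K where "K \<ge> 0"
    "\<And>(a::int) (b::int). 0 \<le> a \<and> a \<le> b \<or> b \<le> a \<and> a \<le> 0 \<Longrightarrow> gp (g [^] a) \<one> (g [^] b) \<le> K"
proof -
  from lox obtain K where K: "\<And>(i::nat) (j::nat). gp \<one> (inv (g [^] i)) (g [^] j) \<le> K"
    unfolding loxodromic_def by blast
  have "gp (g [^] a) \<one> (g [^] b) \<le> K" if "0 \<le> a \<and> a \<le> b \<or> b \<le> a \<and> a \<le> 0" for a b :: int
  proof -
    have eq: "gp (g [^] a) \<one> (g [^] b) = gp \<one> (g [^] (- a)) (g [^] (b - a))"
    proof -
      have "inv (g [^] a) \<otimes> g [^] b = g [^] (b - a)"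
        using g int_pow_mult[of g "- a" b] by (simp add: int_pow_neg)
      then show ?thesis
        using gp_translate[of "g [^] a" \<one> "g [^] b"] g by (simp add: int_pow_neg)
    qed
    show ?thesis
    proof (cases "0 \<le> a \<and> a \<le> b")
      case True
      then show ?thesis
        using K[of "nat a" "nat (b - a)"] g unfolding eq
        by (simp add: int_pow_neg flip: int_pow_int)
    next
      case False
      with that have "b \<le> a" "a \<le> 0" by auto
      then have "g [^] (b - a) = inv (g [^] nat (a - b))" "g [^] (- a) = g [^] nat (- a)"
        using g int_pow_neg[of g "a - b"] by (simp_all flip: int_pow_int)
      then show ?thesis
        using K[of "nat (a - b)" "nat (- a)"] g unfolding eq by (simp add: gp_commute)
    qed
  qed
  moreover have "0 \<le> gp \<one> \<one> \<one>" by (intro gp_nonneg) auto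
  then have "K \<ge> 0" using K[of 0 0] by simp
  ultimately show ?thesis using that by blast
qed

text \<open>A discrete intermediate value argument: consecutive powers differ in length by at most
  \<open>L g\<close>, so some power between \<open>\<one>\<close> and \<open>g [^] b\<close> is
  about as long as \<open>p\<close>. Both follow \<open>g [^] b\<close> for nearly their whole
  length, hence are close. If \<open>p\<close> is longer than \<open>g [^] b\<close>, it is close to
  that end.\<close>

lemma cyclic_quasiconvex:
  assumes g: "g \<in> carrier G" and lox: "loxodromic g"
  shows "\<exists>R::nat. \<forall>p\<in>carrier G. \<forall>b::int. gp p \<one> (g [^] b) \<le> D \<longrightarrow> (\<exists>a::int. L (inv (g [^] a) \<otimes> p) \<le> R)"
proof -
  obtain K where "K \<ge> 0" and
    K: "\<And>(a::int) (b::int). 0 \<le> a \<and> a \<le> b \<or> b \<le> a \<and> a \<le> 0 \<Longrightarrow> gp (g [^] a) \<one> (g [^] b) \<le> K"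
    using loxodromic_gp[OF g lox] by blast
  define R where "R = nat \<lceil>real (L g) + 2 * (\<bar>D\<bar> + K + \<delta>)\<rceil>"
  have R: "real (L g) + 2 * (\<bar>D\<bar> + K + \<delta>) \<le> R" unfolding R_def by linarith
  have "\<exists>a::int. L (inv (g [^] a) \<otimes> p) \<le> R"
    if p: "p \<in> carrier G" and b: "gp p \<one> (g [^] b) \<le> D" for p and b :: int
  proof (cases "L p < L (g [^] b)")
    case False
    have "d p (g [^] b) \<le> 2 * D"
      using b False p g by (simp add: gp_def)
    then have "d (g [^] b) p \<le> R"
      using d_commute[of p "g [^] b"] R \<open>K \<ge> 0\<close> delta_nonneg p g by simp
    then show ?thesis unfolding d_def by auto
  next
    case True
    let ?f = "\<lambda>n::nat. g [^] (sgn b * int n)"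
    have "L p < L (?f (nat \<bar>b\<bar>))"
      using True by (simp add: sgn_mult_abs)
    moreover have "\<not> L p < L (?f 0)" by (simp add: L_one)
    ultimately obtain k where k: "k < nat \<bar>b\<bar>" "L (?f k) \<le> L p" "L p < L (?f (Suc k))"
      using ex_least_nat_less[of "\<lambda>n. L p < L (?f n)" "nat \<bar>b\<bar>"] by (metis not_less order_refl)
    define a where "a = sgn b * int k"
    have a: "L (g [^] a) \<le> L p" "0 \<le> a \<and> a \<le> b \<or> b \<le> a \<and> a \<le> 0"
      using k by (auto simp: a_def sgn_if)
    have "?f (Suc k) = g [^] a \<otimes> g [^] (sgn b)"
      using g by (simp add: a_def distrib_left flip: int_pow_mult) (simp add: add.commute)
    moreover have "L (g [^] (sgn b)) \<le> L g"
      using L_int_pow[OF g, of "sgn b"] by (auto simp: sgn_if L_one split: if_splits)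
    ultimately have step: "L p \<le> L (g [^] a) + L g"
      using k(3) L_mult[of "g [^] a" "g [^] (sgn b)"] g by simp
    have "gp \<one> p (g [^] b) \<ge> L (g [^] a) - (\<bar>D\<bar> + K)"
      using gp_flip[of \<one> p "g [^] b"] b a(1) p g \<open>K \<ge> 0\<close> by simp
    moreover have "gp \<one> (g [^] b) (g [^] a) \<ge> L (g [^] a) - (\<bar>D\<bar> + K)"
      using gp_flip[of \<one> "g [^] a" "g [^] b"] K[OF a(2)] p g gp_commute[of "g [^] b" "g [^] a" \<one>]
      by simp
    ultimately have "gp \<one> p (g [^] a) \<ge> L (g [^] a) - (\<bar>D\<bar> + K) - \<delta>"
      using p g by (intro hyp_ge[where y = "g [^] b"]) auto
    then have "d (g [^] a) p \<le> R"
      using R step p g d_commute[of p "g [^] a"] by (simp add: gp_def field_simps)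
    then show ?thesis unfolding d_def by auto
  qed
  then show ?thesis by blast
qed

text \<open>Points of geodesics are replaced by points with a small Gromov product, for all
  \<open>D\<close> at once because arguments enlarge \<open>D\<close>. Starting all geodesics at
  \<open>\<one>\<close> is enough for a subgroup, by translation.\<close>

definition quasiconvex :: "'g set \<Rightarrow> bool" where
  "quasiconvex H \<longleftrightarrow>
    (\<forall>D. \<exists>R::nat. \<forall>h\<in>H. \<forall>p\<in>carrier G. gp p \<one> h \<le> D \<longrightarrow> (\<exists>x\<in>H. L (inv x \<otimes> p) \<le> R))"

text \<open>If \<open>x\<close> followed the axis too far, all of \<open>g [^] 0\<close>, ...,
  \<open>g [^] N\<close> would lie near a geodesic to \<open>x\<close> and so within
  \<open>R\<close> of elements \<open>y k\<close> of \<open>H\<close>. Two of the differences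
  \<open>inv (y k) \<otimes> g [^] k\<close> coincide, which puts a positive power of
  \<open>g\<close> into \<open>H\<close>.\<close>

lemma power_gp_bounded_nat:
  assumes H: "subgroup H G" and qc: "quasiconvex H"
    and g: "g \<in> carrier G" and inj: "inj (\<lambda>k::int. g [^] k)"
    and no: "\<And>k::nat. k > 0 \<Longrightarrow> g [^] k \<notin> H"
  shows "\<exists>K. \<forall>x\<in>H. \<forall>m::nat. gp \<one> x (g [^] m) \<le> K"
proof -
  obtain K where "K \<ge> 0" and
    K: "\<And>(a::int) (b::int). 0 \<le> a \<and> a \<le> b \<or> b \<le> a \<and> a \<le> 0 \<Longrightarrow> gp (g [^] a) \<one> (g [^] b) \<le> K"
    using loxodromic_gp[OF g infinite_order_loxodromic[OF g inj]] by blast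
  obtain R :: nat where R: "\<forall>h\<in>H. \<forall>p\<in>carrier G. gp p \<one> h \<le> K + \<delta> \<longrightarrow> (\<exists>x\<in>H. L (inv x \<otimes> p) \<le> R)"
    using qc unfolding quasiconvex_def by blast
  obtain N :: nat where N: "\<forall>f. (\<forall>k\<le>N. f k \<in> carrier G \<and> L (f k) \<le> R) \<longrightarrow> (\<exists>i j. i < j \<and> j \<le> N \<and> f i = f j)"
    using pigeonhole_ball[of R] by (rule exE)
  have short: "real (L (g [^] k)) \<le> N * L g" if "k \<le> N" for k :: nat
    using L_nat_pow[OF g that] by simp
  have "gp \<one> x (g [^] m) \<le> N * L g" if x: "x \<in> H" for x and m :: nat
  proof (rule ccontr)
    assume far: "\<not> ?thesis"
    have xG: "x \<in> carrier G" using H x by (rule subgroup.mem_carrier)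
    have "m > N"
      using far short[of m] gp_le(2)[of \<one> x "g [^] m"] xG g by force
    have "\<exists>y\<in>H. L (inv y \<otimes> g [^] k) \<le> R" if "k \<le> N" for k :: nat
    proof -
      have "gp \<one> (g [^] k) (g [^] m) \<ge> L (g [^] k) - K"
        using gp_flip[of \<one> "g [^] k" "g [^] m"] K[of "int k" "int m"] that \<open>m > N\<close> g
        by (simp add: int_pow_int)
      moreover have "gp \<one> (g [^] m) x \<ge> L (g [^] k) - K"
        using far short[OF that] \<open>K \<ge> 0\<close> gp_commute[of "g [^] m" x \<one>] xG g by simp
      ultimately have "gp \<one> (g [^] k) x \<ge> L (g [^] k) - K - \<delta>"
        using xG g by (intro hyp_ge[where y = "g [^] m"]) auto
      then have "gp (g [^] k) \<one> x \<le> K + \<delta>"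
        using gp_flip[of \<one> "g [^] k" x] xG g by simp
      then show ?thesis using R x g by simp
    qed
    then obtain y where y: "\<And>k. k \<le> N \<Longrightarrow> y k \<in> H \<and> L (inv (y k) \<otimes> g [^] k) \<le> R" by metis
    then have yG: "\<And>k. k \<le> N \<Longrightarrow> y k \<in> carrier G" using H subgroup.mem_carrier by metis
    obtain i j where ij: "i < j" "j \<le> N" "inv (y i) \<otimes> g [^] i = inv (y j) \<otimes> g [^] j"
      using N[THEN spec, of "\<lambda>k. inv (y k) \<otimes> g [^] k"] y yG g by auto
    have "g [^] j = y j \<otimes> (inv (y i) \<otimes> g [^] i)"
      using ij yG[of i] yG[of j] g by simp
    moreover have "g [^] j = g [^] (j - i) \<otimes> g [^] i"
      using ij(1) g by (simp add: nat_pow_mult)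
    ultimately have "g [^] (j - i) \<otimes> g [^] i = (y j \<otimes> inv (y i)) \<otimes> g [^] i"
      using ij yG[of i] yG[of j] g by (simp add: m_assoc)
    then have "g [^] (j - i) = y j \<otimes> inv (y i)"
      using ij yG[of i] yG[of j] g by simp
    moreover have "y j \<otimes> inv (y i) \<in> H"
      using H y ij by (simp add: subgroup.m_closed subgroup.m_inv_closed)
    ultimately show False using no[of "j - i"] ij(1) by simp
  qed
  then show ?thesis by blast
qed

lemma inj_int_pow_inv:
  assumes "g \<in> carrier G" "inj (\<lambda>k::int. g [^] k)"
  shows "inj (\<lambda>k::int. inv g [^] k)"
proof (rule injI)
  fix a b :: int assume "inv g [^] a = inv g [^] b"
  then have "inv (g [^] a) = inv (g [^] b)" using assms(1) by (simp add: int_pow_inv)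
  then have "g [^] a = g [^] b" using assms(1) by (metis int_pow_closed inv_inv)
  then show "a = b" using injD[OF assms(2)] by simp
qed

lemma power_gp_bounded:
  assumes H: "subgroup H G" and qc: "quasiconvex H"
    and g: "g \<in> carrier G" and inj: "inj (\<lambda>k::int. g [^] k)"
    and no: "\<And>k::nat. k > 0 \<Longrightarrow> g [^] k \<notin> H"
  obtains K where "K \<ge> 0" "\<And>x m. x \<in> H \<Longrightarrow> gp \<one> x (g [^] (m::int)) \<le> K"
proof -
  obtain K1 where K1: "\<forall>x\<in>H. \<forall>m::nat. gp \<one> x (g [^] m) \<le> K1"
    using power_gp_bounded_nat[OF H qc g inj no] by blast
  have "inv g [^] k \<notin> H" if "k > 0" for k :: nat
  proof
    assume "inv g [^] k \<in> H"
    then have "inv (inv g [^] k) \<in> H" using H subgroup.m_inv_closed by metis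
    then show False using no[OF that] g by (simp add: nat_pow_inv)
  qed
  then obtain K2 where K2: "\<forall>x\<in>H. \<forall>m::nat. gp \<one> x (inv g [^] m) \<le> K2"
    using power_gp_bounded_nat[OF H qc, of "inv g"] inj_int_pow_inv[OF g inj] g by auto
  show ?thesis
  proof (rule that[of "max 0 (max K1 K2)"])
    fix x and m :: int assume x: "x \<in> H"
    show "gp \<one> x (g [^] m) \<le> max 0 (max K1 K2)"
    proof (cases m rule: int_cases2)
      case (nonneg n)
      then show ?thesis using K1 x by (simp add: int_pow_int le_max_iff_disj)
    next
      case (nonpos n)
      then have "g [^] m = inv g [^] n" using g by (simp add: int_pow_neg int_pow_int nat_pow_inv)
      then show ?thesis using K2 x by (simp add: le_max_iff_disj)
    qed
  qed simp
qed

text \<open>The pigeonhole argument of \<open>power_gp_bounded_nat\<close>, with the axis translated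
  by \<open>x\<close> in place of \<open>H\<close>: a coincidence is now a relation
  \<open>g [^] p \<otimes> x = x \<otimes> g [^] q\<close>. The bound is uniform over the ball of
  radius \<open>c\<close>.\<close>

lemma translate_gp_bounded_nat:
  fixes c :: nat
  assumes g: "g \<in> carrier G" and inj: "inj (\<lambda>k::int. g [^] k)"
  shows "\<exists>K. \<forall>x\<in>carrier G. L x \<le> c \<longrightarrow> (\<forall>(p::int) (q::int). p \<noteq> 0 \<longrightarrow> g [^] p \<otimes> x \<noteq> x \<otimes> g [^] q) \<longrightarrow>
    (\<forall>(m::nat) (b::int). gp \<one> (g [^] m) (x \<otimes> g [^] b) \<le> K)"
proof -
  have lox: "loxodromic g" using g inj by (rule infinite_order_loxodromic)
  obtain K where "K \<ge> 0" and
    K: "\<And>(a::int) (b::int). 0 \<le> a \<and> a \<le> b \<or> b \<le> a \<and> a \<le> 0 \<Longrightarrow> gp (g [^] a) \<one> (g [^] b) \<le> K"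
    using loxodromic_gp[OF g lox] by blast
  obtain R :: nat where R: "\<forall>p\<in>carrier G. \<forall>b::int. gp p \<one> (g [^] b) \<le> K + \<delta> + c \<longrightarrow>
      (\<exists>a::int. L (inv (g [^] a) \<otimes> p) \<le> R)"
    using cyclic_quasiconvex[OF g lox] by blast
  obtain N :: nat where N: "\<forall>f. (\<forall>k\<le>N. f k \<in> carrier G \<and> L (f k) \<le> R) \<longrightarrow> (\<exists>i j. i < j \<and> j \<le> N \<and> f i = f j)"
    using pigeonhole_ball[of R] by (rule exE)
  have "gp \<one> (g [^] m) (x \<otimes> g [^] b) \<le> N * L g"
    if x: "x \<in> carrier G" "L x \<le> c" and no: "\<forall>(p::int) (q::int). p \<noteq> 0 \<longrightarrow> g [^] p \<otimes> x \<noteq> x \<otimes> g [^] q"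
    for x and m :: nat and b :: int
  proof (rule ccontr)
    assume far: "\<not> ?thesis"
    have "m > N"
      using far L_nat_pow[OF g, of m N] gp_le(1)[of \<one> "g [^] m" "x \<otimes> g [^] b"] x g by force
    have "\<exists>a::int. L (inv (g [^] a) \<otimes> (inv x \<otimes> g [^] k)) \<le> R" if "k \<le> N" for k :: nat
    proof -
      have "gp \<one> (g [^] k) (g [^] m) \<ge> L (g [^] k) - K"
        using gp_flip[of \<one> "g [^] k" "g [^] m"] K[of "int k" "int m"] that \<open>m > N\<close> g
        by (simp add: int_pow_int)
      moreover have "gp \<one> (g [^] m) (x \<otimes> g [^] b) \<ge> L (g [^] k) - K"
        using far L_nat_pow[OF g that] \<open>K \<ge> 0\<close> by simp
      ultimately have "gp \<one> (g [^] k) (x \<otimes> g [^] b) \<ge> L (g [^] k) - K - \<delta>"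
        using x g by (intro hyp_ge[where y = "g [^] m"]) auto
      then have "gp (g [^] k) \<one> (x \<otimes> g [^] b) \<le> K + \<delta>"
        using gp_flip[of \<one> "g [^] k" "x \<otimes> g [^] b"] x g by simp
      then have "gp (g [^] k) x (x \<otimes> g [^] b) \<le> K + \<delta> + c"
        using gp_right[of "g [^] k" x \<one> "x \<otimes> g [^] b"] x g by simp
      then have "gp (inv x \<otimes> g [^] k) \<one> (g [^] b) \<le> K + \<delta> + c"
        using gp_left[of "inv x" "g [^] k" x "x \<otimes> g [^] b"] x g by simp
      then show ?thesis using R[rule_format, of "inv x \<otimes> g [^] k" b] x g by simp
    qed
    then obtain a :: "nat \<Rightarrow> int" where a: "\<And>k. k \<le> N \<Longrightarrow> L (inv (g [^] a k) \<otimes> (inv x \<otimes> g [^] k)) \<le> R"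
      by metis
    have "\<exists>i j. i < j \<and> j \<le> N \<and>
        inv (g [^] a i) \<otimes> (inv x \<otimes> g [^] i) = inv (g [^] a j) \<otimes> (inv x \<otimes> g [^] j)"
      using a x g by (intro N[THEN spec, THEN mp]) simp
    then obtain i j :: nat where ij: "i < j"
      "inv (g [^] a i) \<otimes> (inv x \<otimes> g [^] i) = inv (g [^] a j) \<otimes> (inv x \<otimes> g [^] j)"
      by blast
    have "g [^] (- a i) \<otimes> (inv x \<otimes> g [^] int i) = g [^] (- a j) \<otimes> (inv x \<otimes> g [^] int j)"
      using ij(2) g by (simp add: int_pow_neg int_pow_int)
    then have "(x \<otimes> g [^] a j) \<otimes> (g [^] (- a i) \<otimes> (inv x \<otimes> g [^] int i)) \<otimes> (g [^] (- int i) \<otimes> x)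
        = (x \<otimes> g [^] a j) \<otimes> (g [^] (- a j) \<otimes> (inv x \<otimes> g [^] int j)) \<otimes> (g [^] (- int i) \<otimes> x)"
      by simp
    moreover have "(x \<otimes> g [^] a j) \<otimes> (g [^] (- a i) \<otimes> (inv x \<otimes> g [^] int i)) \<otimes> (g [^] (- int i) \<otimes> x)
        = x \<otimes> g [^] (a j - a i)"
    proof -
      have "g [^] int i \<otimes> (g [^] (- int i) \<otimes> x) = x"
        using x g by (simp flip: m_assoc int_pow_mult)
      moreover have "g [^] a j \<otimes> (g [^] (- a i) \<otimes> y) = g [^] (a j - a i) \<otimes> y" if "y \<in> carrier G" for y
        using that g int_pow_mult[of g "a j" "- a i"] by (simp flip: m_assoc)
      ultimately show ?thesis using x g by (simp add: m_assoc)
    qed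
    moreover have "(x \<otimes> g [^] a j) \<otimes> (g [^] (- a j) \<otimes> (inv x \<otimes> g [^] int j)) \<otimes> (g [^] (- int i) \<otimes> x)
        = g [^] (int j - int i) \<otimes> x"
    proof -
      have "g [^] int j \<otimes> (g [^] (- int i) \<otimes> x) = g [^] (int j - int i) \<otimes> x"
        using x g int_pow_mult[of g "int j" "- int i"] by (simp flip: m_assoc)
      moreover have "g [^] a j \<otimes> (g [^] (- a j) \<otimes> y) = y" if "y \<in> carrier G" for y
        using that g by (simp flip: m_assoc int_pow_mult)
      ultimately show ?thesis using x g by (simp add: m_assoc)
    qed
    ultimately have "g [^] (int j - int i) \<otimes> x = x \<otimes> g [^] (a j - a i)" by simp
    moreover have "int j - int i \<noteq> 0" using ij(1) by simp
    ultimately show False using no by blast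
  qed
  then show ?thesis by blast
qed

lemma translate_gp_bounded:
  fixes c :: nat
  assumes g: "g \<in> carrier G" and inj: "inj (\<lambda>k::int. g [^] k)"
  obtains K where "\<And>x m b. \<lbrakk>x \<in> carrier G; L x \<le> c; \<And>(p::int) (q::int). p \<noteq> 0 \<Longrightarrow> g [^] p \<otimes> x \<noteq> x \<otimes> g [^] q\<rbrakk> \<Longrightarrow>
    gp \<one> (g [^] (m::int)) (x \<otimes> g [^] (b::int)) \<le> K"
proof -
  obtain K1 where K1: "\<And>x m b. \<lbrakk>x \<in> carrier G; L x \<le> c; \<forall>(p::int) (q::int). p \<noteq> 0 \<longrightarrow> g [^] p \<otimes> x \<noteq> x \<otimes> g [^] q\<rbrakk> \<Longrightarrow>
    gp \<one> (g [^] (m::nat)) (x \<otimes> g [^] (b::int)) \<le> K1"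
    using translate_gp_bounded_nat[OF g inj, of c] by blast
  have "inv g \<in> carrier G" using g by simp
  then obtain K2 where K2: "\<And>x m b. \<lbrakk>x \<in> carrier G; L x \<le> c; \<forall>(p::int) (q::int). p \<noteq> 0 \<longrightarrow> inv g [^] p \<otimes> x \<noteq> x \<otimes> inv g [^] q\<rbrakk> \<Longrightarrow>
    gp \<one> (inv g [^] (m::nat)) (x \<otimes> inv g [^] (b::int)) \<le> K2"
    using translate_gp_bounded_nat[OF _ inj_int_pow_inv[OF g inj], of c] by blast
  have ginv: "inv g [^] (p::int) = g [^] (- p)" for p
    using g by (simp add: int_pow_inv int_pow_neg)
  show ?thesis
  proof (rule that[of "max K1 K2"])
    fix x and m b :: int
    assume x: "x \<in> carrier G" "L x \<le> c" "\<And>(p::int) (q::int). p \<noteq> 0 \<Longrightarrow> g [^] p \<otimes> x \<noteq> x \<otimes> g [^] q"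
    show "gp \<one> (g [^] m) (x \<otimes> g [^] b) \<le> max K1 K2"
    proof (cases m rule: int_cases2)
      case (nonneg n)
      then show ?thesis using K1[of x n b] x by (simp add: int_pow_int le_max_iff_disj)
    next
      case (nonpos n)
      have "g [^] m = inv g [^] n" using nonpos ginv[of "int n"] by (simp add: int_pow_int)
      moreover have "g [^] b = inv g [^] (- b)" by (simp add: ginv)
      moreover have "\<forall>(p::int) (q::int). p \<noteq> 0 \<longrightarrow> inv g [^] p \<otimes> x \<noteq> x \<otimes> inv g [^] q"
        using x(3) by (simp add: ginv)
      ultimately show ?thesis using K2[of x n "- b"] x by (simp add: le_max_iff_disj)
    qed
  qed
qed

section \<open>Torsion-free subgroups and the translates of an axis\<close>

definition torsion_free :: "'g set \<Rightarrow> bool" where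
  "torsion_free H \<longleftrightarrow> (\<forall>x\<in>H. x \<noteq> \<one> \<longrightarrow> inj (\<lambda>k::int. x [^] k))"

text \<open>
  A relation \<open>g\<^sup>p x = x g\<^sup>q\<close> iterates to \<open>g\<^sup>a x\<^sup>k = x\<^sup>k g\<^sup>b\<close>. When \<open>x\<^sup>k\<close> and \<open>g\<^sup>a\<close> are both long, this
  forces them to fellow-travel.
\<close>

lemma no_intertwining:
  assumes H: "subgroup H G" and tf: "torsion_free H"
    and g: "g \<in> carrier G" and inj: "inj (\<lambda>k::int. g [^] k)"
    and K: "K \<ge> 0" "\<And>x m. x \<in> H \<Longrightarrow> gp \<one> x (g [^] (m::int)) \<le> K"
    and x: "x \<in> H" "x \<noteq> \<one>" and "p \<noteq> 0"
  shows "g [^] (p::int) \<otimes> x \<noteq> x \<otimes> g [^] (q::int)"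
proof
  assume eq: "g [^] p \<otimes> x = x \<otimes> g [^] q"
  have xG: "x \<in> carrier G" using H x(1) by (rule subgroup.mem_carrier)
  have injx: "inj (\<lambda>k::int. x [^] k)" using tf x unfolding torsion_free_def by blast
  define B where "B = nat \<lceil>2 * K + \<delta> + 1\<rceil>"
  have B: "real B > 2 * K + \<delta>" unfolding B_def by linarith
  obtain k :: int where k: "k > 0" "L (x [^] k) \<ge> B"
    using exists_large_power[OF injx xG, of B] by (metis abs_ge_self)
  define z where "z = x [^] nat k"
  have z: "z \<in> H" "z \<in> carrier G" "L z \<ge> B"
    using k xG int_pow_int[of G x "nat k"] subgroup_int_pow_closed[OF H x(1), of "int (nat k)"]
    by (simp_all add: z_def)
  define a where "a = p ^ nat k"
  define b where "b = q ^ nat k"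
  have "a \<noteq> 0" using \<open>p \<noteq> 0\<close> by (simp add: a_def)
  obtain n :: int where n: "n > 0" "\<And>k::int. \<bar>k\<bar> \<ge> n \<Longrightarrow> L (g [^] k) \<ge> B"
    using exists_large_power[OF inj g, of B] by blast
  have "\<bar>a * n\<bar> \<ge> n" using \<open>a \<noteq> 0\<close> n(1) by (simp add: abs_mult mult_le_cancel_right1)
  then have u: "L (g [^] (a * n)) \<ge> B" by (rule n(2))
  define u where "u = g [^] (a * n)"
  have uG: "u \<in> carrier G" using g by (simp add: u_def)
  have zu: "u \<otimes> z = z \<otimes> g [^] (b * n)"
    using int_pow_intertwine_iterate[OF g xG eq, of "nat k" n] by (simp add: u_def z_def a_def b_def)
  \<comment> \<open>\<open>u \<otimes> z\<close> starts like \<open>u\<close>, because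
    \<open>z\<close> hardly follows the axis. Being equal to
    \<open>z \<otimes> g [^] (b * n)\<close>, it starts like \<open>z\<close> for the same reason.
    So \<open>u\<close> and \<open>z\<close> share at least \<open>B - K - \<delta>\<close>, which
    exceeds \<open>K\<close> by the choice of \<open>B\<close>.\<close>
  have "gp u \<one> (u \<otimes> z) = gp \<one> (inv u) z"
    using gp_left[of "inv u" u \<one> "u \<otimes> z"] uG z by simp
  also have "\<dots> \<le> K"
    using K(2)[OF z(1), of "- (a * n)"] g z by (simp add: u_def int_pow_neg gp_commute)
  finally have 1: "gp \<one> u (u \<otimes> z) \<ge> L u - K"
    using gp_flip[of \<one> u "u \<otimes> z"] uG z by simp
  have "gp z \<one> (u \<otimes> z) = gp \<one> (inv z) (g [^] (b * n))"
    using gp_left[of "inv z" z \<one> "u \<otimes> z"] uG z g by (simp add: zu)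
  also have "\<dots> \<le> K"
    using K(2) z H by (simp add: subgroup.m_inv_closed)
  finally have 2: "gp \<one> (u \<otimes> z) z \<ge> L z - K"
    using gp_flip[of \<one> z "u \<otimes> z"] gp_commute[of "u \<otimes> z" z \<one>] uG z by simp
  have "gp \<one> u z \<ge> (B - K) - \<delta>"
    using 1 2 u z uG by (intro hyp_ge[where y = "u \<otimes> z"]) (auto simp: u_def)
  then show False
    using K(2)[OF z(1), of "a * n"] B uG z gp_commute[of u z \<one>] by (simp add: u_def)
qed

text \<open>Short \<open>x\<close> are covered by the bound that is uniform on a ball, where
  \<open>no_intertwining\<close> supplies its hypothesis. For long \<open>x\<close>, the element
  \<open>x \<otimes> g [^] b\<close> begins like \<open>x\<close>, and \<open>x\<close> itself
  leaves the axis after \<open>K\<close>.\<close>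

lemma transverse_gp_bounded:
  assumes H: "subgroup H G" and tf: "torsion_free H"
    and g: "g \<in> carrier G" and inj: "inj (\<lambda>k::int. g [^] k)"
    and K: "K \<ge> 0" "\<And>x m. x \<in> H \<Longrightarrow> gp \<one> x (g [^] (m::int)) \<le> K"
  obtains K' where "K' \<ge> K"
    "\<And>x m b. \<lbrakk>x \<in> H; x \<noteq> \<one>\<rbrakk> \<Longrightarrow> gp \<one> (g [^] (m::int)) (x \<otimes> g [^] (b::int)) \<le> K'"
proof -
  obtain K1 where K1: "\<And>x m b. \<lbrakk>x \<in> carrier G; L x \<le> nat \<lceil>2 * K + \<delta>\<rceil>; \<And>(p::int) (q::int). p \<noteq> 0 \<Longrightarrow> g [^] p \<otimes> x \<noteq> x \<otimes> g [^] q\<rbrakk> \<Longrightarrow>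
    gp \<one> (g [^] (m::int)) (x \<otimes> g [^] (b::int)) \<le> K1"
    using translate_gp_bounded[OF g inj] by blast
  show ?thesis
  proof (rule that[of "max K1 (K + \<delta>)"])
    show "K \<le> max K1 (K + \<delta>)" using delta_nonneg by simp
    fix x and m b :: int assume x: "x \<in> H" "x \<noteq> \<one>"
    have xG: "x \<in> carrier G" using H x(1) by (rule subgroup.mem_carrier)
    show "gp \<one> (g [^] m) (x \<otimes> g [^] b) \<le> max K1 (K + \<delta>)"
    proof (cases "L x \<le> nat \<lceil>2 * K + \<delta>\<rceil>")
      case True
      then show ?thesis
        using K1[OF xG _ no_intertwining[OF H tf g inj K(1) _ x], of m b] K(2) by simp
    next
      case False
      then have far: "real (L x) > 2 * K + \<delta>" by linarith
      have "gp x \<one> (x \<otimes> g [^] b) = gp \<one> (inv x) (g [^] b)"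
        using gp_left[of "inv x" x \<one> "x \<otimes> g [^] b"] xG g by simp
      also have "\<dots> \<le> K"
        using K(2) x H by (simp add: subgroup.m_inv_closed)
      finally have "gp \<one> x (x \<otimes> g [^] b) > K + \<delta>"
        using gp_flip[of \<one> x "x \<otimes> g [^] b"] far xG g by simp
      then have "gp \<one> (x \<otimes> g [^] b) (g [^] m) \<le> K + \<delta>"
        using K(2)[OF x(1)] xG g by (intro hyp_le[of \<one> x]) auto
      then show ?thesis
        using xG g gp_commute[of "x \<otimes> g [^] b" "g [^] m" \<one>] by simp
    qed
  qed
qed

end


section \<open>Adjoining a large power\<close>

lemma (in group) inj_int_pow_rotate:
  assumes "a \<in> carrier G" "b \<in> carrier G" "inj (\<lambda>k::int. (a \<otimes> b) [^] k)"
  shows "inj (\<lambda>k::int. (b \<otimes> a) [^] k)"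
proof (rule injI)
  fix i j :: int assume eq: "(b \<otimes> a) [^] i = (b \<otimes> a) [^] j"
  have "(b \<otimes> a) [^] m \<otimes> b = b \<otimes> (a \<otimes> b) [^] m" for m :: int
    using assms by (intro int_pow_intertwine) (auto simp: m_assoc)
  then have "b \<otimes> (a \<otimes> b) [^] i = b \<otimes> (a \<otimes> b) [^] j"
    using eq by metis
  then have "(a \<otimes> b) [^] i = (a \<otimes> b) [^] j"
    using assms by simp
  then show "i = j" using injD[OF assms(3)] by simp
qed

text \<open>\<open>M\<close> is the length along the axis that survives at the end of every reduced
  product. The surplus \<open>3 * K + 4 * \<delta>\<close> in the length of a syllable pays for the
  junction with the preceding letter of \<open>H\<close>. \<open>M\<close> stays a parameter because
  the count of merged cosets asks for it to be large.\<close>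

locale free_extension = hyperbolic_length G L \<delta>
  for G :: "('g, 'm) monoid_scheme" (structure) and L \<delta> +
  fixes H :: "'g set" and g :: 'g and K M :: real and n :: int
  assumes H: "subgroup H G" and torsion_free_H: "torsion_free H"
    and g: "g \<in> carrier G" and inj: "inj (\<lambda>k::int. g [^] k)"
    and K_nonneg: "K \<ge> 0"
    and K: "x \<in> H \<Longrightarrow> gp \<one> x (g [^] (m::int)) \<le> K"
    and K_transverse: "\<lbrakk>x \<in> H; x \<noteq> \<one>\<rbrakk> \<Longrightarrow> gp \<one> (g [^] (m::int)) (x \<otimes> g [^] (b::int)) \<le> K"
    and M: "M > 6 * K + 10 * \<delta>"
    and n: "n > 0" "\<lbrakk>a \<noteq> 0; n dvd a\<rbrakk> \<Longrightarrow> L (g [^] a) \<ge> M + 3 * K + 4 * \<delta>"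
begin

definition H' :: "'g set" where
  "H' = generate G (insert (g [^] n) H)"

text \<open>Alternating words of the free product that begin and end with a power of
  \<open>g\<close>. The index counts these powers and is the measure for cyclic reduction. Words
  grow at the right end, so the geometric invariant concerns the inverse.\<close>

inductive reduced :: "nat \<Rightarrow> 'g \<Rightarrow> bool" where
  syllable: "\<lbrakk>a \<noteq> 0; n dvd a\<rbrakk> \<Longrightarrow> reduced 1 (g [^] a)"
| append: "\<lbrakk>reduced k w; x \<in> H; x \<noteq> \<one>; a \<noteq> 0; n dvd a\<rbrakk> \<Longrightarrow> reduced (Suc k) (w \<otimes> (x \<otimes> g [^] a))"

lemma H_closed [simp]: "x \<in> H \<Longrightarrow> x \<in> carrier G"
  using H by (rule subgroup.mem_carrier)

lemma H_inv [simp]: "x \<in> H \<Longrightarrow> inv x \<in> H"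
  using H by (rule subgroup.m_inv_closed)

lemma H_mult [simp]: "\<lbrakk>x \<in> H; y \<in> H\<rbrakk> \<Longrightarrow> x \<otimes> y \<in> H"
  using H by (rule subgroup.m_closed)

lemma H_one [simp]: "\<one> \<in> H"
  using H by (rule subgroup.one_closed)

lemmas g_closed [simp] = g

lemma reduced_closed [simp]: "reduced k w \<Longrightarrow> w \<in> carrier G"
  by (induction rule: reduced.induct) simp_all

text \<open>\<open>inv w\<close> begins along the axis for \<open>M\<close>, whereas
  \<open>x\<close> and \<open>x \<otimes> g [^] a\<close> leave it after \<open>K\<close>. So hardly
  anything cancels when these are multiplied to \<open>w\<close> on the right.\<close>

lemma separated:
  assumes "w \<in> carrier G" "gp \<one> (inv w) (g [^] (b::int)) \<ge> M"
  shows "x \<in> H \<Longrightarrow> gp \<one> (inv w) x \<le> K + \<delta>"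
    and "\<lbrakk>x \<in> H; x \<noteq> \<one>\<rbrakk> \<Longrightarrow> gp \<one> (inv w) (x \<otimes> g [^] (a::int)) \<le> K + \<delta>"
proof -
  have 1: "gp \<one> (g [^] b) (inv w) > K + \<delta>"
    using assms M K_nonneg delta_nonneg gp_commute[of "g [^] b" "inv w" \<one>] by simp
  show "gp \<one> (inv w) x \<le> K + \<delta>" if "x \<in> H"
    using hyp_le[OF _ 1, of x] K[OF that, of b] that assms(1) gp_commute[of x "g [^] b" \<one>] by simp
  show "gp \<one> (inv w) (x \<otimes> g [^] a) \<le> K + \<delta>" if "x \<in> H" "x \<noteq> \<one>"
    using hyp_le[OF _ 1, of "x \<otimes> g [^] a"] K_transverse[OF that, of b a] that assms(1) by simp
qed

text \<open>The bound is as good after a new syllable as before: what cancels in front of the new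
  power is at most \<open>3 * K + 3 * \<delta>\<close> whatever \<open>w\<close> is, and the power
  exceeds \<open>M\<close> by more than that or exactly by
  \<open>3 * K + 4 * \<delta>\<close>.\<close>

lemma reduced_end:
  assumes "reduced k w"
  shows "\<exists>b::int. gp \<one> (inv w) (g [^] b) \<ge> M"
  using assms
proof (induction rule: reduced.induct)
  case (syllable a)
  have "gp \<one> (inv (g [^] a)) (g [^] (- a)) = L (g [^] a)"
    by (simp add: gp_def int_pow_neg L_inv)
  also have "\<dots> \<ge> M"
    using n(2)[OF syllable] K_nonneg delta_nonneg by simp
  finally show ?case by blast
next
  case (append k w x a)
  then obtain b where b: "gp \<one> (inv w) (g [^] (b::int)) \<ge> M" by blast
  have w: "w \<in> carrier G" using append by simp
  note sep = separated[OF w b] and xG = H_closed[OF append(2)]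
  \<comment> \<open>For a short \<open>x\<close> the base point may be moved from
    \<open>\<one>\<close> to \<open>x\<close>, at the price of \<open>L x\<close>. Seen from the far
    end of a long \<open>x\<close>, the points \<open>\<one>\<close> and \<open>inv w\<close> lie in
    the same direction.\<close>
  have "gp x (inv w) (x \<otimes> g [^] a) \<le> 3 * K + 3 * \<delta>"
  proof (cases "L x \<le> 2 * K + 2 * \<delta>")
    case True
    then show ?thesis
      using gp_base[of x \<one> "inv w" "x \<otimes> g [^] a"] sep(2)[OF append(2,3), of a] w xG by simp
  next
    case False
    have "gp x \<one> (x \<otimes> g [^] a) = gp \<one> (inv x) (g [^] a)"
      using gp_left[of "inv x" x \<one> "x \<otimes> g [^] a"] xG by simp
    also have "\<dots> \<le> K" using K append(2) by simp
    finally have 1: "gp x \<one> (x \<otimes> g [^] a) \<le> K" .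
    have "gp x \<one> (inv w) > K + \<delta>"
      using gp_flip[of \<one> x "inv w"] sep(1)[OF append(2)] False w xG gp_commute[of x "inv w" \<one>] by simp
    from hyp_le[OF 1 this] have "gp x (inv w) (x \<otimes> g [^] a) \<le> K + \<delta>"
      using w xG by simp
    then show ?thesis using K_nonneg delta_nonneg by simp
  qed
  moreover have "gp \<one> (g [^] a) (inv x \<otimes> inv w) = gp x (inv w) (x \<otimes> g [^] a)"
    using gp_left[of "inv x" x "inv w" "x \<otimes> g [^] a"] w xG gp_commute by simp
  moreover have "gp \<one> (inv (w \<otimes> (x \<otimes> g [^] a))) (g [^] (- a)) = gp (g [^] a) \<one> (inv x \<otimes> inv w)"
  proof -
    have "inv (w \<otimes> (x \<otimes> g [^] a)) = inv (g [^] a) \<otimes> (inv x \<otimes> inv w)"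
      using w xG by (simp add: inv_mult_group m_assoc)
    then show ?thesis
      using gp_left[of "inv (g [^] a)" "g [^] a" "inv x \<otimes> inv w" \<one>] w xG
      by (simp add: int_pow_neg gp_commute)
  qed
  ultimately have "gp \<one> (inv (w \<otimes> (x \<otimes> g [^] a))) (g [^] (- a)) \<ge> M"
    using gp_flip[of \<one> "g [^] a" "inv x \<otimes> inv w"] n(2)[OF append(4,5)] w xG delta_nonneg by simp
  then show ?case by blast
qed

lemma reduced_mult:
  assumes "reduced k w" "x \<in> H" "x \<noteq> \<one>" "reduced l u"
  shows "reduced (k + l) (w \<otimes> (x \<otimes> u))"
  using assms(4)
proof (induction rule: reduced.induct)
  case (syllable a)
  then show ?case using reduced.append[OF assms(1-3)] by simp
next
  case (append l u y a)
  have "w \<otimes> (x \<otimes> (u \<otimes> (y \<otimes> g [^] a))) = (w \<otimes> (x \<otimes> u)) \<otimes> (y \<otimes> g [^] a)"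
    using append assms by (simp add: m_assoc)
  then show ?case using reduced.append[OF append.IH append(2-5)] by simp
qed

lemma reduced_inv:
  assumes "reduced k w"
  shows "reduced k (inv w)"
  using assms
proof (induction rule: reduced.induct)
  case (syllable a)
  then show ?case using reduced.syllable[of "- a"] by (simp add: int_pow_neg)
next
  case (append k w x a)
  have "inv (w \<otimes> (x \<otimes> g [^] a)) = g [^] (- a) \<otimes> (inv x \<otimes> inv w)"
    using append by (simp add: inv_mult_group m_assoc int_pow_neg)
  moreover have "inv x \<noteq> \<one>" using append by (metis H_closed inv_inv inv_one)
  then have "reduced (1 + k) (g [^] (- a) \<otimes> (inv x \<otimes> inv w))"
    using append by (intro reduced_mult reduced.syllable) auto
  ultimately show ?case by simp
qed

text \<open>\<open>reduced\<close> only exposes the last syllable; the first one is the last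
  syllable of the inverse.\<close>

lemma reduced_front:
  assumes "reduced k w"
  obtains (one) a where "a \<noteq> 0" "n dvd a" "w = g [^] a"
  | (more) l a x u where "k = Suc l" "a \<noteq> 0" "n dvd a" "x \<in> H" "x \<noteq> \<one>" "reduced l u"
      "w = g [^] a \<otimes> (x \<otimes> u)"
  using reduced_inv[OF assms]
proof cases
  case (syllable a)
  have "w = g [^] (- a)"
    using assms syllable(2) by (metis g_closed int_pow_neg inv_inv reduced_closed)
  then show ?thesis using syllable one[of "- a"] by simp
next
  case (append l u x a)
  have "w = inv (u \<otimes> (x \<otimes> g [^] a))"
    using assms append(2) by (metis inv_inv reduced_closed)
  also have "\<dots> = g [^] (- a) \<otimes> (inv x \<otimes> inv u)"
    using append by (simp add: inv_mult_group m_assoc int_pow_neg)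
  finally have w: "w = g [^] (- a) \<otimes> (inv x \<otimes> inv u)" .
  have "inv x \<noteq> \<one>" using append by (metis H_closed inv_inv inv_one)
  then show ?thesis
    using more[of l "- a" "inv x" "inv u"] w append reduced_inv by simp
qed

text \<open>The inverse of a reduced element follows the axis for \<open>M\<close>, an element of
  \<open>H\<close> for at most \<open>K\<close>.\<close>

lemma reduced_notin:
  assumes "reduced k w"
  shows "w \<notin> H"
proof
  assume "w \<in> H"
  show False
  proof -
    obtain b :: int where "gp \<one> (inv w) (g [^] b) \<ge> M" using reduced_end[OF assms] by blast
    moreover have "gp \<one> (inv w) (g [^] b) \<le> K" using K \<open>w \<in> H\<close> by simp
    ultimately show False using M K_nonneg delta_nonneg by simp
  qed
qed

lemma mem_H':
  "x \<in> H \<Longrightarrow> x \<in> H'" "n dvd a \<Longrightarrow> g [^] a \<in> H'"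
proof -
  show "x \<in> H \<Longrightarrow> x \<in> H'" unfolding H'_def by (simp add: generate.incl)
  have "subgroup H' G"
    unfolding H'_def by (intro generate_is_subgroup) auto
  moreover have "g [^] n \<in> H'" unfolding H'_def by (simp add: generate.incl)
  ultimately have "(g [^] n) [^] b \<in> H'" for b :: int
    by (rule subgroup_int_pow_closed)
  then show "g [^] a \<in> H'" if "n dvd a" using that by (auto simp: int_pow_pow)
qed

lemma subgroup_H': "subgroup H' G"
  unfolding H'_def by (intro generate_is_subgroup) auto

lemma H'_mult [simp]: "\<lbrakk>x \<in> H'; y \<in> H'\<rbrakk> \<Longrightarrow> x \<otimes> y \<in> H'"
  using subgroup_H' by (rule subgroup.m_closed)

lemma reduced_H': "reduced k w \<Longrightarrow> w \<in> H'"
  by (induction rule: reduced.induct) (auto simp: mem_H')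

section \<open>Normal forms and torsion in the free product\<close>

definition normal_form :: "'g \<Rightarrow> bool" where
  "normal_form z \<longleftrightarrow> z \<in> H \<or> (\<exists>x\<in>H. \<exists>y\<in>H. \<exists>k w. reduced k w \<and> z = x \<otimes> (w \<otimes> y))"

lemma normal_form_closed [simp]: "normal_form z \<Longrightarrow> z \<in> carrier G"
  unfolding normal_form_def by auto

lemma normal_form_mult_H:
  assumes "normal_form z" "h \<in> H"
  shows "normal_form (z \<otimes> h)"
  using assms unfolding normal_form_def
  by (auto simp: m_assoc) (metis H_closed H_mult m_assoc reduced_closed)+

lemma normal_form_mult_power:
  assumes "normal_form z" "n dvd a"
  shows "normal_form (z \<otimes> g [^] a)"
proof (cases "a = 0")
  case True
  then show ?thesis using assms by simp
next
  case False
  have red: "normal_form (x \<otimes> w)" if "x \<in> H" "reduced k w" for x w k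
    using that unfolding normal_form_def by (metis H_one r_one reduced_closed)
  have *: "normal_form (x \<otimes> (w \<otimes> (y \<otimes> g [^] a)))" if xy: "x \<in> H" "y \<in> H" and w: "reduced k w" for x y w k
  proof (cases "y = \<one>")
    case False
    then show ?thesis
      using red[OF xy(1) reduced.append[OF w xy(2) False \<open>a \<noteq> 0\<close> assms(2)]] by simp
  next
    case True
    from w show ?thesis
    proof cases
      case (syllable b)
      then have eq: "w \<otimes> (y \<otimes> g [^] a) = g [^] (b + a)"
        using True by (simp add: int_pow_mult)
      show ?thesis
      proof (cases "b + a = 0")
        case True
        then show ?thesis unfolding eq normal_form_def using xy by simp
      next
        case False
        then show ?thesis
          unfolding eq using red[OF xy(1) reduced.syllable[OF False]] syllable assms(2) by simp
      qed
    next
      case (append l u v b)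
      then have eq: "w \<otimes> (y \<otimes> g [^] a) = u \<otimes> (v \<otimes> g [^] (b + a))"
        using True by (simp add: int_pow_mult m_assoc)
      show ?thesis
      proof (cases "b + a = 0")
        case True
        then show ?thesis unfolding eq normal_form_def using xy append by auto
      next
        case False
        then show ?thesis
          unfolding eq using red[OF xy(1) reduced.append[OF append(3-5) False]] append assms(2) by simp
      qed
    qed
  qed
  show ?thesis
  proof (cases "z \<in> H")
    case True
    then show ?thesis using red[OF True reduced.syllable[OF False assms(2)]] by simp
  next
    case False
    then obtain x y k w where "x \<in> H" "y \<in> H" "reduced k w" "z = x \<otimes> (w \<otimes> y)"
      using assms(1) unfolding normal_form_def by blast
    then show ?thesis using *[of x y k w] by (simp add: m_assoc)
  qed
qed

lemma normal_form_H':
  assumes "z \<in> H'"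
  shows "normal_form z"
proof -
  \<comment> \<open>Allowing any left factor in normal form lets the product case of
    \<open>generate\<close> compose the two induction hypotheses.\<close>
  have "normal_form (y \<otimes> z)" if "normal_form y" for y
    using assms[unfolded H'_def] that
  proof (induction arbitrary: y rule: generate.induct)
    case one
    then show ?case by simp
  next
    case (incl h)
    then show ?case using normal_form_mult_H normal_form_mult_power by auto
  next
    case (inv h)
    then show ?case
      using normal_form_mult_H[OF inv(2), of "inv h"] normal_form_mult_power[OF inv(2), of "- n"]
      by (auto simp: int_pow_neg)
  next
    case (eng h1 h2)
    have "y \<in> carrier G" using eng(5) unfolding normal_form_def by auto
    moreover have "h1 \<in> carrier G" "h2 \<in> carrier G"
      using eng(1,2) subgroup.mem_carrier[OF subgroup_H'] unfolding H'_def by auto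
    ultimately have "y \<otimes> (h1 \<otimes> h2) = (y \<otimes> h1) \<otimes> h2" by (simp add: m_assoc)
    then show ?case using eng by simp
  qed
  from this[of \<one>] show ?thesis
    using assms subgroup.mem_carrier[OF subgroup_H'] by (simp add: normal_form_def)
qed

text \<open>A positive power of \<open>w \<otimes> x\<close> is again a reduced element times
  \<open>x\<close>, because the non-trivial \<open>x\<close> separates the copies of
  \<open>w\<close>. A reduced element is not in \<open>H\<close>, so it is not
  \<open>inv x\<close>.\<close>

lemma reduced_mult_infinite_order:
  assumes w: "reduced k w" and x: "x \<in> H" "x \<noteq> \<one>"
  shows "inj (\<lambda>k::int. (w \<otimes> x) [^] k)"
proof -
  have "\<exists>l u. reduced l u \<and> (w \<otimes> x) [^] Suc t = u \<otimes> x" for t :: nat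
  proof (induction t)
    case 0
    then show ?case using w x by auto
  next
    case (Suc t)
    then obtain l u where u: "reduced l u" "(w \<otimes> x) [^] Suc t = u \<otimes> x" by blast
    have "(w \<otimes> x) [^] Suc (Suc t) = (w \<otimes> x) [^] Suc t \<otimes> (w \<otimes> x)"
      by (rule nat_pow_Suc)
    also have "\<dots> = (u \<otimes> (x \<otimes> w)) \<otimes> x"
      using u w x by (simp only: u(2)) (simp add: m_assoc)
    finally have "(w \<otimes> x) [^] Suc (Suc t) = (u \<otimes> (x \<otimes> w)) \<otimes> x" .
    then show ?case using reduced_mult[OF u(1) x w] by blast
  qed
  moreover have "u \<otimes> x \<noteq> \<one>" if "reduced l u" for l u
    using reduced_notin[OF that] that x by (metis H_closed H_inv inv_equality inv_inv reduced_closed)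
  ultimately show ?thesis
    using w x by (metis H_closed Suc_pred int_pow_inj_iff m_closed reduced_closed)
qed

text \<open>Cyclic reduction. If \<open>x\<close> is trivial, the last power of \<open>w\<close> is
  rotated to the front and merged with the first. If they cancel, either only a letter of
  \<open>H\<close> is left, or two letters of \<open>H\<close> are brought together by a further
  rotation and two powers have disappeared.\<close>

lemma reduced_mult_torsion_free:
  assumes "reduced k w" "x \<in> H"
  shows "inj (\<lambda>k::int. (w \<otimes> x) [^] k)"
  using assms
proof (induction k arbitrary: w x rule: less_induct)
  case (less k)
  note w = less.prems(1) and x = less.prems(2)
  show ?case
  proof (cases "x = \<one>")
    case False
    then show ?thesis using reduced_mult_infinite_order w x by blast
  next
    case True
    from w show ?thesis
    proof cases
      case (syllable a)
      then have "inj (\<lambda>k::int. w [^] k)"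
        by (intro injI) (auto simp: int_pow_pow dest: injD[OF inj])
      then show ?thesis using True w by simp
    next
      case (append l w1 x1 b)
      have rot: ?thesis if "inj (\<lambda>k::int. (g [^] b \<otimes> (w1 \<otimes> x1)) [^] k)"
        using inj_int_pow_rotate[OF _ _ that] append True by (simp add: m_assoc)
      have tail: "inj (\<lambda>k::int. (g [^] b \<otimes> (g [^] c \<otimes> y)) [^] k)"
        if "inj (\<lambda>k::int. (g [^] (b + c) \<otimes> y) [^] k)" "y \<in> carrier G" for c y
        using that by (simp add: int_pow_mult m_assoc)
      from append(3) show ?thesis
      proof (cases rule: reduced_front)
        case (one c)
        have "inj (\<lambda>k::int. (g [^] (b + c) \<otimes> x1) [^] k)"
        proof (cases "b + c = 0")
          case True
          then show ?thesis using torsion_free_H append unfolding torsion_free_def by simp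
        next
          case False
          then show ?thesis
            using reduced_mult_infinite_order[OF reduced.syllable[OF False]] append one by simp
        qed
        then show ?thesis using rot tail[of c x1] one append by simp
      next
        case (more l' c x2 u)
        have "inj (\<lambda>k::int. (g [^] (b + c) \<otimes> (x2 \<otimes> (u \<otimes> x1))) [^] k)"
        proof (cases "b + c = 0")
          case True
          have "inj (\<lambda>k::int. (u \<otimes> (x1 \<otimes> x2)) [^] k)"
            using less.IH[of l' u "x1 \<otimes> x2"] more append by simp
          then have "inj (\<lambda>k::int. (x2 \<otimes> (u \<otimes> x1)) [^] k)"
            using inj_int_pow_rotate[of "u \<otimes> x1" x2] more append by (simp add: m_assoc)
          then show ?thesis using True more append by simp
        next
          case False
          have "reduced (1 + l') (g [^] (b + c) \<otimes> (x2 \<otimes> u))"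
            using False more append by (intro reduced_mult reduced.syllable) auto
          from reduced_mult_infinite_order[OF this append(4,5)] show ?thesis
            using more append by (simp add: m_assoc)
        qed
        then show ?thesis
          using rot tail[of c "x2 \<otimes> (u \<otimes> x1)"] more append by (simp add: m_assoc)
      qed
    qed
  qed
qed

lemma torsion_free_H': "torsion_free H'"
  unfolding torsion_free_def
proof (intro ballI impI)
  fix z assume z: "z \<in> H'" "z \<noteq> \<one>"
  show "inj (\<lambda>k::int. z [^] k)"
  proof (cases "z \<in> H")
    case True
    then show ?thesis using torsion_free_H z unfolding torsion_free_def by blast
  next
    case False
    then obtain x y k w where *: "x \<in> H" "y \<in> H" "reduced k w" "z = x \<otimes> (w \<otimes> y)"
      using normal_form_H'[OF z(1)] unfolding normal_form_def by blast
    then have "inj (\<lambda>k::int. (w \<otimes> y \<otimes> x) [^] k)"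
      using reduced_mult_torsion_free[of k w "y \<otimes> x"] by (simp add: m_assoc)
    then show ?thesis
      using inj_int_pow_rotate[of "w \<otimes> y" x] * by simp
  qed
qed

text \<open>A geodesic to \<open>x \<otimes> g [^] a\<close> is covered by one to \<open>x\<close>
  and the axis translated by \<open>x\<close>. On the latter, the exponent of the nearby power is
  rounded down to a multiple of \<open>n\<close>, at a cost of at most \<open>nat n * L g\<close>,
  so as to land in \<open>H'\<close>.\<close>

lemma syllable_near:
  assumes R1: "\<forall>h\<in>H. \<forall>p\<in>carrier G. gp p \<one> h \<le> D + \<delta> \<longrightarrow> (\<exists>x\<in>H. L (inv x \<otimes> p) \<le> R1)"
    and R2: "\<forall>p\<in>carrier G. \<forall>b::int. gp p \<one> (g [^] b) \<le> D + \<delta> \<longrightarrow> (\<exists>a::int. L (inv (g [^] a) \<otimes> p) \<le> R2)"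
    and p: "p \<in> carrier G" and x: "x \<in> H" and near: "gp p \<one> (x \<otimes> g [^] (a::int)) \<le> D"
  shows "\<exists>h\<in>H'. L (inv h \<otimes> p) \<le> R1 + R2 + nat n * L g"
proof -
  consider "gp p \<one> x \<le> D + \<delta>" | "gp p x (x \<otimes> g [^] a) \<le> D + \<delta>"
    using hyp_cases[of p \<one> x "x \<otimes> g [^] a"] near p x by force
  then show ?thesis
  proof cases
    case 1
    then obtain h where "h \<in> H" "L (inv h \<otimes> p) \<le> R1" using R1 p x by blast
    then show ?thesis using mem_H'(1) by (intro bexI[of _ h]) auto
  next
    case 2
    have "gp (inv x \<otimes> p) \<one> (g [^] a) = gp p x (x \<otimes> g [^] a)"
      using gp_left[of "inv x" p x "x \<otimes> g [^] a"] p x by simp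
    then obtain b :: int where b: "L (inv (g [^] b) \<otimes> (inv x \<otimes> p)) \<le> R2"
      using R2[rule_format, of "inv x \<otimes> p" a] 2 p x by auto
    let ?q = "n * (b div n)"
    have "g [^] b = g [^] ?q \<otimes> g [^] (b mod n)"
      by (simp flip: int_pow_mult)
    then have "inv (x \<otimes> g [^] ?q) \<otimes> p = g [^] (b mod n) \<otimes> (inv (g [^] b) \<otimes> (inv x \<otimes> p))"
      using p x by (simp add: inv_mult_group m_assoc)
    then have "L (inv (x \<otimes> g [^] ?q) \<otimes> p) \<le> L (g [^] (b mod n)) + R2"
      using L_mult[of "g [^] (b mod n)" "inv (g [^] b) \<otimes> (inv x \<otimes> p)"] b p x by simp
    moreover have "L (g [^] (b mod n)) \<le> nat n * L g"
    proof -
      have "nat \<bar>b mod n\<bar> \<le> nat n" using n(1) by (simp add: less_imp_le)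
      then show ?thesis
        using L_int_pow[OF g, of "b mod n"] by (meson mult_le_mono1 order_trans)
    qed
    ultimately have "L (inv (x \<otimes> g [^] ?q) \<otimes> p) \<le> R1 + R2 + nat n * L g" by simp
    moreover have "x \<otimes> g [^] ?q \<in> H'" using x mem_H' by simp
    ultimately show ?thesis by blast
  qed
qed

text \<open>
  A geodesic from \<open>\<one>\<close> to \<open>w y\<close> passes near \<open>w\<close>. The second alternative, that \<open>p\<close> lies beyond \<open>w\<close>,
  carries the constant \<open>D + \<delta>\<close> through the whole induction, so that no error accumulates.
\<close>

lemma reduced_near:
  assumes "reduced k w" and D: "D \<ge> 0"
    and near: "\<And>p x a. \<lbrakk>p \<in> carrier G; x \<in> H; gp p \<one> (x \<otimes> g [^] (a::int)) \<le> K + 2 * D + 4 * \<delta>\<rbrakk> \<Longrightarrow>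
      \<exists>h\<in>H'. L (inv h \<otimes> p) \<le> R"
    and "p \<in> carrier G" "y \<in> carrier G" "gp w \<one> y \<le> K + 2 * \<delta>" "gp p \<one> y \<le> D"
  shows "(\<exists>h\<in>H'. L (inv h \<otimes> p) \<le> R) \<or> gp p w y \<le> D + \<delta>"
  using assms(1,4-7)
proof (induction arbitrary: p y rule: reduced.induct)
  case (syllable a)
  then have "gp p \<one> (g [^] a) \<le> D + \<delta> \<or> gp p (g [^] a) y \<le> D + \<delta>"
    using hyp_cases[of p \<one> "g [^] a" y] by force
  moreover have "\<exists>h\<in>H'. L (inv h \<otimes> p) \<le> R" if "gp p \<one> (g [^] a) \<le> D + \<delta>"
    using near[of p \<one> a] that syllable K_nonneg delta_nonneg D by simp
  ultimately show ?case by blast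
next
  case (append k w x a)
  let ?w = "w \<otimes> (x \<otimes> g [^] a)"
  have wG: "w \<in> carrier G" and xG: "x \<in> carrier G" using append by simp_all
  obtain b :: int where b: "gp \<one> (inv w) (g [^] b) \<ge> M" using reduced_end[OF append(1)] by blast
  have len: "d w ?w \<ge> M + K + 4 * \<delta>"
  proof -
    have "gp \<one> (inv x) (g [^] a) \<le> K" using K append by simp
    then have "d (inv x) (g [^] a) \<ge> L (g [^] a) - 2 * K"
      using xG by (simp add: gp_def L_inv field_simps)
    moreover have "d (inv x) (g [^] a) = d w ?w" using wG xG by (simp add: d_def)
    ultimately show ?thesis using n(2)[OF append(4,5)] by simp
  qed
  \<comment> \<open>The bound on \<open>gp ?w \<one> y\<close> has to be handed down to
    \<open>w\<close> for the induction hypothesis. It returns with the same constant because it is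
    derived afresh from the cancellation at \<open>w\<close>, at most \<open>K + \<delta>\<close>,
    and the length of the syllable.\<close>
  have "gp w \<one> ?w = gp \<one> (inv w) (x \<otimes> g [^] a)"
    using gp_left[of "inv w" w \<one> ?w] wG xG by simp
  then have 1: "gp w \<one> ?w \<le> K + \<delta>"
    using separated(2)[OF wG b append(2,3)] by simp
  then have "gp ?w \<one> w > (K + 2 * \<delta>) + \<delta>"
    using gp_flip[of w ?w \<one>] gp_commute[of \<one> ?w w] gp_commute[of \<one> w ?w] len M K_nonneg delta_nonneg wG xG by simp
  from hyp_le[OF append.prems(3) this] have "gp ?w w y \<le> K + 3 * \<delta>"
    using append.prems(2) wG xG by simp
  then have "gp w ?w y > (K + \<delta>) + \<delta>"
    using gp_flip[of w ?w y] len M K_nonneg delta_nonneg wG xG append.prems(2) by simp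
  from hyp_le[OF _ this, of \<one>] have w: "gp w \<one> y \<le> K + 2 * \<delta>"
    using 1 gp_commute[of \<one> ?w w] gp_commute[of \<one> y w] append.prems(2) wG xG by simp
  show ?case
  proof (cases "\<exists>h\<in>H'. L (inv h \<otimes> p) \<le> R")
    case False
    then have wy: "gp p w y \<le> D + \<delta>" using append.IH[OF append.prems(1,2) w append.prems(4)] by blast
    have "gp p \<one> ?w \<le> D + \<delta> \<or> gp p ?w y \<le> D + \<delta>"
      using hyp_cases[of p \<one> ?w y] append.prems(1,2,4) wG xG by force
    moreover have "\<not> gp p \<one> ?w \<le> D + \<delta>"
    proof
      assume p: "gp p \<one> ?w \<le> D + \<delta>"
      \<comment> \<open>The geodesics from \<open>\<one>\<close> to \<open>?w\<close> and from
        \<open>w\<close> to \<open>y\<close> overlap between \<open>w\<close> and \<open>?w\<close>.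
        A point near both is near the overlap; after translation by \<open>inv w\<close> it is near
        a single syllable.\<close>
      have "gp p w ?w \<le> K + 2 * D + 4 * \<delta>"
        using p wy append.prems(3) d_triangle[of \<one> p y] d_triangle[of w ?w y]
          d_commute[of p \<one>] d_commute[of w p] d_commute[of ?w \<one>] d_commute[of p y] d_commute[of y ?w] append.prems(1,2) wG xG
        unfolding gp_def by (simp add: field_simps)
      moreover have "gp (inv w \<otimes> p) \<one> (x \<otimes> g [^] a) = gp p w ?w"
        using gp_left[of "inv w" p w ?w] append.prems(1) wG xG by simp
      ultimately obtain h where h: "h \<in> H'" "L (inv h \<otimes> (inv w \<otimes> p)) \<le> R"
        using near[of "inv w \<otimes> p" x a] append wG by auto
      have "h \<in> carrier G" using h(1) subgroup_H' by (meson subgroup.mem_carrier)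
      then have "inv (w \<otimes> h) \<otimes> p = inv h \<otimes> (inv w \<otimes> p)"
        using wG append.prems(1) by (simp add: inv_mult_group m_assoc)
      moreover have "w \<otimes> h \<in> H'" using h reduced_H'[OF append(1)] by simp
      ultimately show False using h False by metis
    qed
    ultimately show ?thesis by blast
  qed blast
qed

text \<open>In the normal form \<open>x \<otimes> (w \<otimes> y)\<close> the outer letters are
  handled by quasiconvexity of \<open>H\<close> and the middle by \<open>reduced_near\<close>, each
  after translation back by an element of \<open>H'\<close>.\<close>

lemma quasiconvex_H':
  assumes "quasiconvex H"
  shows "quasiconvex H'"
  unfolding quasiconvex_def
proof
  fix D0 :: real
  define D where "D = \<bar>D0\<bar> + \<delta>"
  have D: "D \<ge> 0" "D0 + \<delta> \<le> D" using delta_nonneg unfolding D_def by auto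
  define D' where "D' = K + 2 * D + 4 * \<delta>"
  obtain R1 :: nat where R1: "\<forall>h\<in>H. \<forall>p\<in>carrier G. gp p \<one> h \<le> D' + \<delta> \<longrightarrow> (\<exists>x\<in>H. L (inv x \<otimes> p) \<le> R1)"
    using assms unfolding quasiconvex_def by blast
  obtain R2 :: nat where R2: "\<forall>p\<in>carrier G. \<forall>b::int. gp p \<one> (g [^] b) \<le> D' + \<delta> \<longrightarrow> (\<exists>a::int. L (inv (g [^] a) \<otimes> p) \<le> R2)"
    using cyclic_quasiconvex[OF g infinite_order_loxodromic[OF g inj]] by blast
  define R where "R = R1 + R2 + nat n * L g"
  have near: "\<exists>h\<in>H'. L (inv h \<otimes> p) \<le> R"
    if "p \<in> carrier G" "x \<in> H" "gp p \<one> (x \<otimes> g [^] (a::int)) \<le> K + 2 * D + 4 * \<delta>" for p x a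
    using syllable_near[OF R1 R2 that(1,2)] that(3) unfolding R_def D'_def by blast
  have nearH: "\<exists>h\<in>H'. L (inv h \<otimes> p) \<le> R"
    if "p \<in> carrier G" "x \<in> H" "gp p \<one> x \<le> D + \<delta>" for p x
    using near[of p x 0] that K_nonneg D delta_nonneg by simp
  have shift: "\<exists>h\<in>H'. L (inv h \<otimes> p) \<le> R"
    if "x \<in> H'" "p \<in> carrier G" "\<exists>h\<in>H'. L (inv h \<otimes> (inv x \<otimes> p)) \<le> R" for p x
  proof -
    from that(3) obtain h where h: "h \<in> H'" "L (inv h \<otimes> (inv x \<otimes> p)) \<le> R" by blast
    have "h \<in> carrier G" "x \<in> carrier G"
      using h(1) that(1) subgroup_H' by (meson subgroup.mem_carrier)+
    then have "inv (x \<otimes> h) \<otimes> p = inv h \<otimes> (inv x \<otimes> p)"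
      using that(2) by (simp add: inv_mult_group m_assoc)
    then show ?thesis using h that(1) by (metis H'_mult)
  qed
  have "\<exists>h\<in>H'. L (inv h \<otimes> p) \<le> R"
    if z: "z \<in> H'" and p: "p \<in> carrier G" and zp: "gp p \<one> z \<le> D0" for z p
  proof (cases "z \<in> H")
    case True
    then show ?thesis using nearH[OF p True] zp D delta_nonneg by simp
  next
    case False
    then obtain x y k w where *: "x \<in> H" "y \<in> H" "reduced k w" "z = x \<otimes> (w \<otimes> y)"
      using normal_form_H'[OF z] unfolding normal_form_def by blast
    note G = H_closed[OF *(1)] H_closed[OF *(2)] reduced_closed[OF *(3)]
    have "gp p \<one> x \<le> D0 + \<delta> \<or> gp p x z \<le> D0 + \<delta>"
      using hyp_cases[of p \<one> x z] zp p G *(4) by force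
    then show ?thesis
    proof
      assume "gp p \<one> x \<le> D0 + \<delta>"
      then show ?thesis using nearH[OF p *(1)] D delta_nonneg by simp
    next
      assume "gp p x z \<le> D0 + \<delta>"
      define p' where "p' = inv x \<otimes> p"
      have p': "p' \<in> carrier G" using p G by (simp add: p'_def)
      have "gp p' \<one> (w \<otimes> y) = gp p x z"
        using gp_left[of "inv x" p x z] p G *(4) by (simp add: p'_def)
      then have 1: "gp p' \<one> (w \<otimes> y) \<le> D" using \<open>gp p x z \<le> D0 + \<delta>\<close> D by simp
      obtain b :: int where b: "gp \<one> (inv w) (g [^] b) \<ge> M" using reduced_end[OF *(3)] by blast
      have "gp w \<one> (w \<otimes> y) = gp \<one> (inv w) y"
        using gp_left[of "inv w" w \<one> "w \<otimes> y"] G by simp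
      then have 2: "gp w \<one> (w \<otimes> y) \<le> K + 2 * \<delta>"
        using separated(1)[OF G(3) b *(2)] delta_nonneg by simp
      have "(\<exists>h\<in>H'. L (inv h \<otimes> p') \<le> R) \<or> gp p' w (w \<otimes> y) \<le> D + \<delta>"
        by (rule reduced_near[OF *(3) D(1) _ p' _ 2 1]) (use near G in simp_all)
      then have "\<exists>h\<in>H'. L (inv h \<otimes> p') \<le> R"
      proof
        assume "gp p' w (w \<otimes> y) \<le> D + \<delta>"
        moreover have "gp (inv w \<otimes> p') \<one> y = gp p' w (w \<otimes> y)"
          using gp_left[of "inv w" p' w "w \<otimes> y"] p' G by simp
        ultimately have "\<exists>h\<in>H'. L (inv h \<otimes> (inv w \<otimes> p')) \<le> R"
          using nearH[of "inv w \<otimes> p'" y] p' G * by simp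
        then show ?thesis using shift reduced_H'[OF *(3)] p' by blast
      qed auto
      then show ?thesis using shift mem_H'(1)[OF *(1)] p unfolding p'_def by blast
    qed
  qed
  then show "\<exists>R::nat. \<forall>h\<in>H'. \<forall>p\<in>carrier G. gp p \<one> h \<le> D0 \<longrightarrow> (\<exists>x\<in>H'. L (inv x \<otimes> p) \<le> R)"
    by blast
qed

text \<open>If \<open>z t = s\<close>, a geodesic of \<open>z\<close> is covered by initial segments of \<open>s\<close> and of a translate of \<open>t\<close>.\<close>

lemma merged_coset_prefix:
  assumes z: "z \<in> H'" "z \<notin> H" and t: "t \<in> carrier G"
  shows "\<exists>x\<in>H. \<exists>b::int. gp \<one> (x \<otimes> t) (g [^] b) \<ge> M / 2 - \<delta> \<or> gp \<one> (x \<otimes> (z \<otimes> t)) (g [^] b) \<ge> M / 2 - \<delta>"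
proof -
  obtain x y k w where *: "x \<in> H" "y \<in> H" "reduced k w" "z = x \<otimes> (w \<otimes> y)"
    using normal_form_H'[OF z(1)] z(2) unfolding normal_form_def by blast
  note G = H_closed[OF *(1)] H_closed[OF *(2)] reduced_closed[OF *(3)]
  have M0: "M \<ge> 0" using M K_nonneg delta_nonneg by simp
  obtain b :: int where b: "gp \<one> (inv w) (g [^] b) \<ge> M" using reduced_end[OF *(3)] by blast
  obtain c :: int where c: "gp \<one> w (g [^] c) \<ge> M"
    using reduced_end[OF reduced_inv[OF *(3)]] G by auto
  define s where "s = y \<otimes> t"
  have s: "s \<in> carrier G" using t G by (simp add: s_def)
  have ws: "inv x \<otimes> (z \<otimes> t) = w \<otimes> s"
    using t G by (simp add: s_def *(4) m_assoc)
  have "gp w \<one> (w \<otimes> s) = gp \<one> (inv w) s"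
    using gp_left[of "inv w" w \<one> "w \<otimes> s"] s G by simp
  \<comment> \<open>The length of \<open>w\<close> is at least \<open>M\<close> and is shared by the
    two products, so one of them is at least \<open>M / 2\<close>.\<close>
  then have "gp \<one> w (w \<otimes> s) + gp \<one> (inv w) s = L w"
    using gp_flip[of \<one> w "w \<otimes> s"] s G by simp
  moreover have "L w \<ge> M"
    using c gp_le(1)[of \<one> w "g [^] c"] G by simp
  ultimately consider "gp \<one> w (w \<otimes> s) \<ge> M / 2" | "gp \<one> (inv w) s \<ge> M / 2" by linarith
  then show ?thesis
  proof cases
    case 1
    have "gp \<one> (w \<otimes> s) (g [^] c) \<ge> M / 2 - \<delta>"
      using 1 c s G M0 gp_commute[of w "w \<otimes> s" \<one>] by (intro hyp_ge[where y = w]) auto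
    then show ?thesis using ws *(1) by (intro bexI[of _ "inv x"] exI[of _ c] disjI2) auto
  next
    case 2
    have "gp \<one> s (g [^] b) \<ge> M / 2 - \<delta>"
      using 2 b s G M0 gp_commute[of "inv w" s \<one>] by (intro hyp_ge[where y = "inv w"]) auto
    then show ?thesis using *(2) unfolding s_def by (intro bexI[of _ y] exI[of _ b] disjI1) auto
  qed
qed

end


section \<open>Ping-pong in non-elementary groups\<close>

context hyperbolic_length
begin

text \<open>\<open>x\<close> lies near a geodesic between \<open>x \<otimes> g [^] (- k)\<close> and
  \<open>x \<otimes> g [^] k\<close>. For suitable large \<open>k\<close> the relation puts these
  points within \<open>L x\<close> of powers of \<open>g\<close>. Far away this difference is
  harmless, so \<open>x\<close> lies near a geodesic between powers of \<open>g\<close>, with a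
  constant that does not depend on \<open>x\<close>.\<close>

lemma commensurated_near_axis:
  assumes g: "g \<in> carrier G" and inj: "inj (\<lambda>k::int. g [^] k)"
    and comm: "\<And>x. x \<in> carrier G \<Longrightarrow> \<exists>(p::int) (q::int). p \<noteq> 0 \<and> g [^] p \<otimes> x = x \<otimes> g [^] q"
  shows "\<exists>R::nat. \<forall>x\<in>carrier G. \<exists>k::int. L (inv (g [^] k) \<otimes> x) \<le> R"
proof -
  have lox: "loxodromic g" using g inj by (rule infinite_order_loxodromic)
  obtain K where "K \<ge> 0" and
    K: "\<And>(a::int) (b::int). 0 \<le> a \<and> a \<le> b \<or> b \<le> a \<and> a \<le> 0 \<Longrightarrow> gp (g [^] a) \<one> (g [^] b) \<le> K"
    using loxodromic_gp[OF g lox] by blast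
  obtain R :: nat where R: "\<forall>p\<in>carrier G. \<forall>b::int. gp p \<one> (g [^] b) \<le> K + 2 * \<delta> \<longrightarrow>
      (\<exists>a::int. L (inv (g [^] a) \<otimes> p) \<le> R)"
    using cyclic_quasiconvex[OF g lox] by blast
  have "\<exists>k::int. L (inv (g [^] k) \<otimes> x) \<le> R" if x: "x \<in> carrier G" for x
  proof -
    obtain p q :: int where pq: "p \<noteq> 0" "g [^] p \<otimes> x = x \<otimes> g [^] q" using comm[OF x] by blast
    have "q \<noteq> 0"
    proof
      assume "q = 0"
      then have "g [^] p = g [^] (0::int)" using pq x g by simp
      then show False using injD[OF inj] pq(1) by blast
    qed
    obtain n :: int where n: "n > 0" "\<And>k::int. \<bar>k\<bar> \<ge> n \<Longrightarrow> L (g [^] k) \<ge> nat \<lceil>L x + K + 2 * \<delta> + 1\<rceil>"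
      using exists_large_power[OF inj g] by blast
    \<comment> \<open>The sign of \<open>q\<close> is unknown; with this \<open>j\<close> the
      exponent \<open>q * j\<close> is positive and at least \<open>n\<close>.\<close>
    define j where "j = sgn q * n"
    have qj: "q * j = \<bar>q\<bar> * n" by (simp add: j_def abs_sgn mult.assoc)
    have "\<bar>q\<bar> * n \<ge> n" using \<open>q \<noteq> 0\<close> n(1) by (simp add: mult_le_cancel_right1)
    then have qjn: "\<bar>q * j\<bar> \<ge> n" "\<bar>q * (- j)\<bar> \<ge> n" using qj n(1) by simp_all
    have long: "L (g [^] (q * j)) > L x + K + 2 * \<delta>" "L (g [^] (q * (- j))) > L x + K + 2 * \<delta>"
      using n(2)[OF qjn(1)] n(2)[OF qjn(2)] unfolding nat_ceiling_le_eq by linarith+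
    define A B where "A = x \<otimes> g [^] (q * (- j))" and "B = x \<otimes> g [^] (q * j)"
    define A' B' where "A' = g [^] (p * (- j))" and "B' = g [^] (p * j)"
    have conj: "g [^] (p * i) \<otimes> x = x \<otimes> g [^] (q * i)" for i
      using int_pow_intertwine[OF _ _ x pq(2), of i] g by (simp add: int_pow_pow)
    have G: "A \<in> carrier G" "B \<in> carrier G" "A' \<in> carrier G" "B' \<in> carrier G"
      using x g by (simp_all add: A_def B_def A'_def B'_def)
    have AA: "d A A' = L x" "d B B' = L x"
      using x g conj[of "- j"] conj[of j] unfolding A_def B_def A'_def B'_def
      by (metis d_left_one(2) int_pow_closed)+
    have "gp x A B = gp \<one> (g [^] (- (\<bar>q\<bar> * n))) (g [^] (\<bar>q\<bar> * n))"
      using gp_left[of x \<one> "g [^] (q * (- j))" "g [^] (q * j)"] x g qj by (simp add: A_def B_def)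
    also have "\<dots> = gp (g [^] (\<bar>q\<bar> * n)) \<one> (g [^] (\<bar>q\<bar> * n + \<bar>q\<bar> * n))"
      using gp_left[of "g [^] (\<bar>q\<bar> * n)" \<one> "g [^] (- (\<bar>q\<bar> * n))" "g [^] (\<bar>q\<bar> * n)"] g
      unfolding int_pow_mult[OF g] by (simp add: int_pow_neg)
    also have "\<dots> \<le> K"
      using n(1) by (intro K) simp
    finally have 1: "gp x A B \<le> K" .
    have "d x A = L (g [^] (q * (- j)))" "d x B = L (g [^] (q * j))"
      using x g by (simp_all add: A_def B_def)
    then have "gp x A A' > K + \<delta>" and 3: "gp x B B' > K + \<delta> + \<delta>"
      using gp_ge[of x A A'] gp_ge[of x B B'] AA long x G delta_nonneg by linarith+
    from hyp_le[OF 1 this(1)] have "gp x B A' \<le> K + \<delta>"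
      using x G gp_commute[of A' B x] by simp
    from hyp_le[OF this 3] have "gp x A' B' \<le> K + 2 * \<delta>"
      using x G gp_commute[of A' B' x] by simp
    moreover have "gp (B' \<otimes> x) \<one> (g [^] (p * j + p * j)) = gp x A' B'"
      using gp_left[of B' x A' B'] x g G unfolding int_pow_mult[OF g] by (simp add: A'_def B'_def int_pow_neg)
    ultimately obtain a :: int where a: "L (inv (g [^] a) \<otimes> (B' \<otimes> x)) \<le> R"
      using R[rule_format, of "B' \<otimes> x" "p * j + p * j"] x G by auto
    have "inv (g [^] (a - p * j)) \<otimes> x = inv (g [^] a) \<otimes> (B' \<otimes> x)"
    proof -
      have "inv (g [^] (a - p * j)) = g [^] (- a + p * j)"
        using int_pow_neg[of g "a - p * j"] g by simp
      also have "\<dots> = inv (g [^] a) \<otimes> B'"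
        using g unfolding int_pow_mult[OF g] B'_def by (simp add: int_pow_neg)
      finally show ?thesis using x g G by (simp add: m_assoc)
    qed
    then show ?thesis using a by metis
  qed
  then show ?thesis by blast
qed

text \<open>Otherwise all of \<open>G\<close> lies within bounded distance of the cyclic group
  generated by \<open>g\<close>, whose cosets are then represented in a finite ball.\<close>

lemma exists_transverse:
  assumes g: "g \<in> carrier G" and inj: "inj (\<lambda>k::int. g [^] k)"
    and "\<not> elementary_group G"
  shows "\<exists>x\<in>carrier G. \<forall>(p::int) (q::int). p \<noteq> 0 \<longrightarrow> g [^] p \<otimes> x \<noteq> x \<otimes> g [^] q"
proof (rule ccontr)
  assume "\<not> ?thesis"
  then have "\<And>x. x \<in> carrier G \<Longrightarrow> \<exists>(p::int) (q::int). p \<noteq> 0 \<and> g [^] p \<otimes> x = x \<otimes> g [^] q"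
    by blast
  then obtain R :: nat where R: "\<forall>x\<in>carrier G. \<exists>k::int. L (inv (g [^] k) \<otimes> x) \<le> R"
    using commensurated_near_axis[OF g inj] by blast
  let ?H = "generate G {g}"
  have H: "subgroup ?H G" using g by (intro generate_is_subgroup) simp
  have "rcosets ?H \<subseteq> (\<lambda>b. ?H #> b) ` {x \<in> carrier G. L x \<le> R}"
  proof
    fix C assume "C \<in> rcosets ?H"
    then obtain x where x: "x \<in> carrier G" "C = ?H #> x" by (auto simp: RCOSETS_def)
    from R x obtain k :: int where k: "L (inv (g [^] k) \<otimes> x) \<le> R" by blast
    have "g [^] k \<in> ?H" using H by (intro subgroup_int_pow_closed) (simp_all add: generate.incl)
    then have "inv (g [^] k) \<otimes> x \<in> ?H #> x"
      using H subgroup.m_inv_closed by (force simp: r_coset_def)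
    then have "?H #> x = ?H #> (inv (g [^] k) \<otimes> x)"
      using x H by (intro repr_independence)
    then show "C \<in> (\<lambda>b. ?H #> b) ` {x \<in> carrier G. L x \<le> R}"
      using x g k by auto
  qed
  then have "finite (rcosets ?H)"
    using finite_ball finite_surj by metis
  then show False
    using assms(3) g is_group unfolding elementary_group_def by blast
qed

text \<open>Ping-pong: right multiplication by \<open>v\<close> moves the complement of one cone into the opposite cone.\<close>

definition push :: "real \<Rightarrow> 'g \<Rightarrow> 'g \<Rightarrow> 'g" where
  "push T v h = (if gp \<one> (inv h) v \<ge> T then h else h \<otimes> v)"

text \<open>If \<open>inv h\<close> is outside the cone of \<open>v\<close>, less than
  \<open>T\<close> of \<open>v\<close> cancels in \<open>h \<otimes> v\<close>. The remaining
  length, at least \<open>T\<close>, shows at the beginning of \<open>inv (h \<otimes> v)\<close> as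
  a piece of \<open>inv v\<close>.\<close>

lemma push_cone:
  assumes "v \<in> carrier G" "L v \<ge> 2 * (T :: real)" "h \<in> carrier G"
  shows "gp \<one> (inv (push T v h)) v \<ge> T \<or> gp \<one> (inv (push T v h)) (inv v) \<ge> T"
proof (cases "gp \<one> (inv h) v \<ge> T")
  case False
  have "gp \<one> (inv (h \<otimes> v)) (inv v) = gp v (inv h) \<one>"
    using gp_left[of "inv v" v "inv h" \<one>] assms by (simp add: inv_mult_group)
  then show ?thesis
    using False gp_flip[of \<one> v "inv h"] gp_commute[of v "inv h" \<one>] gp_commute[of \<one> "inv h" v] assms
    by (simp add: push_def)
qed (simp add: push_def)

text \<open>Only an element that stays and one that is moved could collide. The inverse of the
  common value would lie in the cones of both \<open>v\<close> and \<open>inv v\<close>, which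
  \<open>sep\<close> excludes.\<close>

lemma inj_on_push:
  assumes v: "v \<in> carrier G" "L v \<ge> 2 * (T :: real)" and sep: "gp \<one> v (inv v) < T - \<delta>"
  shows "inj_on (push T v) (carrier G)"
proof -
  have *: False if "h \<in> carrier G" "h' \<in> carrier G" "gp \<one> (inv h) v \<ge> T" "\<not> gp \<one> (inv h') v \<ge> T" "h = h' \<otimes> v"
    for h h'
  proof -
    have "gp \<one> (inv h) (inv v) \<ge> T"
    proof -
      have "gp \<one> (inv h) (inv v) = gp v (inv h') \<one>"
        using gp_left[of "inv v" v "inv h'" \<one>] v that by (simp add: inv_mult_group)
      then show ?thesis
        using that gp_flip[of \<one> v "inv h'"] gp_commute[of v "inv h'" \<one>] gp_commute[of \<one> "inv h'" v] v
        by simp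
    qed
    then have "gp \<one> v (inv v) \<ge> T - \<delta>"
      using that v gp_commute[of "inv h" v \<one>] by (intro hyp_ge[where y = "inv h"]) auto
    then show False using sep by simp
  qed
  show ?thesis
    by (rule inj_onI) (use * v in \<open>auto simp: push_def split: if_splits\<close>)
qed

text \<open>\<open>a\<close> is a large power of \<open>g\<close> and \<open>b\<close> its conjugate
  by the transverse \<open>x\<close>. The cones of \<open>a\<close> and \<open>inv a\<close> are
  apart from those of \<open>b\<close> and \<open>inv b\<close> because the axis and its translate
  by \<open>x\<close> separate after \<open>K2\<close>.\<close>

lemma exists_disjoint_pushes:
  assumes g: "g \<in> carrier G" and inj: "inj (\<lambda>k::int. g [^] k)"
    and x: "x \<in> carrier G" and trans: "\<And>(p::int) (q::int). p \<noteq> 0 \<Longrightarrow> g [^] p \<otimes> x \<noteq> x \<otimes> g [^] q"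
  shows "\<exists>a\<in>carrier G. \<exists>b\<in>carrier G. \<exists>T.
    inj_on (push T a) (carrier G) \<and> inj_on (push T b) (carrier G) \<and>
    push T a ` carrier G \<inter> push T b ` carrier G = {}"
proof -
  have lox: "loxodromic g" using g inj by (rule infinite_order_loxodromic)
  obtain K1 where "K1 \<ge> 0" and
    K1: "\<And>(a::int) (b::int). 0 \<le> a \<and> a \<le> b \<or> b \<le> a \<and> a \<le> 0 \<Longrightarrow> gp (g [^] a) \<one> (g [^] b) \<le> K1"
    using loxodromic_gp[OF g lox] by blast
  obtain K2 where K2: "gp \<one> (g [^] (m::int)) (x \<otimes> g [^] (b::int)) \<le> K2" for m b
    using translate_gp_bounded[OF g inj, of "L x"] x trans by (metis order_refl)
  \<comment> \<open>\<open>3 * L x\<close> is what the estimate for \<open>b\<close> against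
    \<open>inv b\<close> costs: one change of base point and the removal of \<open>inv x\<close>
    from both arguments.\<close>
  define T where "T = max K1 K2 + 3 * L x + \<delta> + 1"
  obtain n :: int where n: "n > 0" "\<And>k::int. \<bar>k\<bar> \<ge> n \<Longrightarrow> L (g [^] k) \<ge> nat \<lceil>2 * T + 2 * L x\<rceil>"
    using exists_large_power[OF inj g] by blast
  have Lgn: "L (g [^] n) \<ge> 2 * T + 2 * L x"
    using n(2)[of n] n(1) by (simp only: nat_ceiling_le_eq)
  define a where "a = g [^] n"
  define b where "b = x \<otimes> (a \<otimes> inv x)"
  have G: "a \<in> carrier G" "b \<in> carrier G" using g x by (simp_all add: a_def b_def)
  have inv_b: "inv b = x \<otimes> (inv a \<otimes> inv x)" using G x by (simp add: b_def inv_mult_group m_assoc)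
  have inv_a: "inv a = g [^] (- n)" using g by (simp add: a_def int_pow_neg)
  have "gp \<one> a (inv a) = gp a \<one> (g [^] (n + n))"
  proof -
    have "g [^] (n + n) = a \<otimes> a" using g unfolding a_def by (rule int_pow_mult)
    then show ?thesis
      using gp_left[of a \<one> "inv a" a] gp_commute[of a "inv a" \<one>] G by simp
  qed
  also have "\<dots> \<le> K1" using K1[of n "n + n"] n(1) by (simp add: a_def)
  finally have aa: "gp \<one> a (inv a) \<le> K1" .
  have right: "gp \<one> y (u \<otimes> inv x) \<le> gp \<one> y u + L x" if "y \<in> carrier G" "u \<in> carrier G" for y u
    using gp_right[of \<one> "u \<otimes> inv x" u y] gp_commute[of y u \<one>] gp_commute[of y "u \<otimes> inv x" \<one>] that x
    by (simp add: L_inv)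
  have "gp \<one> b (inv b) \<le> gp x b (inv b) + L x"
    using gp_base[of \<one> x b "inv b"] x G by simp
  also have "gp x b (inv b) = gp \<one> (a \<otimes> inv x) (inv a \<otimes> inv x)"
    unfolding inv_b using gp_left[of x \<one> "a \<otimes> inv x" "inv a \<otimes> inv x"] x G by (simp add: b_def)
  also have "\<dots> \<le> gp \<one> (a \<otimes> inv x) (inv a) + L x"
    using right[of "a \<otimes> inv x" "inv a"] x G by simp
  also have "gp \<one> (a \<otimes> inv x) (inv a) \<le> gp \<one> a (inv a) + L x"
    using right[of "inv a" a] x G gp_commute[of "a \<otimes> inv x" "inv a" \<one>] gp_commute[of a "inv a" \<one>] by simp
  finally have bb: "gp \<one> b (inv b) \<le> K1 + 3 * L x" using aa by simp
  have ab: "gp \<one> (g [^] m) (x \<otimes> (g [^] k \<otimes> inv x)) \<le> K2 + L x" for m k :: int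
    using right[of "g [^] m" "x \<otimes> g [^] k"] K2[of m k] x g by (simp add: m_assoc)
  have sep: "gp \<one> v w < T - \<delta>" if vw: "v = a \<or> v = inv a" "w = b \<or> w = inv b" for v w
  proof -
    obtain m :: int where "v = g [^] m" using vw(1) inv_a a_def by metis
    moreover obtain k :: int where "w = x \<otimes> (g [^] k \<otimes> inv x)"
      using vw(2) inv_a inv_b a_def b_def by metis
    ultimately have "gp \<one> v w \<le> K2 + L x" using ab by simp
    then show ?thesis unfolding T_def by simp
  qed
  have long: "L a \<ge> 2 * T" "L b \<ge> 2 * T"
  proof -
    show "L a \<ge> 2 * T" using Lgn by (simp add: a_def)
    have "a = inv x \<otimes> (b \<otimes> x)" using x G by (simp add: b_def m_assoc)
    then have "L a \<le> L b + 2 * L x"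
      using L_mult[of "inv x" "b \<otimes> x"] L_mult[of b x] x G by (simp add: L_inv)
    then show "L b \<ge> 2 * T" using Lgn by (simp add: a_def)
  qed
  have "push T a h \<noteq> push T b h'" if h: "h \<in> carrier G" "h' \<in> carrier G" for h h'
  proof
    assume eq: "push T a h = push T b h'"
    define y where "y = inv (push T a h)"
    have y: "y \<in> carrier G" using h G by (simp add: y_def push_def)
    obtain v where v: "v = a \<or> v = inv a" "gp \<one> y v \<ge> T"
      using push_cone[OF G(1) long(1) h(1)] unfolding y_def by blast
    obtain w where w: "w = b \<or> w = inv b" "gp \<one> y w \<ge> T"
      using push_cone[OF G(2) long(2) h(2)] eq unfolding y_def by auto
    have vw: "v \<in> carrier G" "w \<in> carrier G" using v w G by auto
    have "gp \<one> v w \<ge> T - \<delta>"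
      using v w y vw gp_commute[of y v \<one>] by (intro hyp_ge[where y = y]) auto
    then show False using sep[OF v(1) w(1)] by simp
  qed
  moreover have "inj_on (push T a) (carrier G)" "inj_on (push T b) (carrier G)"
    using inj_on_push[OF G(1) long(1)] inj_on_push[OF G(2) long(2)] aa bb by (simp_all add: T_def)
  ultimately show ?thesis using G by blast
qed

end


section \<open>Word lengths and change of generators\<close>

context group
begin

lemma foldr_mult_closed [simp]: "set w \<subseteq> carrier G \<Longrightarrow> foldr (\<otimes>) w \<one> \<in> carrier G"
  by (induction w) auto

lemma foldr_mult_append:
  "\<lbrakk>set u \<subseteq> carrier G; set v \<subseteq> carrier G\<rbrakk> \<Longrightarrow> foldr (\<otimes>) (u @ v) \<one> = foldr (\<otimes>) u \<one> \<otimes> foldr (\<otimes>) v \<one>"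
  by (induction u) (auto simp: m_assoc)

lemma foldr_mult_inv:
  "set w \<subseteq> carrier G \<Longrightarrow> foldr (\<otimes>) (rev (map (m_inv G) w)) \<one> = inv (foldr (\<otimes>) w \<one>)"
proof (induction w)
  case (Cons a w)
  then have "set (rev (map (m_inv G) w)) \<subseteq> carrier G" by auto
  then have "foldr (\<otimes>) (rev (map (m_inv G) w) @ [inv a]) \<one> = inv (foldr (\<otimes>) w \<one>) \<otimes> inv a"
    using Cons by (subst foldr_mult_append) auto
  then show ?case using Cons(2) by (simp add: inv_mult_group)
qed simp

lemma generate_word:
  assumes "g \<in> generate G S" "S \<subseteq> carrier G"
  shows "\<exists>w. set w \<subseteq> S \<union> m_inv G ` S \<and> foldr (\<otimes>) w \<one> = g"
  using assms(1)
proof (induction rule: generate.induct)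
  case one
  then show ?case by (intro exI[of _ "[]"]) auto
next
  case (incl h)
  then show ?case using assms(2) by (intro exI[of _ "[h]"]) auto
next
  case (inv h)
  then show ?case using assms(2) by (intro exI[of _ "[inv h]"]) auto
next
  case (eng h1 h2)
  then obtain u v where uv: "set u \<subseteq> S \<union> m_inv G ` S" "foldr (\<otimes>) u \<one> = h1"
    "set v \<subseteq> S \<union> m_inv G ` S" "foldr (\<otimes>) v \<one> = h2" by blast
  have "S \<union> m_inv G ` S \<subseteq> carrier G" using assms(2) by auto
  then have "foldr (\<otimes>) (u @ v) \<one> = h1 \<otimes> h2"
    using uv by (subst foldr_mult_append) auto
  then show ?case using uv by (intro exI[of _ "u @ v"]) simp
qed

lemma word_length_le:
  assumes "set w \<subseteq> S \<union> m_inv G ` S" "foldr (\<otimes>) w \<one> = g"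
  shows "word_length G S g \<le> length w"
  unfolding word_length_def using assms by (intro Least_le) auto

context
  fixes S assumes S: "finite_generating_set G S"
begin

lemma letters_closed: "S \<union> m_inv G ` S \<subseteq> carrier G"
  using S by (auto simp: finite_generating_set_def)

lemma shortest_word:
  assumes "g \<in> carrier G"
  obtains w where "length w = word_length G S g" "set w \<subseteq> S \<union> m_inv G ` S" "foldr (\<otimes>) w \<one> = g"
proof -
  have "\<exists>n w. length w = n \<and> set w \<subseteq> S \<union> m_inv G ` S \<and> foldr (\<otimes>) w \<one> = g"
    using generate_word[of g S] assms S by (auto simp: finite_generating_set_def)
  from LeastI_ex[OF this] show ?thesis
    using that unfolding word_length_def by blast
qed

lemma word_length_mult:
  assumes "x \<in> carrier G" "y \<in> carrier G"
  shows "word_length G S (x \<otimes> y) \<le> word_length G S x + word_length G S y"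
proof -
  obtain u where u: "length u = word_length G S x" "set u \<subseteq> S \<union> m_inv G ` S" "foldr (\<otimes>) u \<one> = x"
    using shortest_word[OF assms(1)] by blast
  obtain v where v: "length v = word_length G S y" "set v \<subseteq> S \<union> m_inv G ` S" "foldr (\<otimes>) v \<one> = y"
    using shortest_word[OF assms(2)] by blast
  have "foldr (\<otimes>) (u @ v) \<one> = x \<otimes> y"
    using u v letters_closed by (subst foldr_mult_append) auto
  then show ?thesis using word_length_le[of "u @ v" S] u v by simp
qed

lemma word_length_inv_le:
  assumes "x \<in> carrier G"
  shows "word_length G S (inv x) \<le> word_length G S x"
proof -
  obtain u where u: "length u = word_length G S x" "set u \<subseteq> S \<union> m_inv G ` S" "foldr (\<otimes>) u \<one> = x"
    using shortest_word[OF assms] by blast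
  have uG: "set u \<subseteq> carrier G" using u(2) letters_closed by (rule subset_trans)
  have "foldr (\<otimes>) (rev (map (m_inv G) u)) \<one> = inv x"
    using foldr_mult_inv[OF uG] u(3) by simp
  moreover have "set (rev (map (m_inv G) u)) \<subseteq> S \<union> m_inv G ` S"
  proof -
    have "inv a \<in> S \<union> m_inv G ` S" if "a \<in> S \<union> m_inv G ` S" for a
    proof -
      from that consider "a \<in> S" | s where "s \<in> S" "a = inv s" by blast
      then show ?thesis using letters_closed by cases auto
    qed
    then show ?thesis using u(2) unfolding set_rev set_map by (intro image_subsetI) blast
  qed
  ultimately show ?thesis using word_length_le[of "rev (map (m_inv G) u)" S] u by simp
qed

lemma length_group_word_length: "length_group G (word_length G S)"
proof
  show "word_length G S \<one> = 0" using word_length_le[of "[]" S \<one>] by simp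
  show "x = \<one>" if "x \<in> carrier G" "word_length G S x = 0" for x
    using shortest_word[OF that(1)] that(2) by fastforce
  show "word_length G S (inv x) = word_length G S x" if "x \<in> carrier G" for x
    using word_length_inv_le[OF that] word_length_inv_le[of "inv x"] that by simp
  show "word_length G S (x \<otimes> y) \<le> word_length G S x + word_length G S y"
    if "x \<in> carrier G" "y \<in> carrier G" for x y using that by (rule word_length_mult)
  show "finite {x \<in> carrier G. word_length G S x \<le> r}" for r
  proof (rule finite_subset)
    let ?W = "{w. set w \<subseteq> S \<union> m_inv G ` S \<and> length w \<le> r}"
    show "{x \<in> carrier G. word_length G S x \<le> r} \<subseteq> (\<lambda>w. foldr (\<otimes>) w \<one>) ` ?W"
    proof
      fix x assume "x \<in> {x \<in> carrier G. word_length G S x \<le> r}"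
      then have x: "x \<in> carrier G" "word_length G S x \<le> r" by auto
      obtain u where "length u = word_length G S x" "set u \<subseteq> S \<union> m_inv G ` S" "foldr (\<otimes>) u \<one> = x"
        using shortest_word[OF x(1)] by blast
      then show "x \<in> (\<lambda>w. foldr (\<otimes>) w \<one>) ` ?W" using x(2) by (intro image_eqI[of _ _ u]) auto
    qed
    show "finite ((\<lambda>w. foldr (\<otimes>) w \<one>) ` ?W)"
      using S by (intro finite_imageI finite_lists_length_le) (auto simp: finite_generating_set_def)
  qed
  show "\<exists>y\<in>carrier G. word_length G S y = k \<and> word_length G S (inv y \<otimes> x) = word_length G S x - k"
    if x: "x \<in> carrier G" and k: "k \<le> word_length G S x" for x k
  proof -
    obtain u where u: "length u = word_length G S x" "set u \<subseteq> S \<union> m_inv G ` S" "foldr (\<otimes>) u \<one> = x"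
      using shortest_word[OF x] by blast
    have sub: "set (take k u) \<subseteq> S \<union> m_inv G ` S" "set (drop k u) \<subseteq> S \<union> m_inv G ` S"
      using u(2) set_take_subset[of k u] set_drop_subset[of k u] by auto
    define y z where "y = foldr (\<otimes>) (take k u) \<one>" and "z = foldr (\<otimes>) (drop k u) \<one>"
    have yz: "y \<in> carrier G" "z \<in> carrier G"
      using sub letters_closed unfolding y_def z_def by (meson foldr_mult_closed subset_trans)+
    have xyz: "x = y \<otimes> z"
      using foldr_mult_append[of "take k u" "drop k u"] sub letters_closed u(3)
      unfolding y_def z_def by (metis append_take_drop_id subset_trans)
    have "word_length G S y \<le> k" "word_length G S z \<le> word_length G S x - k"
      using word_length_le[OF sub(1) y_def[symmetric]] word_length_le[OF sub(2) z_def[symmetric]] u(1) k by auto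
    moreover have "word_length G S x \<le> word_length G S y + word_length G S z"
      unfolding xyz using yz by (rule word_length_mult)
    moreover have "inv y \<otimes> x = z" unfolding xyz using yz by (simp flip: m_assoc)
    ultimately show ?thesis using yz k by (intro bexI[of _ y]) auto
  qed
qed

text \<open>The factor is the largest \<open>L\<close> of a letter. Applied both ways, this makes
  the word lengths of two finite generating sets comparable.\<close>

lemma length_le_word_length:
  assumes "length_group G L"
  obtains \<Lambda> :: nat where "\<And>x. x \<in> carrier G \<Longrightarrow> L x \<le> \<Lambda> * word_length G S x"
proof -
  interpret length_group G L by fact
  have "finite (L ` (S \<union> m_inv G ` S))" using S by (simp add: finite_generating_set_def)
  then obtain \<Lambda> where \<Lambda>: "\<And>a. a \<in> S \<union> m_inv G ` S \<Longrightarrow> L a \<le> \<Lambda>"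
    by (metis finite_nat_set_iff_bounded_le imageI)
  have "L (foldr (\<otimes>) w \<one>) \<le> \<Lambda> * length w" if "set w \<subseteq> S \<union> m_inv G ` S" for w
    using that
  proof (induction w)
    case (Cons a w)
    have "set w \<subseteq> carrier G" "a \<in> carrier G" using Cons(2) letters_closed by auto
    then have "L (foldr (\<otimes>) (a # w) \<one>) \<le> L a + L (foldr (\<otimes>) w \<one>)"
      using L_mult by simp
    then show ?case using Cons \<Lambda>[of a] by simp
  qed (simp add: L_one)
  then show ?thesis using that shortest_word by metis
qed

end

end

section \<open>Geodesics for two comparable lengths\<close>

definition (in length_group) geodesic :: "(nat \<Rightarrow> 'g) \<Rightarrow> 'g \<Rightarrow> bool" where
  "geodesic c x \<longleftrightarrow> c 0 = \<one> \<and> c (L x) = x \<and> (\<forall>i. c i \<in> carrier G) \<and>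
    (\<forall>i j. i \<le> j \<and> j \<le> L x \<longrightarrow> L (inv (c i) \<otimes> c j) = j - i)"

lemma (in length_group) exists_geodesic:
  assumes "x \<in> carrier G"
  shows "\<exists>c. geodesic c x"
  using assms unfolding geodesic_def
proof (induction "L x" arbitrary: x)
  case 0
  then have "x = \<one>" using L_eq_0 by simp
  then show ?case by (intro exI[of _ "\<lambda>_. \<one>"]) (auto simp: L_one)
next
  case (Suc n)
  then obtain y where y: "y \<in> carrier G" "L y = n" "L (inv y \<otimes> x) = 1"
    using geodesic_split[of x n] by auto
  then obtain c :: "nat \<Rightarrow> 'g" where c: "c 0 = \<one>" "c n = y" "\<And>i. c i \<in> carrier G"
    "\<And>i j. \<lbrakk>i \<le> j; j \<le> n\<rbrakk> \<Longrightarrow> L (inv (c i) \<otimes> c j) = j - i"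
    using Suc(1)[of y] by blast
  have last: "L (inv (c i) \<otimes> x) = Suc n - i" if "i \<le> n" for i
  proof -
    have "inv (c i) \<otimes> x = (inv (c i) \<otimes> y) \<otimes> (inv y \<otimes> x)" "x = c i \<otimes> (inv (c i) \<otimes> x)"
      using c(3)[of i] y(1) Suc(3) by (simp_all add: m_assoc)
    then have "L (inv (c i) \<otimes> x) \<le> L (inv (c i) \<otimes> y) + 1" "L x \<le> L (c i) + L (inv (c i) \<otimes> x)"
      using L_mult[of "inv (c i) \<otimes> y" "inv y \<otimes> x"] L_mult[of "c i" "inv (c i) \<otimes> x"] c(3)[of i] y Suc(3)
      by simp_all
    moreover have "L (inv (c i) \<otimes> y) = n - i" "L (c i) = i"
      using c(4)[of i n] c(4)[of 0 i] c(1,2) c(3)[of i] that by simp_all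
    ultimately show ?thesis using Suc(2) that by linarith
  qed
  show ?case
  proof (intro exI[of _ "c(Suc n := x)"] conjI allI impI)
    fix i j assume ij: "i \<le> j \<and> j \<le> L x"
    then show "L (inv (c(Suc n := x)) i \<otimes> (c(Suc n := x)) j) = j - i"
      using c(4)[of i j] last[of i] Suc(2,3) L_one by (cases "j = Suc n"; cases "i = Suc n") auto
  qed (use c Suc in auto)
qed

locale comparable_lengths = hyperbolic_length G L \<delta> + other: length_group G L'
  for G :: "('g, 'm) monoid_scheme" (structure) and L \<delta> L' +
  fixes \<Lambda> :: nat
  assumes L_le: "x \<in> carrier G \<Longrightarrow> L x \<le> \<Lambda> * L' x"
    and Lambda_pos: "\<Lambda> > 0"
    and le_L: "x \<in> carrier G \<Longrightarrow> L' x \<le> \<Lambda> * L x"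
begin

text \<open>Halving the path costs one \<open>\<delta>\<close> per level, so the loss is only
  logarithmic in its length. This is what makes long detours around a point impossible.\<close>

lemma path_gp:
  fixes c :: "nat \<Rightarrow> 'g"
  assumes "p \<in> carrier G" "\<And>i. c i \<in> carrier G" "i < j" "j - i \<le> 2 ^ k"
    and "\<And>m. \<lbrakk>i \<le> m; m < j\<rbrakk> \<Longrightarrow> gp p (c m) (c (Suc m)) \<ge> B"
  shows "gp p (c i) (c j) \<ge> B - k * \<delta>"
  using assms(3-5)
proof (induction k arbitrary: i j)
  case 0
  then have "j = Suc i" by simp
  then show ?case using 0 by simp
next
  case (Suc k)
  show ?case
  proof (cases "j - i \<le> 2 ^ k")
    case True
    then have "gp p (c i) (c j) \<ge> B - k * \<delta>" using Suc by simp
    then show ?thesis using delta_nonneg by (simp add: algebra_simps)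
  next
    case False
    have "gp p (c i) (c (i + 2 ^ k)) \<ge> B - k * \<delta>" "gp p (c (i + 2 ^ k)) (c j) \<ge> B - k * \<delta>"
      using False Suc.prems by (intro Suc.IH; simp)+
    then have "gp p (c i) (c j) \<ge> (B - k * \<delta>) - \<delta>"
      using assms(1,2) by (intro hyp_ge[where y = "c (i + 2 ^ k)"]) auto
    then show ?thesis by (simp add: algebra_simps)
  qed
qed

end

lemma linear_less_power_of_two:
  fixes C :: real
  shows "\<exists>k0. \<forall>k\<ge>k0. C * (real k + 1) < 2 ^ k"
proof -
  have sq: "real k ^ 2 \<le> 2 ^ k" if "k \<ge> 4" for k :: nat
    using that
  proof (induction k rule: nat_induct_at_least)
    case (Suc k)
    have "4 * real k \<le> real k * real k" using Suc(1) by (intro mult_right_mono) auto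
    then have "2 * real k + 1 \<le> real k ^ 2"
      using Suc(1) unfolding power2_eq_square by linarith
    then have "real (Suc k) ^ 2 \<le> 2 * real k ^ 2" by (simp add: power2_eq_square algebra_simps)
    then show ?case using Suc(2) by simp
  qed simp
  have "C * (real k + 1) < 2 ^ k" if k: "k \<ge> max 4 (nat \<lceil>2 * \<bar>C\<bar>\<rceil> + 1)" for k
  proof -
    have "2 * \<bar>C\<bar> < real k" using k by linarith
    have "C * (real k + 1) \<le> \<bar>C\<bar> * (2 * real k)"
      using k by (intro mult_mono) auto
    also have "\<dots> = (2 * \<bar>C\<bar>) * real k" by simp
    also have "\<dots> < real k * real k"
      using k \<open>2 * \<bar>C\<bar> < real k\<close> by (intro mult_strict_right_mono) auto
    also have "\<dots> \<le> 2 ^ k" using sq[of k] k by (simp add: power2_eq_square)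
    finally show ?thesis .
  qed
  then show ?thesis by blast
qed

context comparable_lengths
begin

text \<open>Stability of quasigeodesics. \<open>\<gamma> i0\<close> is a point of
  \<open>\<gamma>\<close> farthest from \<open>c\<close>. Jump from \<open>\<gamma>\<close> to
  \<open>c\<close> before it, follow \<open>c\<close>, and jump back behind it: this route avoids
  the ball of radius \<open>D\<close> about the point. The part along \<open>c\<close> has at most
  \<open>2 ^ k\<close> steps, so the ends have a product of at least
  \<open>D - \<Lambda> - (k + 2) * \<delta>\<close> there, the two jumps costing one
  \<open>\<delta>\<close> each. But the point lies on a geodesic between the ends, where the product
  is 0.\<close>

lemma geodesic_near_path_aux:
  fixes \<gamma> c :: "nat \<Rightarrow> 'g" and D :: nat
  assumes \<gamma>: "\<gamma> 0 = \<one>" "\<gamma> m = t" "\<And>i. \<gamma> i \<in> carrier G"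
      "\<And>i j. \<lbrakk>i \<le> j; j \<le> m\<rbrakk> \<Longrightarrow> L (inv (\<gamma> i) \<otimes> \<gamma> j) = j - i"
    and c: "c 0 = \<one>" "c n = t" "\<And>i. c i \<in> carrier G"
      "\<And>i j. \<lbrakk>i \<le> j; j \<le> n\<rbrakk> \<Longrightarrow> L' (inv (c i) \<otimes> c j) = j - i"
    and i0: "i0 \<le> m" "\<And>j. j \<le> n \<Longrightarrow> D \<le> L (inv (\<gamma> i0) \<otimes> c j)"
    and D: "\<And>i. i \<le> m \<Longrightarrow> \<exists>j\<le>n. L (inv (\<gamma> i) \<otimes> c j) \<le> D"
    and k: "6 * \<Lambda> * D \<le> 2 ^ k"
  shows "real D \<le> \<Lambda> + (k + 2) * \<delta>"
proof -
  let ?p = "\<gamma> i0"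
  \<comment> \<open>Radius \<open>2 * D\<close> keeps a jump of at most \<open>D\<close> at distance
    \<open>D\<close> from \<open>?p\<close>. Near an end of \<open>\<gamma>\<close>, truncated
    subtraction and \<open>min\<close> stop at the end point, which also lies on
    \<open>c\<close>.\<close>
  define i1 i2 where "i1 = i0 - 2 * D" and "i2 = min m (i0 + 2 * D)"
  have i: "i1 \<le> i0" "i0 \<le> i2" "i2 \<le> m" using i0(1) by (auto simp: i1_def i2_def)
  have dp: "d ?p (c j) \<ge> D" if "j \<le> n" for j using i0(2)[OF that] by (simp add: d_def)
  have d1: "d ?p (\<gamma> i1) = i0 - i1" and d2: "d ?p (\<gamma> i2) = i2 - i0" and d12: "d (\<gamma> i1) (\<gamma> i2) = i2 - i1"
    using \<gamma>(4)[of i1 i0] \<gamma>(4)[of i0 i2] \<gamma>(4)[of i1 i2] i d_commute[of ?p "\<gamma> i1"] \<gamma>(3) by (simp_all add: d_def)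
  have "\<exists>j\<le>n. d (\<gamma> i1) (c j) \<le> D \<and> gp ?p (\<gamma> i1) (c j) \<ge> D"
  proof (cases "2 * D \<le> i0")
    case True
    obtain j where j: "j \<le> n" "d (\<gamma> i1) (c j) \<le> D" using D[of i1] i unfolding d_def by auto
    have "gp ?p (\<gamma> i1) (c j) \<ge> D"
      using gp_ge[of ?p "\<gamma> i1" "c j"] d1 j True \<gamma>(3) c(3) by (simp add: i1_def)
    then show ?thesis using j by blast
  next
    case False
    then have "\<gamma> i1 = c 0" using \<gamma>(1) c(1) by (simp add: i1_def)
    then show ?thesis using dp[of 0] c(3) by (intro exI[of _ 0]) (simp add: gp_def)
  qed
  then obtain j1 where j1: "j1 \<le> n" "d (\<gamma> i1) (c j1) \<le> D" "gp ?p (\<gamma> i1) (c j1) \<ge> D" by blast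
  have "\<exists>j\<le>n. d (\<gamma> i2) (c j) \<le> D \<and> gp ?p (\<gamma> i2) (c j) \<ge> D"
  proof (cases "i0 + 2 * D \<le> m")
    case True
    obtain j where j: "j \<le> n" "d (\<gamma> i2) (c j) \<le> D" using D[of i2] i unfolding d_def by auto
    have "gp ?p (\<gamma> i2) (c j) \<ge> D"
      using gp_ge[of ?p "\<gamma> i2" "c j"] d2 j True \<gamma>(3) c(3) by (simp add: i2_def)
    then show ?thesis using j by blast
  next
    case False
    then have "\<gamma> i2 = c n" using \<gamma>(2) c(2) by (simp add: i2_def)
    then show ?thesis using dp[of n] c(3) by (intro exI[of _ n]) (simp add: gp_def)
  qed
  then obtain j2 where j2: "j2 \<le> n" "d (\<gamma> i2) (c j2) \<le> D" "gp ?p (\<gamma> i2) (c j2) \<ge> D" by blast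
  have "d (\<gamma> i1) (\<gamma> i2) \<le> 4 * D"
    unfolding d12 by (auto simp: i1_def i2_def)
  then have d: "d (c j1) (c j2) \<le> 6 * D"
    using d_triangle[of "c j1" "\<gamma> i1" "c j2"] d_triangle[of "\<gamma> i1" "\<gamma> i2" "c j2"]
      d_commute[of "c j1" "\<gamma> i1"] j1 j2 \<gamma>(3) c(3) by simp
  have steps: "gp ?p (c m) (c (Suc m)) \<ge> real D - \<Lambda>" if "m < n" for m
  proof -
    have "L (inv (c m) \<otimes> c (Suc m)) \<le> \<Lambda>"
      using L_le[of "inv (c m) \<otimes> c (Suc m)"] c(4)[of m "Suc m"] c(3) that by simp
    then show ?thesis
      using gp_ge[of ?p "c m" "c (Suc m)"] dp[of m] \<gamma>(3) c(3) that by (simp add: d_def)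
  qed
  have span: "gp ?p (c a) (c b) \<ge> real D - \<Lambda> - k * \<delta>" if ab: "a < b" "b \<le> n" "d (c a) (c b) \<le> 6 * D" for a b
  proof (rule path_gp)
    have "L (inv (c a) \<otimes> c b) \<le> 6 * D" using ab(3) unfolding d_def by linarith
    have "L' (inv (c a) \<otimes> c b) \<le> \<Lambda> * L (inv (c a) \<otimes> c b)"
      using c(3) by (intro le_L) simp
    also have "\<dots> \<le> \<Lambda> * (6 * D)"
      using \<open>L (inv (c a) \<otimes> c b) \<le> 6 * D\<close> by (rule mult_le_mono2)
    finally have "L' (inv (c a) \<otimes> c b) \<le> 6 * \<Lambda> * D" by (simp only: mult.assoc mult.left_commute)
    then show "b - a \<le> 2 ^ k" using c(4)[of a b] ab k by simp
  qed (use ab steps \<gamma>(3) c(3) in auto)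
  have "gp ?p (c j1) (c j2) \<ge> real D - \<Lambda> - k * \<delta>"
  proof (cases j1 j2 rule: linorder_cases)
    case less
    then show ?thesis using span j2(1) d by blast
  next
    case equal
    have "0 \<le> k * \<delta>" using delta_nonneg by simp
    then show ?thesis using dp[OF j1(1)] equal c(3) by (simp add: gp_def)
  next
    case greater
    then show ?thesis
      using span[of j2 j1] j1(1) d d_commute[of "c j1" "c j2"] gp_commute[of "c j1" "c j2" ?p] c(3) by simp
  qed
  moreover have "0 \<le> k * \<delta>" using delta_nonneg by simp
  ultimately have "gp ?p (\<gamma> i1) (c j2) \<ge> (real D - \<Lambda> - k * \<delta>) - \<delta>"
    using j1(3) \<gamma>(3) c(3) by (intro hyp_ge[where y = "c j1"]) auto
  moreover have "gp ?p (c j2) (\<gamma> i2) \<ge> (real D - \<Lambda> - k * \<delta>) - \<delta>"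
    using j2(3) gp_commute[OF \<gamma>(3) c(3), of ?p i2 j2] delta_nonneg \<open>0 \<le> k * \<delta>\<close> by linarith
  ultimately have "gp ?p (\<gamma> i1) (\<gamma> i2) \<ge> ((real D - \<Lambda> - k * \<delta>) - \<delta>) - \<delta>"
    by (rule hyp_ge) (rule \<gamma>(3) c(3))+
  moreover have "gp ?p (\<gamma> i1) (\<gamma> i2) = 0"
    using d1 d2 d12 i unfolding gp_def by simp
  ultimately show ?thesis by (simp add: algebra_simps)
qed

text \<open>For the least \<open>k\<close> with \<open>6 * \<Lambda> * D \<le> 2 ^ k\<close>, the
  number \<open>2 ^ k\<close> is below \<open>12 * \<Lambda> * D\<close>, while
  \<open>geodesic_near_path_aux\<close> bounds \<open>D\<close> linearly in \<open>k\<close>. An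
  exponential below a linear function bounds \<open>k\<close>, hence \<open>D\<close>, uniformly in
  the geodesics.\<close>

lemma geodesic_near_geodesic:
  "\<exists>R::nat. \<forall>\<gamma> c t. geodesic \<gamma> t \<longrightarrow> other.geodesic c t \<longrightarrow>
    (\<forall>i\<le>L t. \<exists>j\<le>L' t. L (inv (\<gamma> i) \<otimes> c j) \<le> R)"
proof -
  define C where "C = 12 * \<Lambda> * (\<Lambda> + 2 * \<delta>)"
  obtain k0 where k0: "\<And>k. k \<ge> k0 \<Longrightarrow> C * (real k + 1) < 2 ^ k"
    using linear_less_power_of_two by blast
  have "\<exists>j\<le>n. L (inv (\<gamma> i) \<otimes> c j) \<le> 2 ^ k0"
    if geo: "geodesic \<gamma> t" "other.geodesic c t" and "i \<le> m" and mn: "m = L t" "n = L' t"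
    for \<gamma> c t i m n
  proof -
    have \<gamma>: "\<gamma> 0 = \<one>" "\<gamma> m = t" "\<And>i. \<gamma> i \<in> carrier G"
      "\<And>i j. \<lbrakk>i \<le> j; j \<le> m\<rbrakk> \<Longrightarrow> L (inv (\<gamma> i) \<otimes> \<gamma> j) = j - i"
      using geo(1) unfolding geodesic_def mn by blast+
    have c: "c 0 = \<one>" "c n = t" "\<And>i. c i \<in> carrier G"
      "\<And>i j. \<lbrakk>i \<le> j; j \<le> n\<rbrakk> \<Longrightarrow> L' (inv (c i) \<otimes> c j) = j - i"
      using geo(2) unfolding other.geodesic_def mn by blast+
    define \<rho> where "\<rho> i = Min ((\<lambda>j. L (inv (\<gamma> i) \<otimes> c j)) ` {..n})" for i
    have \<rho>: "\<rho> i \<le> L (inv (\<gamma> i) \<otimes> c j)" if "j \<le> n" for i j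
      unfolding \<rho>_def using that by (intro Min_le) auto
    have \<rho>': "\<exists>j\<le>n. L (inv (\<gamma> i) \<otimes> c j) = \<rho> i" for i
      using Min_in[of "(\<lambda>j. L (inv (\<gamma> i) \<otimes> c j)) ` {..n}"] unfolding \<rho>_def by (auto simp del: Min_in)
    define D where "D = Max (\<rho> ` {..m})"
    have D: "\<rho> i \<le> D" if "i \<le> m" for i unfolding D_def using that by (intro Max_ge) auto
    have "D \<in> \<rho> ` {..m}" unfolding D_def by (intro Max_in) auto
    then obtain i0 where i0: "i0 \<le> m" "\<rho> i0 = D" by auto
    have key: "real D \<le> \<Lambda> + (k + 2) * \<delta>" if "6 * \<Lambda> * D \<le> 2 ^ k" for k
    proof (rule geodesic_near_path_aux[OF \<gamma> c i0(1) _ _ that])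
      show "D \<le> L (inv (\<gamma> i0) \<otimes> c j)" if "j \<le> n" for j using \<rho>[OF that] i0(2) by metis
      show "\<exists>j\<le>n. L (inv (\<gamma> i) \<otimes> c j) \<le> D" if "i \<le> m" for i
        using \<rho>'[of i] D[OF that] by auto
    qed
    have "D \<le> 2 ^ k0"
    proof (rule ccontr)
      assume big: "\<not> D \<le> 2 ^ k0"
      have "\<Lambda> \<noteq> 0"
      proof
        assume "\<Lambda> = 0"
        then have "L (inv (\<gamma> i0) \<otimes> c 0) = 0"
          using L_le[of "inv (\<gamma> i0) \<otimes> c 0"] \<gamma>(3) c(3) by simp
        then show False using \<rho>[of 0 i0] i0(2) big by simp
      qed
      then have "D \<le> 6 * \<Lambda> * D" by simp
      define k where "k = (LEAST k. 6 * \<Lambda> * D \<le> 2 ^ k)"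
      have ex: "6 * \<Lambda> * D \<le> 2 ^ (6 * \<Lambda> * D)" by (rule less_imp_le[OF less_exp])
      have k: "6 * \<Lambda> * D \<le> 2 ^ k" unfolding k_def using ex by (rule LeastI)
      then have "(2::nat) ^ k0 < 2 ^ k" using big \<open>D \<le> 6 * \<Lambda> * D\<close> by linarith
      then have "k0 < k" by (simp add: power_strict_increasing_iff)
      then obtain k' where k': "k = Suc k'" by (cases k) auto
      have *: "\<not> 6 * \<Lambda> * D \<le> 2 ^ k'"
        using not_less_Least[of k' "\<lambda>k. 6 * \<Lambda> * D \<le> 2 ^ k"] k' unfolding k_def[symmetric] by simp
      have "0 \<le> \<Lambda> * real k" "0 \<le> \<delta> * k" using delta_nonneg by simp_all
      then have le: "real \<Lambda> + (real k + 2) * \<delta> \<le> (real \<Lambda> + 2 * \<delta>) * (real k + 1)"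
        by (simp add: algebra_simps)
      from * have "2 ^ k < 12 * \<Lambda> * D" unfolding k' power_Suc by linarith
      then have "(2::real) ^ k < 12 * \<Lambda> * real D"
        by (metis of_nat_less_iff of_nat_mult of_nat_numeral of_nat_power)
      also have "12 * \<Lambda> * real D \<le> 12 * \<Lambda> * (\<Lambda> + (k + 2) * \<delta>)"
        using key[OF k] by (intro mult_left_mono) (simp_all add: algebra_simps)
      also have "\<dots> \<le> 12 * \<Lambda> * ((\<Lambda> + 2 * \<delta>) * (real k + 1))"
        using le by (intro mult_left_mono) (simp_all add: add.commute)
      also have "\<dots> = C * (real k + 1)" unfolding C_def by simp
      finally show False using k0[of k] \<open>k0 < k\<close> by simp
    qed
    moreover obtain j where "j \<le> n" "L (inv (\<gamma> i) \<otimes> c j) = \<rho> i" using \<rho>' by blast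
    moreover have "\<rho> i \<le> D" using \<open>i \<le> m\<close> by (rule D)
    ultimately show ?thesis by (intro exI[of _ j]) simp
  qed
  then show ?thesis by blast
qed

text \<open>This lets a shortening found in \<open>L\<close> be measured in \<open>L'\<close>. A
  point near an \<open>L\<close>-geodesic to \<open>t\<close> is near some \<open>c j\<close> on an
  \<open>L'\<close>-geodesic, where the two lengths add up exactly; replacing \<open>p\<close> by
  \<open>c j\<close> costs at most \<open>\<Lambda> * R\<close> on each side.\<close>

lemma near_geodesic_other_length:
  "\<exists>R::nat. \<forall>p\<in>carrier G. \<forall>t\<in>carrier G. gp p \<one> t \<le> D \<longrightarrow> L' p + L' (inv p \<otimes> t) \<le> L' t + R"
proof -
  obtain R0 :: nat where R0: "\<And>\<gamma> c t i. \<lbrakk>geodesic \<gamma> t; other.geodesic c t; i \<le> L t\<rbrakk> \<Longrightarrow>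
      \<exists>j\<le>L' t. L (inv (\<gamma> i) \<otimes> c j) \<le> R0"
    using geodesic_near_geodesic by metis
  define R where "R = nat \<lceil>2 * \<bar>D\<bar> + 2 * \<delta>\<rceil> + R0"
  have R: "2 * \<bar>D\<bar> + 2 * \<delta> + R0 \<le> R" unfolding R_def by linarith
  have "L' p + L' (inv p \<otimes> t) \<le> L' t + 2 * (\<Lambda> * R)"
    if p: "p \<in> carrier G" and t: "t \<in> carrier G" and near: "gp p \<one> t \<le> D" for p t
  proof -
    obtain \<gamma> c where geo: "geodesic \<gamma> t" "other.geodesic c t"
      using exists_geodesic[OF t] other.exists_geodesic[OF t] by blast
    have \<gamma>: "\<gamma> 0 = \<one>" "\<gamma> (L t) = t" "\<forall>i. \<gamma> i \<in> carrier G"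
      "\<forall>i j. i \<le> j \<and> j \<le> L t \<longrightarrow> L (inv (\<gamma> i) \<otimes> \<gamma> j) = j - i"
      using geo(1) unfolding geodesic_def by blast+
    have c: "c 0 = \<one>" "c (L' t) = t" "\<forall>i. c i \<in> carrier G"
      "\<forall>i j. i \<le> j \<and> j \<le> L' t \<longrightarrow> L' (inv (c i) \<otimes> c j) = j - i"
      using geo(2) unfolding other.geodesic_def by blast+
    have "\<exists>i\<le>L t. d p (\<gamma> i) \<le> 2 * \<bar>D\<bar> + 2 * \<delta>"
    proof (cases "L p \<le> L t")
      case True
      let ?q = "\<gamma> (L p)"
      have q: "?q \<in> carrier G" "L ?q = L p" "d ?q t = L t - L p"
        using \<gamma>(3) \<gamma>(4)[rule_format, of 0 "L p"] \<gamma>(4)[rule_format, of "L p" "L t"] \<gamma>(1,2) True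
        by (simp_all add: d_def)
      have "gp \<one> p t \<ge> L p - \<bar>D\<bar>" using near gp_flip[of \<one> p t] p t by simp
      moreover have "gp \<one> t ?q \<ge> L p - \<bar>D\<bar>"
        using q t True d_commute[of ?q t] by (simp add: gp_def of_nat_diff)
      ultimately have "gp \<one> p ?q \<ge> L p - \<bar>D\<bar> - \<delta>"
        using p t q by (intro hyp_ge[where y = t]) auto
      then show ?thesis using p q True unfolding gp_def by (intro exI[of _ "L p"]) (simp add: field_simps)
    next
      case False
      have "d p t \<le> 2 * \<bar>D\<bar>" using near False p t by (simp add: gp_def)
      then show ?thesis using \<gamma>(2) delta_nonneg by (intro exI[of _ "L t"]) simp
    qed
    then obtain i where i: "i \<le> L t" "d p (\<gamma> i) \<le> 2 * \<bar>D\<bar> + 2 * \<delta>" by blast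
    have "\<exists>j\<le>L' t. L (inv (\<gamma> i) \<otimes> c j) \<le> R0" using R0[OF geo i(1)] .
    then obtain j where j: "j \<le> L' t" "L (inv (\<gamma> i) \<otimes> c j) \<le> R0" by blast
    have cj: "c j \<in> carrier G" using c(3) by blast
    have "d p (c j) \<le> R"
      using d_triangle[of p "\<gamma> i" "c j"] i(2) j(2) R \<gamma>(3) cj p unfolding d_def by simp
    then have "\<Lambda> * L (inv p \<otimes> c j) \<le> \<Lambda> * R" unfolding d_def by simp
    then have close: "other.d p (c j) \<le> \<Lambda> * R"
      using le_L[of "inv p \<otimes> c j"] p cj unfolding other.d_def by (meson inv_closed m_closed of_nat_le_iff order_trans)
    have "other.d \<one> (c j) = j" "other.d (c j) t = L' t - j"
      using c(4)[rule_format, of 0 j] c(4)[rule_format, of j "L' t"] c(1,2) cj j(1)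
      by (simp_all add: other.d_def)
    then have "other.d \<one> p + other.d p t \<le> L' t + 2 * (\<Lambda> * R)"
      using other.d_triangle[of \<one> "c j" p] other.d_triangle[of p "c j" t] close j(1)
        other.d_commute[of p "c j"] p t cj by (simp add: of_nat_diff)
    then have "real (L' p + L' (inv p \<otimes> t)) \<le> real (L' t + 2 * (\<Lambda> * R))"
      using p t by (simp add: other.d_def)
    then show ?thesis by (simp only: of_nat_le_iff)
  qed
  then show ?thesis by blast
qed

end


section \<open>Counting cosets\<close>

lemma (in group) r_coset_eq_iff:
  assumes "subgroup H G" "x \<in> carrier G" "y \<in> carrier G"
  shows "H #> x = H #> y \<longleftrightarrow> y \<otimes> inv x \<in> H"
proof
  assume eq: "H #> x = H #> y"
  have "y \<in> H #> x" unfolding eq using assms by (intro rcos_self)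
  then obtain h where h: "h \<in> H" "y = h \<otimes> x" by (auto simp: r_coset_def)
  then have "y \<otimes> inv x = h" using assms subgroup.mem_carrier[OF assms(1)] by (simp add: m_assoc)
  then show "y \<otimes> inv x \<in> H" using h by simp
next
  assume "y \<otimes> inv x \<in> H"
  moreover have "y = (y \<otimes> inv x) \<otimes> x" using assms by (simp add: m_assoc)
  ultimately have "y \<in> H #> x" unfolding r_coset_def by blast
  then show "H #> x = H #> y" using assms by (intro repr_independence)
qed

lemma card_image_le_card_image:
  assumes "finite A" "\<And>x y. \<lbrakk>x \<in> A; y \<in> A; f x = f y\<rbrakk> \<Longrightarrow> h x = h y"
  shows "card (h ` A) \<le> card (f ` A)"
proof -
  have "h ` A \<subseteq> (\<lambda>c. h (SOME x. x \<in> A \<and> f x = c)) ` f ` A"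
  proof
    fix z assume "z \<in> h ` A"
    then obtain x where x: "x \<in> A" "z = h x" by blast
    define s where "s = (SOME y. y \<in> A \<and> f y = f x)"
    have "\<exists>y. y \<in> A \<and> f y = f x" using x(1) by blast
    from someI_ex[OF this] have s: "s \<in> A" "f s = f x" unfolding s_def by simp_all
    have "z = h (SOME y. y \<in> A \<and> f y = f x)"
      using assms(2)[OF s(1) x(1) s(2)] x(2) unfolding s_def by simp
    then show "z \<in> (\<lambda>c. h (SOME x. x \<in> A \<and> f x = c)) ` f ` A" using x(1) by blast
  qed
  then show ?thesis using assms(1) by (intro surj_card_le) auto
qed

context comparable_lengths
begin

definition ball' :: "nat \<Rightarrow> 'g set" where
  "ball' N = {x \<in> carrier G. L' x \<le> N}"

lemma finite_ball' [simp]: "finite (ball' N)"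
  unfolding ball'_def by (rule other.finite_ball)

text \<open>Since \<open>x \<otimes> t\<close> begins along the axis, its geodesic passes near a
  power \<open>v\<close> with exponent \<open>l\<close> or \<open>- l\<close>. Moved back by
  \<open>inv x\<close>, the point \<open>p = inv x \<otimes> v\<close> lies near a geodesic from
  \<open>\<one>\<close> to \<open>t\<close>, because \<open>x\<close> leaves the axis early and so
  \<open>\<one>\<close> and \<open>inv x\<close> are on the same side of \<open>p\<close>. Cutting
  \<open>t\<close> at \<open>p\<close> leaves \<open>s\<close>; the length
  \<open>L' p \<ge> R + M0\<close> pays for the defect \<open>R\<close> and the gain
  \<open>M0\<close>.\<close>

lemma axis_prefix_coset:
  fixes R M0 l :: nat and B K K1 :: real
  assumes H: "subgroup H G" and g: "g \<in> carrier G"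
    and K: "\<And>x m. x \<in> H \<Longrightarrow> gp \<one> x (g [^] (m::int)) \<le> K"
    and K1: "\<And>(a::int) (b::int). 0 \<le> a \<and> a \<le> b \<or> b \<le> a \<and> a \<le> 0 \<Longrightarrow> gp (g [^] a) \<one> (g [^] b) \<le> K1"
    and R: "\<forall>p\<in>carrier G. \<forall>t\<in>carrier G. gp p \<one> t \<le> K1 + 2 * \<delta> \<longrightarrow> L' p + L' (inv p \<otimes> t) \<le> L' t + R"
    and l: "\<And>v. v \<in> {g [^] int l, g [^] (- int l)} \<Longrightarrow>
        L v > K + K1 + 2 * \<delta> \<and> L v \<ge> 2 * K + \<Lambda> * (R + M0) \<and> L v \<le> B"
    and B: "B > l * L g"
    and x: "x \<in> H" and t: "t \<in> carrier G" and b: "gp \<one> (x \<otimes> t) (g [^] (b::int)) \<ge> B"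
  shows "\<exists>v\<in>{g [^] int l, g [^] (- int l)}. \<exists>s\<in>carrier G. H #> t = H #> (v \<otimes> s) \<and> L' s + M0 \<le> L' t"
proof -
  have xG: "x \<in> carrier G" using H x by (rule subgroup.mem_carrier)
  \<comment> \<open>Powers with exponent up to \<open>l\<close> are too short to share
    \<open>B\<close> with anything, so the \<open>v\<close> chosen below lies between
    \<open>\<one>\<close> and \<open>g [^] b\<close>.\<close>
  have "\<bar>b\<bar> > l"
  proof (rule ccontr)
    assume "\<not> ?thesis"
    then have "nat \<bar>b\<bar> * L g \<le> l * L g" by (intro mult_le_mono1) simp
    with L_int_pow[OF g, of b] have "L (g [^] b) \<le> l * L g" by (rule order_trans)
    then have "real (L (g [^] b)) \<le> l * L g" by (simp flip: of_nat_mult)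
    then show False using gp_le(2)[of \<one> "x \<otimes> t" "g [^] b"] b B xG t g by simp
  qed
  define a where "a = (if b > 0 then int l else - int l)"
  have ab: "0 \<le> a \<and> a \<le> b \<or> b \<le> a \<and> a \<le> 0" using \<open>\<bar>b\<bar> > l\<close> by (auto simp: a_def)
  define v where "v = g [^] a"
  have v: "v \<in> {g [^] int l, g [^] (- int l)}" "v \<in> carrier G" using g by (auto simp: v_def a_def)
  note Lv = l[OF v(1)]
  define p where "p = inv x \<otimes> v"
  define s where "s = inv v \<otimes> (x \<otimes> t)"
  have G: "p \<in> carrier G" "s \<in> carrier G" using v xG t by (simp_all add: p_def s_def)
  have "gp \<one> (g [^] b) v \<ge> L v - K1"
    using gp_flip[of \<one> v "g [^] b"] K1[OF ab] gp_commute[of "g [^] b" v \<one>] v g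
    by (simp add: v_def)
  moreover have "K1 \<ge> 0"
    using K1[of 0 0] gp_nonneg[of \<one> \<one> \<one>] by simp
  ultimately have "gp \<one> (x \<otimes> t) v \<ge> L v - K1 - \<delta>"
    using b Lv xG t g v by (intro hyp_ge[where y = "g [^] b"]) auto
  then have "gp v (x \<otimes> t) \<one> \<le> K1 + \<delta>"
    using gp_flip[of \<one> v "x \<otimes> t"] gp_commute[of "x \<otimes> t" v \<one>] gp_commute[of \<one> "x \<otimes> t" v] xG t v by simp
  moreover have "gp p t (inv x) = gp v (x \<otimes> t) \<one>"
    using gp_left[of "inv x" v "x \<otimes> t" \<one>] xG t v by (simp add: p_def)
  ultimately have 1: "gp p (inv x) t \<le> K1 + \<delta>"
    using gp_commute[of t "inv x" p] xG t by simp
  have "gp p (inv x) \<one> = gp v \<one> x"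
    using gp_left[of "inv x" v \<one> x] xG v by (simp add: p_def)
  also have "\<dots> \<ge> L v - K"
    using gp_flip[of \<one> v x] gp_commute[of x v \<one>] K[OF x, of a] xG v by (simp add: v_def)
  finally have "gp p (inv x) \<one> > K1 + \<delta> + \<delta>" using Lv by linarith
  from hyp_le[OF 1 this] have "gp p \<one> t \<le> K1 + 2 * \<delta>" using G xG t by simp
  then have "L' p + L' (inv p \<otimes> t) \<le> L' t + R" using R G t by blast
  moreover have "inv p \<otimes> t = s"
    using xG v t by (simp add: p_def s_def inv_mult_group m_assoc)
  moreover have "R + M0 \<le> L' p"
  proof -
    have "real (L p) = d x v" by (simp add: p_def d_def)
    also have "\<dots> \<ge> L v - 2 * K" using K[OF x, of a] xG v unfolding gp_def by (simp add: v_def field_simps)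
    finally have "real (\<Lambda> * (R + M0)) \<le> L p" using Lv by simp
    then have "\<Lambda> * (R + M0) \<le> \<Lambda> * L' p"
      using L_le[OF G(1)] unfolding of_nat_le_iff by linarith
    then show ?thesis using Lambda_pos by simp
  qed
  ultimately have "L' s + M0 \<le> L' t" by simp
  moreover have "H #> t = H #> (v \<otimes> s)"
    using H x xG v t by (simp add: r_coset_eq_iff s_def m_assoc)
  ultimately show ?thesis using v(1) G(2) by blast
qed

definition cosets :: "'g set \<Rightarrow> nat \<Rightarrow> 'g set set" where
  "cosets H N = (\<lambda>x. H #> x) ` ball' N"

text \<open>The constants are fixed in order: \<open>K\<close>, \<open>K1\<close> and
  \<open>R\<close>, then \<open>l\<close> so that \<open>g [^] l\<close> shortens representatives by
  \<open>M0\<close>, then \<open>B\<close> and \<open>M\<close>, and last the exponent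
  \<open>n\<close>. Points that are not bad are identified by \<open>H'\<close> only if
  \<open>H\<close> identifies them. Cosets of bad points are among those of
  \<open>v \<otimes> s\<close>, with two choices of \<open>v\<close> and with \<open>s\<close> in
  the ball of radius \<open>N - M0\<close>.\<close>

lemma adjoin_power:
  fixes M0 :: nat
  assumes H: "subgroup H G" and qc: "quasiconvex H" and tf: "torsion_free H"
    and g: "g \<in> carrier G" and no: "\<And>k::nat. k > 0 \<Longrightarrow> g [^] k \<notin> H"
  shows "\<exists>H'. subgroup H' G \<and> quasiconvex H' \<and> torsion_free H' \<and> H \<subseteq> H' \<and>
    (\<exists>k::nat. k > 0 \<and> g [^] k \<in> H') \<and>
    (\<forall>N. card (cosets H N) \<le> card (cosets H' N) + (if N < M0 then 0 else 2 * card (ball' (N - M0))))"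
proof -
  have "g [^] k \<noteq> \<one>" if "k > 0" for k :: nat
    using no[OF that] subgroup.one_closed[OF H] by metis
  then have inj: "inj (\<lambda>k::int. g [^] k)" using g by (simp add: int_pow_inj_iff)
  obtain K0 where K0: "K0 \<ge> 0" "\<And>x m. x \<in> H \<Longrightarrow> gp \<one> x (g [^] (m::int)) \<le> K0"
    using power_gp_bounded[OF H qc g inj no] by blast
  obtain K where "K \<ge> K0" and
    K': "\<And>x m b. \<lbrakk>x \<in> H; x \<noteq> \<one>\<rbrakk> \<Longrightarrow> gp \<one> (g [^] (m::int)) (x \<otimes> g [^] (b::int)) \<le> K"
    using transverse_gp_bounded[OF H tf g inj K0] by blast
  have Kb: "K \<ge> 0" "\<And>x m. x \<in> H \<Longrightarrow> gp \<one> x (g [^] (m::int)) \<le> K"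
    using K0 \<open>K \<ge> K0\<close> by (auto intro: order_trans)
  obtain K1 where "K1 \<ge> 0" and
    K1: "\<And>(a::int) (b::int). 0 \<le> a \<and> a \<le> b \<or> b \<le> a \<and> a \<le> 0 \<Longrightarrow> gp (g [^] a) \<one> (g [^] b) \<le> K1"
    using loxodromic_gp[OF g infinite_order_loxodromic[OF g inj]] by blast
  obtain R :: nat where R: "\<forall>p\<in>carrier G. \<forall>t\<in>carrier G. gp p \<one> t \<le> K1 + 2 * \<delta> \<longrightarrow> L' p + L' (inv p \<otimes> t) \<le> L' t + R"
    using near_geodesic_other_length by blast
  \<comment> \<open>Dominates both lower bounds on \<open>L v\<close> in
    \<open>axis_prefix_coset\<close>.\<close>
  define B0 where "B0 = 2 * K + K1 + 2 * \<delta> + \<Lambda> * (R + M0) + 1"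
  obtain l' :: int where l': "l' > 0" "\<And>k::int. \<bar>k\<bar> \<ge> l' \<Longrightarrow> L (g [^] k) \<ge> nat \<lceil>B0\<rceil>"
    using exists_large_power[OF inj g] by blast
  define l where "l = nat l'"
  define B where "B = real (L (g [^] int l)) + real (L (g [^] (- int l))) + l * L g + 1"
  have l: "L v > K + K1 + 2 * \<delta> \<and> L v \<ge> 2 * K + \<Lambda> * (R + M0) \<and> L v \<le> B"
    if "v \<in> {g [^] int l, g [^] (- int l)}" for v
  proof -
    have "L v \<ge> nat \<lceil>B0\<rceil>" using that l'(1) l'(2)[of l'] l'(2)[of "- l'"] by (auto simp: l_def)
    then have "L v \<ge> B0" unfolding nat_ceiling_le_eq .
    moreover have "L v \<le> B" using that unfolding B_def by auto
    moreover have "0 \<le> real (\<Lambda> * (R + M0))" by simp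
    ultimately show ?thesis using Kb(1) \<open>K1 \<ge> 0\<close> delta_nonneg unfolding B0_def by linarith
  qed
  \<comment> \<open>\<open>M / 2 - \<delta>\<close>, the common piece from
    \<open>merged_coset_prefix\<close>, must be at least \<open>B\<close>; the other summands meet
    the demand of \<open>free_extension\<close>.\<close>
  define M where "M = 2 * (B + \<delta>) + 6 * K + 10 * \<delta> + 1"
  have "B > 0" unfolding B_def by (simp add: add_nonneg_pos)
  obtain n :: int where n: "n > 0" "\<And>k::int. \<bar>k\<bar> \<ge> n \<Longrightarrow> L (g [^] k) \<ge> nat \<lceil>M + 3 * K + 4 * \<delta>\<rceil>"
    using exists_large_power[OF inj g] by blast
  have n': "L (g [^] a) \<ge> M + 3 * K + 4 * \<delta>" if "a \<noteq> 0" "n dvd a" for a :: int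
  proof -
    have "\<bar>a\<bar> \<ge> n" using that zdvd_imp_le[of n "\<bar>a\<bar>"] by simp
    from n(2)[OF this] show ?thesis unfolding nat_ceiling_le_eq .
  qed
  interpret free_extension G L \<delta> H g K M n
    by (intro free_extension.intro free_extension_axioms.intro hyperbolic_length_axioms)
      (use H tf g inj Kb K' n(1) n' \<open>B > 0\<close> delta_nonneg in \<open>auto simp: M_def\<close>)
  let ?V = "{g [^] int l, g [^] (- int l)}"
  define bad where "bad t \<longleftrightarrow> (\<exists>v\<in>?V. \<exists>s\<in>carrier G. H #> t = H #> (v \<otimes> s) \<and> L' s + M0 \<le> L' t)" for t
  have bad: "bad t" if "x \<in> H" "t \<in> carrier G" "gp \<one> (x \<otimes> t) (g [^] (b::int)) \<ge> M / 2 - \<delta>" for x t b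
    unfolding bad_def
  proof (rule axis_prefix_coset[OF H g Kb(2) K1 R l _ that(1,2)])
    show "B > l * L g" unfolding B_def by (simp add: add_nonneg_pos)
    show "B \<le> gp \<one> (x \<otimes> t) (g [^] b)" using that(3) Kb(1) delta_nonneg unfolding M_def by (simp add: field_simps)
  qed
  have "card (cosets H N) \<le> card (cosets H' N) + (if N < M0 then 0 else 2 * card (ball' (N - M0)))" for N
  proof -
    define A where "A = {t \<in> ball' N. \<not> bad t}"
    \<comment> \<open>For \<open>N < M0\<close> the ball has no bad point, but truncated subtraction
      would still count a ball of radius 0.\<close>
    define E where "E = (if N < M0 then {} else (\<lambda>(v, s). H #> (v \<otimes> s)) ` (?V \<times> ball' (N - M0)))"
    have "cosets H N \<subseteq> (\<lambda>t. H #> t) ` A \<union> E"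
    proof
      fix c assume "c \<in> cosets H N"
      then obtain t where t: "t \<in> ball' N" "c = H #> t" unfolding cosets_def by blast
      show "c \<in> (\<lambda>t. H #> t) ` A \<union> E"
      proof (cases "bad t")
        case True
        then obtain v s where vs: "v \<in> ?V" "s \<in> carrier G" "c = H #> (v \<otimes> s)" "L' s + M0 \<le> L' t"
          unfolding bad_def t(2) by blast
        then have "\<not> N < M0" "s \<in> ball' (N - M0)" using t(1) by (auto simp: ball'_def)
        then have "c \<in> E" using vs unfolding E_def by force
        then show ?thesis by blast
      next
        case False
        then show ?thesis using t unfolding A_def by blast
      qed
    qed
    moreover have "finite E" "finite A" unfolding E_def A_def by auto
    ultimately have "card (cosets H N) \<le> card ((\<lambda>t. H #> t) ` A) + card E"
      by (meson card_Un_le card_mono finite_UnI finite_imageI order_trans)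
    moreover have "card E \<le> (if N < M0 then 0 else 2 * card (ball' (N - M0)))"
    proof (cases "N < M0")
      case False
      have "card E \<le> card (?V \<times> ball' (N - M0))"
        using False unfolding E_def by (simp only: if_False) (intro card_image_le finite_cartesian_product, auto)
      also have "\<dots> = card ?V * card (ball' (N - M0))" by (rule card_cartesian_product)
      also have "card ?V \<le> 2" by (simp add: card_insert_if)
      finally show ?thesis using False by simp
    qed (simp add: E_def)
    moreover have "card ((\<lambda>t. H #> t) ` A) \<le> card ((\<lambda>t. H' #> t) ` A)"
    proof (rule card_image_le_card_image[OF \<open>finite A\<close>])
      fix x y assume xy: "x \<in> A" "y \<in> A" "H' #> x = H' #> y"
      then have G: "x \<in> carrier G" "y \<in> carrier G" by (auto simp: A_def ball'_def)
      define z where "z = y \<otimes> inv x"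
      have z: "z \<in> H'" "y = z \<otimes> x"
        using xy(3) G subgroup_H' by (simp_all add: z_def r_coset_eq_iff m_assoc)
      have "z \<in> H"
      proof (rule ccontr)
        assume "z \<notin> H"
        from merged_coset_prefix[OF z(1) this G(1)] have "bad x \<or> bad y"
          using bad G z(2) by metis
        then show False using xy(1,2) by (simp add: A_def)
      qed
      then show "H #> x = H #> y" using G H by (simp add: r_coset_eq_iff z_def)
    qed
    moreover have "card ((\<lambda>t. H' #> t) ` A) \<le> card (cosets H' N)"
      unfolding cosets_def A_def by (intro card_mono finite_imageI image_mono) auto
    ultimately show ?thesis by linarith
  qed
  moreover have "g [^] nat n \<in> H'"
    using mem_H'(2)[of n] n(1) int_pow_int[of G g "nat n"] by simp
  then have "\<exists>k::nat. k > 0 \<and> g [^] k \<in> H'" using n(1) by (intro exI[of _ "nat n"]) simp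
  ultimately show ?thesis
    using subgroup_H' quasiconvex_H'[OF qc] torsion_free_H' mem_H'(1) by (intro exI[of _ H']) blast
qed

text \<open>\<open>push T a\<close> and \<open>push T b\<close> embed a ball disjointly into one
  with a slightly larger radius, since each multiplies by a fixed element at most once.\<close>

lemma ball'_doubling:
  assumes "\<not> elementary_group G"
  shows "\<exists>C. \<forall>N. 2 * card (ball' N) \<le> card (ball' (N + C))"
proof -
  have "infinite (carrier G)"
  proof
    assume "finite (carrier G)"
    \<comment> \<open>A finite group is elementary: already the trivial cyclic subgroup has finite
      index.\<close>
    then have "finite (rcosets (generate G {\<one>}))" by (auto simp: RCOSETS_def)
    then show False using assms is_group unfolding elementary_group_def by blast
  qed
  then obtain g where g: "g \<in> carrier G" "inj (\<lambda>k::int. g [^] k)"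
    using exists_infinite_order by blast
  obtain x where x: "x \<in> carrier G" "\<And>(p::int) (q::int). p \<noteq> 0 \<Longrightarrow> g [^] p \<otimes> x \<noteq> x \<otimes> g [^] q"
    using exists_transverse[OF g assms] by blast
  obtain a b T where ab: "a \<in> carrier G" "b \<in> carrier G"
    "inj_on (push T a) (carrier G)" "inj_on (push T b) (carrier G)"
    "push T a ` carrier G \<inter> push T b ` carrier G = {}"
    using exists_disjoint_pushes[OF g x] by blast
  define C where "C = max (L' a) (L' b)"
  have "2 * card (ball' N) \<le> card (ball' (N + C))" for N
  proof -
    have sub: "ball' N \<subseteq> carrier G" by (auto simp: ball'_def)
    have push: "push T v ` ball' N \<subseteq> ball' (N + C)" if "v \<in> {a, b}" for v
    proof
      fix y assume "y \<in> push T v ` ball' N"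
      then obtain h where h: "h \<in> carrier G" "L' h \<le> N" "y = h \<or> y = h \<otimes> v"
        by (auto simp: ball'_def push_def)
      have "v \<in> carrier G" "L' v \<le> C" using that ab by (auto simp: C_def)
      then show "y \<in> ball' (N + C)"
        using h other.L_mult[of h v] by (auto simp: ball'_def)
    qed
    have "2 * card (ball' N) = card (push T a ` ball' N) + card (push T b ` ball' N)"
      using ab(3,4) sub by (simp add: card_image inj_on_subset)
    also have "\<dots> = card (push T a ` ball' N \<union> push T b ` ball' N)"
      using ab(5) sub by (intro card_Un_disjoint[symmetric]) auto
    also have "\<dots> \<le> card (ball' (N + C))"
      using push by (intro card_mono) auto
    finally show ?thesis .
  qed
  then show ?thesis by blast
qed

section \<open>The chain of subgroups and its union\<close>

lemma quasiconvex_trivial: "quasiconvex {\<one>}"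
  unfolding quasiconvex_def
proof
  fix D :: real
  show "\<exists>R::nat. \<forall>h\<in>{\<one>}. \<forall>p\<in>carrier G. gp p \<one> h \<le> D \<longrightarrow> (\<exists>x\<in>{\<one>}. L (inv x \<otimes> p) \<le> R)"
  proof (intro exI[of _ "nat \<lceil>D\<rceil>"] ballI impI)
    fix h p assume "h \<in> {\<one>}" "p \<in> carrier G" "gp p \<one> h \<le> D"
    then have "L p \<le> D" by (simp add: gp_def)
    then show "\<exists>x\<in>{\<one>}. L (inv x \<otimes> p) \<le> nat \<lceil>D\<rceil>" using \<open>p \<in> carrier G\<close> by simp linarith
  qed
qed

lemma exists_maximal_growth_subgroup:
  assumes "\<not> elementary_group G"
  obtains H C where "subgroup H G" "\<And>g. g \<in> carrier G \<Longrightarrow> \<exists>k::nat. k > 0 \<and> g [^] k \<in> H"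
    "\<And>N. card (ball' N) \<le> card (cosets H (N + C))"
proof -
  let ?f = "\<lambda>N. card (ball' N)"
  obtain C where C: "\<And>N. 2 * ?f N \<le> ?f (N + C)" using ball'_doubling[OF assms] by blast
  have iter: "2 ^ j * ?f N \<le> ?f (N + j * C)" for j N
  proof (induction j)
    case (Suc j)
    have "2 ^ Suc j * ?f N \<le> 2 * ?f (N + j * C)" using Suc by simp
    also have "\<dots> \<le> ?f (N + j * C + C)" by (rule C)
    finally show ?case by (simp add: algebra_simps)
  qed simp
  have "countable (carrier G)"
  proof -
    have "carrier G = (\<Union>N. ball' N)" by (auto simp: ball'_def)
    then show ?thesis by (metis countable_UN countable_finite countableI_type finite_ball')
  qed
  then obtain e :: "nat \<Rightarrow> 'g" where e: "range e = carrier G"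
    using range_from_nat_into[of "carrier G"] one_closed by blast
  \<comment> \<open>The factor is 1 at \<open>j = 0\<close>, as the trivial subgroup requires. It
    drops by \<open>(1 / 2) ^ (j + 2)\<close> from \<open>j\<close> to \<open>Suc j\<close>, which
    is the loss allowed to that step, and stays above one half.\<close>
  define P where "P j H \<longleftrightarrow> subgroup H G \<and> quasiconvex H \<and> torsion_free H \<and>
    (\<forall>N. (1 / 2 + (1 / 2) ^ (j + 1)) * ?f N \<le> card (cosets H N))" for j :: nat and H
  define Q where "Q j H H' \<longleftrightarrow> H \<subseteq> H' \<and> (\<exists>k::nat. k > 0 \<and> e j [^] k \<in> H')" for j and H H' :: "'g set"
  have "\<exists>H. \<forall>j. P j (H j) \<and> Q j (H j) (H (Suc j))"
  proof (rule dependent_nat_choice)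
    have "card (cosets {\<one>} N) = ?f N" for N
      unfolding cosets_def by (intro card_image) (auto simp: inj_on_def ball'_def r_coset_def)
    then show "\<exists>H. P 0 H"
      unfolding P_def using triv_subgroup quasiconvex_trivial
      by (intro exI[of _ "{\<one>}"]) (auto simp: torsion_free_def)
  next
    fix H j assume P: "P j H"
    have g: "e j \<in> carrier G" using e by blast
    show "\<exists>H'. P (Suc j) H' \<and> Q j H H'"
    proof (cases "\<exists>k::nat. k > 0 \<and> e j [^] k \<in> H")
      case True
      have "(1 / 2 + (1 / 2) ^ (Suc j + 1)) * ?f N \<le> card (cosets H N)" for N
      proof -
        have "(1 / 2 + (1 / 2) ^ (Suc j + 1)) * ?f N \<le> (1 / 2 + (1 / 2) ^ (j + 1)) * real (?f N)"
          by (intro mult_right_mono) auto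
        also have "\<dots> \<le> card (cosets H N)" using P unfolding P_def by blast
        finally show ?thesis .
      qed
      then have "P (Suc j) H" using P unfolding P_def by blast
      then show ?thesis using True unfolding Q_def by blast
    next
      case False
      \<comment> \<open>\<open>j + 3\<close> doublings give
        \<open>2 ^ (j + 3) * ?f (N - M0) \<le> ?f N\<close>; the factor 2 in the loss uses up one of
        them.\<close>
      define M0 where "M0 = (j + 3) * C"
      obtain H' where H': "subgroup H' G" "quasiconvex H'" "torsion_free H'" "H \<subseteq> H'"
        "\<exists>k::nat. k > 0 \<and> e j [^] k \<in> H'"
        "\<And>N. card (cosets H N) \<le> card (cosets H' N) + (if N < M0 then 0 else 2 * ?f (N - M0))"
        using adjoin_power[of H "e j" M0] P g False unfolding P_def by blast
      have "(1 / 2 + (1 / 2) ^ (Suc j + 1)) * ?f N \<le> card (cosets H' N)" for N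
      proof -
        have loss: "real (if N < M0 then 0 else 2 * ?f (N - M0)) \<le> (1 / 2) ^ (j + 2) * ?f N"
        proof (cases "N < M0")
          case False
          then have "2 ^ (j + 3) * ?f (N - M0) \<le> ?f N"
            using iter[of "j + 3" "N - M0"] unfolding M0_def by simp
          then have "real (2 ^ (j + 3) * ?f (N - M0)) \<le> ?f N" by (simp only: of_nat_le_iff)
          then show ?thesis using False by (simp add: field_simps power_add)
        qed simp
        have "(1 / 2 + (1 / 2) ^ (j + 1)) * ?f N \<le> real (card (cosets H N))"
          using P unfolding P_def by blast
        also have "\<dots> \<le> card (cosets H' N) + real (if N < M0 then 0 else 2 * ?f (N - M0))"
          using H'(6)[of N] by (metis of_nat_add of_nat_le_iff)
        finally have "(1 / 2 + (1 / 2) ^ (j + 1)) * ?f N \<le> card (cosets H' N) + (1 / 2) ^ (j + 2) * ?f N"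
          using loss by linarith
        then show ?thesis by (simp add: algebra_simps)
      qed
      then have "P (Suc j) H'" using H' unfolding P_def by blast
      then show ?thesis using H' unfolding Q_def by blast
    qed
  qed
  then obtain H where H: "\<And>j. P j (H j)" "\<And>j. Q j (H j) (H (Suc j))" by blast
  have sub: "subgroup (H j) G" for j using H(1)[of j] unfolding P_def by (rule conjunct1)
  have "H j \<subseteq> H (Suc j)" for j using H(2)[of j] unfolding Q_def by (rule conjunct1)
  then have mono: "H i \<subseteq> H j" if "i \<le> j" for i j
    using that by (rule lift_Suc_mono_le)
  define U where "U = (\<Union>j. H j)"
  have U: "subgroup U G"
  proof
    show "U \<subseteq> carrier G" using subgroup.subset[OF sub] unfolding U_def by auto
    show "\<one> \<in> U" using subgroup.one_closed[OF sub] unfolding U_def by auto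
    show "inv x \<in> U" if "x \<in> U" for x
      using that subgroup.m_inv_closed[OF sub] unfolding U_def by auto
    show "x \<otimes> y \<in> U" if xy: "x \<in> U" "y \<in> U" for x y
    proof -
      obtain i j where "x \<in> H i" "y \<in> H j" using xy unfolding U_def by blast
      then have "x \<in> H (max i j)" "y \<in> H (max i j)" using mono[of i "max i j"] mono[of j "max i j"] by auto
      then have "x \<otimes> y \<in> H (max i j)" using subgroup.m_closed[OF sub] by simp
      then show ?thesis unfolding U_def by blast
    qed
  qed
  have powers: "\<exists>k::nat. k > 0 \<and> g [^] k \<in> U" if g: "g \<in> carrier G" for g
  proof -
    obtain j where j: "g = e j" using e g by blast
    obtain k :: nat where "k > 0" "e j [^] k \<in> H (Suc j)" using H(2)[of j] unfolding Q_def by blast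
    then show ?thesis unfolding U_def j by blast
  qed
  have half: "?f N \<le> 2 * card (cosets U N)" for N
  proof -
    \<comment> \<open>\<open>Z\<close> holds the elements of \<open>U\<close> that can identify two
      points of the ball. It is finite, so all of it lies in one \<open>H j\<close>, and there
      \<open>U\<close> and \<open>H j\<close> identify the same points of the ball.\<close>
    define Z where "Z = U \<inter> (\<lambda>(x, y). y \<otimes> inv x) ` (ball' N \<times> ball' N)"
    define J where "J z = (LEAST j. z \<in> H j)" for z
    define j where "j = Max (insert 0 (J ` Z))"
    have "finite (insert 0 (J ` Z))" unfolding Z_def by auto
    then have J_le: "J z \<le> j" if "z \<in> Z" for z
      unfolding j_def using that by (intro Max_ge) auto
    have Z_sub: "z \<in> H j" if z: "z \<in> Z" for z
    proof -
      have "\<exists>j. z \<in> H j" using z unfolding Z_def U_def by blast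
      then have "z \<in> H (J z)" unfolding J_def by (rule LeastI_ex)
      then show ?thesis using mono[OF J_le[OF z]] by blast
    qed
    have j: "y \<otimes> inv x \<in> H j" if "x \<in> ball' N" "y \<in> ball' N" "y \<otimes> inv x \<in> U" for x y
      using that by (intro Z_sub) (auto simp: Z_def)
    have "card (cosets (H j) N) \<le> card (cosets U N)"
      unfolding cosets_def
    proof (rule card_image_le_card_image)
      fix x y assume xy: "x \<in> ball' N" "y \<in> ball' N" "U #> x = U #> y"
      then have "x \<in> carrier G" "y \<in> carrier G" by (auto simp: ball'_def)
      then show "H j #> x = H j #> y" using xy j[of x y] U sub by (simp add: r_coset_eq_iff)
    qed simp
    moreover have "1 / 2 * real (?f N) \<le> (1 / 2 + (1 / 2) ^ (j + 1)) * ?f N"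
      by (intro mult_right_mono) auto
    moreover have "(1 / 2 + (1 / 2) ^ (j + 1)) * ?f N \<le> card (cosets (H j) N)"
      using H(1)[of j] unfolding P_def by blast
    ultimately show ?thesis by linarith
  qed
  \<comment> \<open>The missing half is regained by one more doubling, that is, by a shift of the
    argument.\<close>
  have "?f N \<le> card (cosets U (N + C))" for N
    using C[of N] half[of "N + C"] by linarith
  then show ?thesis using that U powers by blast
qed

end

section \<open>The action on right cosets\<close>

context group
begin

lemma transitive_right_action_rcosets:
  assumes H: "subgroup H G"
  shows "transitive_right_action G (rcosets H) (\<lambda>c g. c #> g)"
proof
  have sub: "H \<subseteq> carrier G" using H by (rule subgroup.subset)
  show "c #> g \<in> rcosets H" if "c \<in> rcosets H" "g \<in> carrier G" for c g
    using that sub by (auto simp: RCOSETS_def coset_mult_assoc)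
  show "c #> \<one> = c" if "c \<in> rcosets H" for c
    using that sub by (auto simp: RCOSETS_def coset_mult_assoc)
  show "c #> (g \<otimes> h) = c #> g #> h" if "c \<in> rcosets H" "g \<in> carrier G" "h \<in> carrier G" for c g h
    using that sub by (auto simp: RCOSETS_def coset_mult_assoc m_assoc)
  show "rcosets H \<noteq> {}" by (auto simp: RCOSETS_def)
  show "\<exists>g\<in>carrier G. c #> g = c'" if cs: "c \<in> rcosets H" "c' \<in> rcosets H" for c c'
  proof -
    obtain x where "x \<in> carrier G" "c = H #> x" using cs(1) by (auto simp: RCOSETS_def)
    moreover obtain y where "y \<in> carrier G" "c' = H #> y" using cs(2) by (auto simp: RCOSETS_def)
    ultimately show ?thesis using sub by (intro bexI[of _ "inv x \<otimes> y"]) (simp_all add: coset_mult_assoc flip: m_assoc)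
  qed
qed

text \<open>\<open>g\<close> acts on the point \<open>H #> x\<close> as the conjugate
  \<open>h = x \<otimes> g \<otimes> inv x\<close> acts on \<open>H\<close>. A power
  \<open>h [^] k\<close> in \<open>H\<close> fixes \<open>H\<close>, so only exponents modulo
  \<open>k\<close> matter. Hence powers of all conjugates of \<open>g\<close> are wanted in
  \<open>H\<close>.\<close>

lemma finite_cyclic_orbit_rcosets:
  assumes H: "subgroup H G" and pow: "\<And>g. g \<in> carrier G \<Longrightarrow> \<exists>k::nat. k > 0 \<and> g [^] k \<in> H"
    and g: "g \<in> carrier G" and c: "c \<in> rcosets H"
  shows "finite (cyclic_orbit G (\<lambda>c g. c #> g) g c)"
proof -
  have sub: "H \<subseteq> carrier G" using H by (rule subgroup.subset)
  obtain x where x: "x \<in> carrier G" "c = H #> x" using c by (auto simp: RCOSETS_def)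
  define h where "h = x \<otimes> g \<otimes> inv x"
  have h: "h \<in> carrier G" "h \<otimes> x = x \<otimes> g" using x g by (simp_all add: h_def m_assoc)
  obtain k :: nat where k: "k > 0" "h [^] k \<in> H" using pow[OF h(1)] by blast
  have "cyclic_orbit G (\<lambda>c g. c #> g) g c \<subseteq> (\<lambda>r. H #> (x \<otimes> g [^] r)) ` {0..<int k}"
  proof
    fix z assume "z \<in> cyclic_orbit G (\<lambda>c g. c #> g) g c"
    then obtain m :: int where "z = c #> g [^] m"
      using generate_pow[OF g] by (auto simp: cyclic_orbit_def)
    then have z: "z = H #> (x \<otimes> g [^] m)" using x g sub by (simp add: coset_mult_assoc)
    define q where "q = (h [^] k) [^] (m div int k)"
    have q: "q \<in> H" "q \<in> carrier G"
      using H k(2) h(1) by (simp_all add: q_def subgroup_int_pow_closed)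
    have hm: "h [^] m = q \<otimes> h [^] (m mod int k)"
      using h(1) int_pow_mult[of h "int k * (m div int k)" "m mod int k"]
      by (simp add: q_def int_pow_pow flip: int_pow_int)
    have hx: "x \<otimes> g [^] i = h [^] i \<otimes> x" for i :: int
      using int_pow_intertwine[OF h(1) g x(1) h(2), of i] by simp
    have "z = H #> (q \<otimes> (h [^] (m mod int k) \<otimes> x))"
      unfolding z hx hm using q h(1) x(1) by (simp add: m_assoc)
    also have "\<dots> = H #> q #> (h [^] (m mod int k) \<otimes> x)"
      using q h(1) x(1) sub by (simp add: coset_mult_assoc)
    also have "H #> q = H" using q H by (simp add: coset_join2)
    finally have "z = H #> (x \<otimes> g [^] (m mod int k))" unfolding hx .
    then show "z \<in> (\<lambda>r. H #> (x \<otimes> g [^] r)) ` {0..<int k}"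
      using k(1) by auto
  qed
  then show ?thesis by (rule finite_subset) simp
qed

end

theorem theorem1p1:
  fixes G :: "('g, 'm) monoid_scheme" and S :: "'g set"
  assumes "hyperbolic_group G"
    and "\<not> elementary_group G"
    and "finite_generating_set G S"
  shows "\<exists>(\<Omega> :: 'g set set) (act :: 'g set \<Rightarrow> 'g \<Rightarrow> 'g set).
           transitive_right_action G \<Omega> act \<and>
           maximal_growth G S \<Omega> act \<and>
           (\<forall>g\<in>carrier G. \<forall>x\<in>\<Omega>. finite (cyclic_orbit G act g x))"
proof -
  interpret group G using assms(1) by (simp add: hyperbolic_group_def)
  obtain S0 where S0: "finite_generating_set G S0" "gromov_hyperbolic (carrier G) (word_dist G S0)"
    using assms(1) by (auto simp: hyperbolic_group_def)
  interpret L: length_group G "word_length G S0" using S0(1) by (rule length_group_word_length)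
  interpret L': length_group G "word_length G S" using assms(3) by (rule length_group_word_length)
  have d: "L.d x y = word_dist G S0 x y" for x y by (simp add: L.d_def word_dist_def)
  obtain \<delta> where \<delta>: "\<delta> \<ge> 0" "\<And>w x y z. \<lbrakk>w \<in> carrier G; x \<in> carrier G; y \<in> carrier G; z \<in> carrier G\<rbrakk> \<Longrightarrow>
      L.gp w x z \<ge> min (L.gp w x y) (L.gp w y z) - \<delta>"
  proof -
    have "L.gp w x y = gromov_product (word_dist G S0) w x y"
      if "w \<in> carrier G" "x \<in> carrier G" "y \<in> carrier G" for w x y
      using that L.d_commute[of w x] L.d_commute[of w y] by (simp add: L.gp_def gromov_product_def d)
    then show ?thesis using S0(2) that unfolding gromov_hyperbolic_def by (metis (no_types, lifting))
  qed
  obtain \<Lambda>1 where \<Lambda>1: "\<And>x. x \<in> carrier G \<Longrightarrow> word_length G S0 x \<le> \<Lambda>1 * word_length G S x"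
    using length_le_word_length[OF assms(3) L.length_group_axioms] by blast
  obtain \<Lambda>2 where \<Lambda>2: "\<And>x. x \<in> carrier G \<Longrightarrow> word_length G S x \<le> \<Lambda>2 * word_length G S0 x"
    using length_le_word_length[OF S0(1) L'.length_group_axioms] by blast
  \<comment> \<open>The locale asks for one positive constant in both directions; this sum dominates
    either.\<close>
  have le: "a * n \<le> (\<Lambda>1 + \<Lambda>2 + 1) * n" if "a = \<Lambda>1 \<or> a = \<Lambda>2" for a n :: nat
    using that by (intro mult_le_mono1) auto
  interpret comparable_lengths G "word_length G S0" \<delta> "word_length G S" "\<Lambda>1 + \<Lambda>2 + 1"
    using \<delta> order_trans[OF \<Lambda>1 le] order_trans[OF \<Lambda>2 le] by unfold_locales auto
  have ball: "ball' N = word_ball G S N" for N by (simp add: ball'_def word_ball_def)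
  obtain H C where H: "subgroup H G" "\<And>g. g \<in> carrier G \<Longrightarrow> \<exists>k::nat. k > 0 \<and> g [^]\<^bsub>G\<^esub> k \<in> H"
    and C: "\<And>N. card (ball' N) \<le> card (cosets H (N + C))"
    using exists_maximal_growth_subgroup[OF assms(2)] by blast
  have sub: "H \<subseteq> carrier G" using H(1) by (rule subgroup.subset)
  let ?act = "\<lambda>c g. c #>\<^bsub>G\<^esub> g"
  have "growth_equiv (action_growth G S ?act p) (group_growth G S)" if p: "p \<in> rcosets\<^bsub>G\<^esub> H" for p
  proof -
    obtain y where y: "y \<in> carrier G" "p = H #>\<^bsub>G\<^esub> y" using p by (auto simp: RCOSETS_def)
    have "action_growth G S ?act p n \<le> group_growth G S (n + 0)" for n
      unfolding action_growth_def group_growth_def ball[symmetric] by (simp add: card_image_le)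
    \<comment> \<open>From the base point \<open>p\<close>, the coset of \<open>x\<close> is reached
      by \<open>inv y \<otimes> x\<close>, which adds the length of \<open>y\<close> to the shift
      \<open>C\<close>.\<close>
    moreover have "group_growth G S n \<le> action_growth G S ?act p (n + (C + word_length G S y))" for n
    proof -
      have "cosets H (n + C) \<subseteq> ?act p ` ball' (n + (C + word_length G S y))"
      proof
        fix c assume "c \<in> cosets H (n + C)"
        then obtain x where x: "x \<in> carrier G" "word_length G S x \<le> n + C" "c = H #>\<^bsub>G\<^esub> x"
          by (auto simp: cosets_def ball'_def)
        have "?act p (inv\<^bsub>G\<^esub> y \<otimes>\<^bsub>G\<^esub> x) = c"
          using x y sub by (simp add: coset_mult_assoc)
        moreover have "inv\<^bsub>G\<^esub> y \<otimes>\<^bsub>G\<^esub> x \<in> ball' (n + (C + word_length G S y))"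
          using x y L'.L_mult[of "inv\<^bsub>G\<^esub> y" x] L'.L_inv[of y] by (simp add: ball'_def)
        ultimately show "c \<in> ?act p ` ball' (n + (C + word_length G S y))" by blast
      qed
      then have "card (cosets H (n + C)) \<le> card (?act p ` ball' (n + (C + word_length G S y)))"
        by (intro card_mono) auto
      then show ?thesis
        using C[of n] unfolding group_growth_def action_growth_def ball by simp
    qed
    ultimately show ?thesis unfolding growth_equiv_def growth_le_def by blast
  qed
  then have "maximal_growth G S (rcosets\<^bsub>G\<^esub> H) ?act" unfolding maximal_growth_def by blast
  moreover have "\<forall>g\<in>carrier G. \<forall>x\<in>rcosets\<^bsub>G\<^esub> H. finite (cyclic_orbit G ?act g x)"
    using finite_cyclic_orbit_rcosets[OF H] by blast
  ultimately show ?thesis using transitive_right_action_rcosets[OF H(1)] by blast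
qed

end
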